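(* Assume $N\ge1$, $k\ge0$, that $a>0$ satisfies $a+2\langle k\rangle+N>2$, and that $\alpha,\beta\ge1$. For every $f\in L^2_{k,a}(\mathbb{R}^N)$, \[\bigl\|\|\cdot\|^{\alpha\cdot\frac a2}f\bigr\|_{L^2_{k,a}}^{\frac{\beta}{\alpha+\beta}}\bigl\|\|\cdot\|^{\beta\cdot\frac a2}\mathcal{F}_{k,a}f\bigr\|_{L^2_{k,a}}^{\frac{\alpha}{\alpha+\beta}}\ge\Bigl(\frac{2\langle k\rangle+N+a-2}{2}\Bigr)^{\frac{\alpha\beta}{\alpha+\beta}}\|f\|_{L^2_{k,a}}.\]
   Context: Let $\langle\cdot,\cdot\rangle$, $\|\cdot\|$ be the Euclidean inner product and norm on $\mathbb{R}^N$. Let $\mathcal{R}\subset\mathbb{R}^N\setminus\{0\}$ be a reduced root system with positive subsystem $\mathcal{R}^+$, let $r_\alpha(x)=x-2\frac{\langle\alpha,x\rangle}{\|\alpha\|^2}\alpha$, let $\mathfrak{C}$ be the finite group generated by the $r_\alpha$, and let $k:\mathcal{R}\to[0,\infty)$, $\alpha\mapsto k_\alpha$, be a $\mathfrak{C}$-invariant (multiplicity) function; $\langle k\rangle=\sum_{\alpha\in\mathcal{R}^+}k_\alpha$. For $a>0$ put $\vartheta_k(x)=\prod_{\alpha\in\mathcal{R}^+}|\langle\alpha,x\rangle|^{2k_\alpha}$, $\vartheta_{k,a}(x)=\|x\|^{a-2}\vartheta_k(x)$, $d\mu_{k,a}(x)=\vartheta_{k,a}(x)\,dx$, $L^p_{k,a}(\mathbb{R}^N)=L^p(\mathbb{R}^N,\mu_{k,a})$.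 The Dunkl Laplacian is $\Delta_kf(x)=\Delta f(x)+\sum_{\alpha\in\mathcal{R}^+}k_\alpha\bigl(\frac{2\langle\nabla f(x),\alpha\rangle}{\langle\alpha,x\rangle}-\|\alpha\|^2\frac{f(x)-f(r_\alpha x)}{\langle\alpha,x\rangle^2}\bigr)$. If $a+2\langle k\rangle+N>2$, the $(k,a)$-generalized Fourier transform is the unitary operator on $L^2_{k,a}(\mathbb{R}^N)$ given by $\mathcal{F}_{k,a}=\exp\bigl[\frac{i\pi}{2a}(2\langle k\rangle+N+a-2)\bigr]\exp\bigl[\frac{i\pi}{2a}(\|x\|^{2-a}\Delta_k-\|x\|^a)\bigr]$. Equivalently, it is the unitary operator determined by $\mathcal{F}_{k,a}\Phi_{\ell}(p,\cdot)=e^{-i\pi(\ell+m/a)}\Phi_\ell(p,\cdot)$ for $\ell,m\in\{0,1,2,\dots\}$ and $p$ a homogeneous polynomial of degree $m$ with $\Delta_kp=0$, where $\Phi_\ell(p,x)=p(x)L_\ell^{(\lambda_m)}(\frac2a\|x\|^a)e^{-\|x\|^a/a}$, $\lambda_m=\frac1a(2m+2\langle k\rangle+N-2)$, and $L_\ell^{(\lambda)}$ are Laguerre polynomials (these functions span a dense subspace). Here $\mathcal{F}_{k,a}$ is normalized to be unitary. Weighted norms may take the value $+\infty$. *)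

theory Defs
  imports "HOL-Analysis.Analysis"
begin

section \<open>Root systems and multiplicity functions\<close>

definition reflection :: "'a::euclidean_space \<Rightarrow> 'a \<Rightarrow> 'a" where
  "reflection \<alpha> x = x - (2 * (\<alpha> \<bullet> x) / (norm \<alpha>)\<^sup>2) *\<^sub>R \<alpha>"

text \<open>As usual in Dunkl theory, a root system need be neither crystallographic nor spanning;
  the empty root system is allowed.\<close>

definition reduced_root_system :: "'a::euclidean_space set \<Rightarrow> bool" where
  "reduced_root_system R \<longleftrightarrow>
     finite R \<and> 0 \<notin> R \<and>
     (\<forall>\<alpha>\<in>R. reflection \<alpha> ` R = R) \<and>
     (\<forall>\<alpha>\<in>R. R \<inter> span {\<alpha>} = {\<alpha>, - \<alpha>})"

definition positive_subsystem :: "'a::euclidean_space set \<Rightarrow> 'a set \<Rightarrow> bool" where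
  "positive_subsystem R P \<longleftrightarrow>
     (\<exists>v. (\<forall>\<alpha>\<in>R. \<alpha> \<bullet> v \<noteq> 0) \<and> P = {\<alpha> \<in> R. \<alpha> \<bullet> v > 0})"

text \<open>Reflections are involutions, so closure under composition already yields the group
  generated by them.\<close>

inductive_set reflection_group :: "'a::euclidean_space set \<Rightarrow> ('a \<Rightarrow> 'a) set"
  for R :: "'a set" where
  id: "id \<in> reflection_group R"
| step: "\<alpha> \<in> R \<Longrightarrow> g \<in> reflection_group R \<Longrightarrow> reflection \<alpha> \<circ> g \<in> reflection_group R"

text \<open>A multiplicity function is given on the whole space; its values outside \<open>R\<close> are never used.\<close>

definition multiplicity_function :: "'a::euclidean_space set \<Rightarrow> ('a \<Rightarrow> real) \<Rightarrow> bool" where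
  "multiplicity_function R k \<longleftrightarrow>
     (\<forall>\<alpha>\<in>R. k \<alpha> \<ge> 0) \<and> (\<forall>g\<in>reflection_group R. \<forall>\<alpha>\<in>R. k (g \<alpha>) = k \<alpha>)"

definition mult_index :: "'a::euclidean_space set \<Rightarrow> ('a \<Rightarrow> real) \<Rightarrow> real" where
  "mult_index P k = (\<Sum>\<alpha>\<in>P. k \<alpha>)"

section \<open>The weighted measure and its \<open>L\<^sup>2\<close> space\<close>

definition theta :: "'a::euclidean_space set \<Rightarrow> ('a \<Rightarrow> real) \<Rightarrow> 'a \<Rightarrow> real" where
  "theta P k x = (\<Prod>\<alpha>\<in>P. \<bar>\<alpha> \<bullet> x\<bar> powr (2 * k \<alpha>))"

text \<open>The convention \<open>0 powr s = 0\<close> (also for \<open>s \<le> 0\<close>) affects the density only on the null set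
  formed by the origin and the reflection hyperplanes.\<close>

definition mu :: "'a::euclidean_space set \<Rightarrow> ('a \<Rightarrow> real) \<Rightarrow> real \<Rightarrow> 'a measure" where
  "mu P k a = density lborel (\<lambda>x. ennreal (norm x powr (a - 2) * theta P k x))"

text \<open>Elements of \<open>L\<^sup>2\<close> are represented by functions; equality of classes is equality almost
  everywhere.\<close>

definition L2 :: "'a measure \<Rightarrow> ('a \<Rightarrow> complex) set" where
  "L2 M = {f \<in> borel_measurable M. integrable M (\<lambda>x. (cmod (f x))\<^sup>2)}"

text \<open>Real powers on \<open>[0,\<infinity>]\<close>, used with exponents \<open>s > 0\<close> only.\<close>

definition ennpowr :: "ennreal \<Rightarrow> real \<Rightarrow> ennreal" where
  "ennpowr t s = (if t = \<infinity> then \<infinity> else ennreal (enn2real t powr s))"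

definition L2norm :: "'a measure \<Rightarrow> ('a \<Rightarrow> complex) \<Rightarrow> ennreal" where
  "L2norm M f = ennpowr (\<integral>\<^sup>+ x. ennreal ((cmod (f x))\<^sup>2) \<partial>M) (1 / 2)"

definition unitary_on_L2 :: "'a measure \<Rightarrow> (('a \<Rightarrow> complex) \<Rightarrow> ('a \<Rightarrow> complex)) \<Rightarrow> bool" where
  "unitary_on_L2 M F \<longleftrightarrow>
     (\<forall>f\<in>L2 M. F f \<in> L2 M) \<and>
     (\<forall>f\<in>L2 M. \<forall>g\<in>L2 M. (AE x in M. f x = g x) \<longrightarrow> (AE x in M. F f x = F g x)) \<and>
     (\<forall>f\<in>L2 M. \<forall>g\<in>L2 M. AE x in M. F (\<lambda>y. f y + g y) x = F f x + F g x) \<and>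
     (\<forall>c. \<forall>f\<in>L2 M. AE x in M. F (\<lambda>y. c * f y) x = c * F f x) \<and>
     (\<forall>f\<in>L2 M. \<forall>g\<in>L2 M.
        (LINT x|M. F f x * cnj (F g x)) = (LINT x|M. f x * cnj (g x))) \<and>
     (\<forall>g\<in>L2 M. \<exists>f\<in>L2 M. AE x in M. F f x = g x)"

section \<open>The Dunkl Laplacian and the generalized Fourier transform\<close>

definition laplacian :: "('a::euclidean_space \<Rightarrow> complex) \<Rightarrow> 'a \<Rightarrow> complex" where
  "laplacian f x =
     (\<Sum>b\<in>Basis. frechet_derivative (\<lambda>y. frechet_derivative f (at y) b) (at x) b)"

text \<open>\<open>frechet_derivative f (at x) \<alpha>\<close> is the inner product of the gradient of \<open>f\<close> at \<open>x\<close> with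
  \<open>\<alpha>\<close>. Because of \<open>z / 0 = 0\<close>, the formula is only meaningful off the hyperplanes
  \<open>\<alpha> \<bullet> x = 0\<close>.\<close>

definition dunkl_laplacian ::
    "'a::euclidean_space set \<Rightarrow> ('a \<Rightarrow> real) \<Rightarrow> ('a \<Rightarrow> complex) \<Rightarrow> 'a \<Rightarrow> complex" where
  "dunkl_laplacian P k f x =
     laplacian f x +
     (\<Sum>\<alpha>\<in>P. of_real (k \<alpha>) *
        (2 * frechet_derivative f (at x) \<alpha> / of_real (\<alpha> \<bullet> x)
         - of_real ((norm \<alpha>)\<^sup>2) * (f x - f (reflection \<alpha> x)) / of_real ((\<alpha> \<bullet> x)\<^sup>2)))"

text \<open>Homogeneous polynomials \<open>p\<close> of degree \<open>m\<close> with \<open>\<Delta>\<^sub>k p = 0\<close>. The Dunkl Laplacian of a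
  polynomial is a polynomial, so it vanishes iff it does so off the hyperplanes, where the
  defining formula is meaningful.\<close>

definition dunkl_harmonics ::
    "'a::euclidean_space set \<Rightarrow> ('a \<Rightarrow> real) \<Rightarrow> nat \<Rightarrow> ('a \<Rightarrow> complex) set" where
  "dunkl_harmonics P k m =
     {p. polynomial_function p \<and>
         (\<forall>c x. p (c *\<^sub>R x) = of_real (c ^ m) * p x) \<and>
         (\<forall>x. (\<forall>\<alpha>\<in>P. \<alpha> \<bullet> x \<noteq> 0) \<longrightarrow> dunkl_laplacian P k p x = 0)}"

definition laguerre :: "nat \<Rightarrow> real \<Rightarrow> real \<Rightarrow> real" where
  "laguerre l s t =
     (\<Sum>j\<le>l. (- 1) ^ j * ((real l + s) gchoose (l - j)) * t ^ j / fact j)"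

definition lambda :: "'a::euclidean_space set \<Rightarrow> ('a \<Rightarrow> real) \<Rightarrow> real \<Rightarrow> nat \<Rightarrow> real" where
  "lambda P k a m = (2 * real m + 2 * mult_index P k + real DIM('a) - 2) / a"

definition Phi ::
    "'a::euclidean_space set \<Rightarrow> ('a \<Rightarrow> real) \<Rightarrow> real \<Rightarrow> nat \<Rightarrow> nat \<Rightarrow> ('a \<Rightarrow> complex) \<Rightarrow> 'a \<Rightarrow> complex"
  where
  "Phi P k a m l p x =
     p x * of_real (laguerre l (lambda P k a m) (2 / a * norm x powr a)
                    * exp (- (norm x powr a) / a))"

text \<open>The functions \<open>Phi P k a m l p\<close> span a dense subspace, so these conditions determine \<open>F\<close>
  up to equality almost everywhere.\<close>

definition is_ka_Fourier ::
    "'a::euclidean_space set \<Rightarrow> ('a \<Rightarrow> real) \<Rightarrow> real \<Rightarrow>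
     (('a \<Rightarrow> complex) \<Rightarrow> ('a \<Rightarrow> complex)) \<Rightarrow> bool" where
  "is_ka_Fourier P k a F \<longleftrightarrow>
     unitary_on_L2 (mu P k a) F \<and>
     (\<forall>l m. \<forall>p\<in>dunkl_harmonics P k m.
        AE x in mu P k a.
          F (Phi P k a m l p) x =
          exp (- \<i> * of_real (pi * (real l + real m / a))) * Phi P k a m l p x)"

end

theory Submission
  imports Defs
begin

text \<open>Put \<open>t = (2 / a) \<parallel>x\<parallel>\<^sup>a\<close>. The three-term recurrence of the Laguerre polynomials shows that
  multiplication by \<open>t\<close> acts on the functions \<open>\<Phi>\<^sub>l(p, \<cdot>)\<close> as a Jacobi matrix \<open>D - A - B\<close>, with diagonal part
  \<open>D = 2 l + \<lambda>\<^sub>m + 1\<close>, and because \<open>F\<close> multiplies consecutive \<open>\<Phi>\<^sub>l\<close> by opposite phases, \<open>F\<^sup>-\<^sup>1 t F\<close> acts as \<open>D + A + B\<close>.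
  Symmetry of both operators already forces the \<open>\<Phi>\<^sub>l(p, \<cdot>)\<close> for different \<open>(l, m)\<close> to be orthogonal, so no
  integration over spheres is needed, and Cauchy--Schwarz for the off-diagonal part gives
  \<open>\<langle>t v, v\<rangle> \<langle>t F v, F v\<rangle> \<ge> (\<lambda>\<^sub>0 + 1)\<^sup>2 \<parallel>v\<parallel>\<^sup>4\<close> for \<open>v\<close> in the span \<open>V\<close> of the \<open>\<Phi>\<^sub>l(p, \<cdot>)\<close>.

  The span is dense: \<open>\<Delta>\<^sub>k\<close> applied to \<open>\<parallel>x\<parallel>\<^sup>2\<^sup>j h\<close>, \<open>h\<close> harmonic, is a positive multiple of \<open>\<parallel>x\<parallel>\<^sup>2\<^sup>j\<^sup>-\<^sup>2 h\<close>, so every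
  homogeneous polynomial is a sum of such terms by induction on the degree, and Weierstrass approximation
  in the radial variable and in \<open>x\<close> does the rest. As \<open>D\<close> maps \<open>V\<close> onto \<open>V\<close>, density in \<open>L\<^sup>2\<close> implies that \<open>V\<close> is
  even a core for the form \<open>\<langle>t f, f\<rangle> + \<langle>t F f, F f\<rangle>\<close>, which carries the inequality over to all \<open>f\<close>. This is the
  case \<open>\<alpha> = \<beta> = 1\<close>; Jensen's inequality for \<open>s \<mapsto> s\<^sup>\<alpha>\<close> and \<open>s \<mapsto> s\<^sup>\<beta>\<close> gives the general one.\<close>

section \<open>Hermitian forms and form cores\<close>

text \<open>The passage from \<open>V\<close> to \<open>L2\<close> is the obstacle. Weighted norms
  are only lower semicontinuous under \<open>L2\<close> limits, which is the wrong direction for a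
  lower bound, and an approximant of \<open>f\<close> must have both its own weighted norm and that
  of its transform under control. So the approximants are not built by hand: they minimize the
  distance to \<open>f\<close> in the form of t + F^-1 t F. Its off-diagonal parts cancel, the
  \<open>\<Phi>\<close> are its eigenvectors with eigenvalues 2 D > 0, and this is what makes the
  minimal distance zero. Orthogonality rests on the signs. Symmetry of t is one linear relation
  between neighbouring inner products; conjugation by F reverses the sign of the off-diagonal terms
  and yields a second one, so the diagonal terms separate from the rest. The diagonal part alone
  does not suffice, since D takes equal values whenever l + m/a = l' + m'/a; those pairs need the
  off-diagonal relation too. The constant is the least value of D, \<open>lam 0 + 1\<close>, times
  the factor a/2 that turns t back into \<open>norm x powr a\<close>.\<close>

locale hermitian_form =
  fixes S :: "('a \<Rightarrow> complex) set" and B :: "('a \<Rightarrow> complex) \<Rightarrow> ('a \<Rightarrow> complex) \<Rightarrow> complex"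
  assumes add_closed: "f \<in> S \<Longrightarrow> g \<in> S \<Longrightarrow> (\<lambda>x. f x + g x) \<in> S"
    and scale_closed: "f \<in> S \<Longrightarrow> (\<lambda>x. c * f x) \<in> S"
    and add_left: "f \<in> S \<Longrightarrow> g \<in> S \<Longrightarrow> h \<in> S \<Longrightarrow> B (\<lambda>x. f x + g x) h = B f h + B g h"
    and scale_left: "f \<in> S \<Longrightarrow> g \<in> S \<Longrightarrow> B (\<lambda>x. c * f x) g = c * B f g"
    and hermitian: "f \<in> S \<Longrightarrow> g \<in> S \<Longrightarrow> B g f = cnj (B f g)"
    and nonneg: "f \<in> S \<Longrightarrow> 0 \<le> Re (B f f)"
begin

definition sq :: "('a \<Rightarrow> complex) \<Rightarrow> real" where "sq f = Re (B f f)"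

lemma sq_nonneg: "f \<in> S \<Longrightarrow> 0 \<le> sq f"
  unfolding sq_def by (rule nonneg)

lemma diff_closed:
  assumes "f \<in> S" "g \<in> S" shows "(\<lambda>x. f x - g x) \<in> S"
  using add_closed[OF assms(1) scale_closed[OF assms(2), of "-1"]] by simp

lemma add_right:
  assumes "f \<in> S" "g \<in> S" "h \<in> S"
  shows "B h (\<lambda>x. f x + g x) = B h f + B h g"
  using assms by (simp add: hermitian[of _ h] add_closed add_left)

lemma scale_right:
  assumes "f \<in> S" "g \<in> S"
  shows "B g (\<lambda>x. c * f x) = cnj c * B g f"
  using assms by (simp add: hermitian[of _ g] scale_closed scale_left)

lemma diff_left:
  assumes "f \<in> S" "g \<in> S" "h \<in> S"
  shows "B (\<lambda>x. f x - g x) h = B f h - B g h"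
  using add_left[OF assms(1) scale_closed[OF assms(2), of "-1"] assms(3)] scale_left[OF assms(2,3), of "-1"]
  by simp

lemma diff_right:
  assumes "f \<in> S" "g \<in> S" "h \<in> S"
  shows "B h (\<lambda>x. f x - g x) = B h f - B h g"
  using assms by (simp add: hermitian[of _ h] diff_closed diff_left)

lemma sq_eq:
  assumes "f \<in> S" shows "B f f = of_real (sq f)"
  using hermitian[OF assms assms] by (simp add: sq_def complex_eq_iff)

lemma sq_scale:
  assumes "f \<in> S" shows "sq (\<lambda>x. c * f x) = (cmod c)\<^sup>2 * sq f"
  using assms unfolding sq_def
  by (simp add: scale_left scale_right scale_closed sq_eq flip: mult.assoc complex_norm_square)

lemma sq_diff:
  assumes "f \<in> S" "g \<in> S"
  shows "sq (\<lambda>x. f x - g x) = sq f - 2 * Re (B f g) + sq g"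
  using assms hermitian[OF assms] unfolding sq_def
  by (simp add: diff_left diff_right diff_closed)

lemma sq_add:
  assumes "f \<in> S" "g \<in> S"
  shows "sq (\<lambda>x. f x + g x) = sq f + 2 * Re (B f g) + sq g"
  using assms hermitian[OF assms] unfolding sq_def
  by (simp add: add_left add_right add_closed)

lemma parallelogram:
  assumes "f \<in> S" "g \<in> S"
  shows "sq (\<lambda>x. f x + g x) + sq (\<lambda>x. f x - g x) = 2 * sq f + 2 * sq g"
  using assms by (simp add: sq_add sq_diff)

lemma sq_add_le:
  assumes "f \<in> S" "g \<in> S"
  shows "sq (\<lambda>x. f x + g x) \<le> 2 * sq f + 2 * sq g"
  using parallelogram[OF assms] sq_nonneg[OF diff_closed[OF assms]] by linarith

text \<open>Quantitative first variation: moving \<open>f\<close> along the multiple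
  \<open>s * B f g\<close> of \<open>g\<close> gives a real quadratic in \<open>s\<close>, and its
  value at \<open>s = 1 / sq g\<close> is the claim. With \<delta> = 0 this is Cauchy-Schwarz for a
  form that may be degenerate.\<close>

lemma near_minimizer_almost_orthogonal:
  assumes f: "f \<in> S" and g: "g \<in> S" and min: "\<And>c. \<delta> \<le> sq (\<lambda>x. f x - c * g x)"
  shows "(cmod (B f g))\<^sup>2 \<le> (sq f - \<delta>) * sq g"
proof -
  let ?b = "(cmod (B f g))\<^sup>2"
  have expand: "sq (\<lambda>x. f x - (of_real s * B f g) * g x) = sq f - 2 * s * ?b + s\<^sup>2 * ?b * sq g" for s
  proof -
    have "sq (\<lambda>x. f x - (of_real s * B f g) * g x)
      = sq f - 2 * Re (cnj (of_real s * B f g) * B f g) + (cmod (of_real s * B f g))\<^sup>2 * sq g"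
      by (subst sq_diff[OF f scale_closed[OF g]]) (simp only: scale_right[OF g f] sq_scale[OF g])
    also have "cnj (of_real s * B f g) * B f g = of_real (s * ?b)"
      using complex_norm_square[of "B f g"] by (simp add: mult_ac)
    also have "Re (of_real (s * ?b)) = s * ?b" by (rule Re_complex_of_real)
    finally show ?thesis by (simp add: norm_mult power_mult_distrib)
  qed
  have le: "\<delta> \<le> sq f - 2 * s * ?b + s\<^sup>2 * ?b * sq g" for s
    using min[of "of_real s * B f g"] expand[of s] by simp
  show ?thesis
  proof (cases "sq g = 0")
    case True
    have "?b = 0"
    proof (rule ccontr)
      assume "?b \<noteq> 0"
      \<comment> \<open>With \<open>sq g = 0\<close> the quadratic is affine in \<open>s\<close>;
        this choice of \<open>s\<close> pushes it one below \<delta>.\<close>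
      then have "\<delta> \<le> sq f - (sq f - \<delta> + 1)"
        using le[of "(sq f - \<delta> + 1) / (2 * ?b)"] True by (simp add: field_simps)
      then show False by simp
    qed
    with True show ?thesis by simp
  next
    case False
    then have pos: "sq g > 0" using sq_nonneg[OF g] by simp
    from le[of "1 / sq g"] have "\<delta> \<le> sq f - ?b / sq g"
      using pos by (simp add: power2_eq_square field_simps)
    with pos show ?thesis by (simp add: field_simps)
  qed
qed

lemma Cauchy_Schwarz:
  assumes "f \<in> S" "g \<in> S" shows "(cmod (B f g))\<^sup>2 \<le> sq f * sq g"
  using near_minimizer_almost_orthogonal[OF assms, of 0]
    sq_nonneg[OF diff_closed[OF assms(1) scale_closed[OF assms(2)]]] by simp

lemma Cauchy_Schwarz_sqrt:
  assumes "f \<in> S" "g \<in> S" shows "cmod (B f g) \<le> sqrt (sq f) * sqrt (sq g)"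
  using Cauchy_Schwarz[OF assms] by (simp add: real_le_rsqrt flip: real_sqrt_mult)

lemma zero_closed: "f \<in> S \<Longrightarrow> (\<lambda>x. 0) \<in> S"
  using scale_closed[of f 0] by simp

lemma zero_left: "f \<in> S \<Longrightarrow> B (\<lambda>x. 0) f = 0"
  using scale_left[of f f 0] by simp

lemma zero_right: "f \<in> S \<Longrightarrow> B f (\<lambda>x. 0) = 0"
  using scale_right[of f f 0] by simp

lemma sum_closed:
  assumes "finite I" "\<And>i. i \<in> I \<Longrightarrow> h i \<in> S" "(\<lambda>x. 0) \<in> S"
  shows "(\<lambda>x. \<Sum>i\<in>I. h i x) \<in> S"
  using assms by (induction rule: finite_induct) (auto intro: add_closed)

lemma sum_left:
  assumes "finite I" "\<And>i. i \<in> I \<Longrightarrow> h i \<in> S" "g \<in> S"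
  shows "B (\<lambda>x. \<Sum>i\<in>I. h i x) g = (\<Sum>i\<in>I. B (h i) g)"
  using assms
proof (induction rule: finite_induct)
  case empty
  then show ?case by (simp add: zero_left)
next
  case (insert i I)
  then show ?case using sum_closed[of I h] zero_closed[of g] by (simp add: add_left)
qed

lemma sum_right:
  assumes "finite I" "\<And>i. i \<in> I \<Longrightarrow> h i \<in> S" "g \<in> S"
  shows "B g (\<lambda>x. \<Sum>i\<in>I. h i x) = (\<Sum>i\<in>I. B g (h i))"
  using sum_left[OF assms(1,2,3)] hermitian[OF _ assms(3)] assms sum_closed[of I h] zero_closed[of g]
  by simp

lemma sq_tendsto:
  assumes f: "f \<in> S" and v: "\<And>n. v n \<in> S" and lim: "(\<lambda>n. sq (\<lambda>x. f x - v n x)) \<longlonglongrightarrow> 0"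
  shows "(\<lambda>n. sq (v n)) \<longlonglongrightarrow> sq f"
proof -
  let ?d = "\<lambda>n. (\<lambda>x. f x - v n x)"
  have d: "?d n \<in> S" for n by (rule diff_closed[OF f v])
  have eq: "sq (v n) = sq f - 2 * Re (B f (?d n)) + sq (?d n)" for n
    using sq_diff[OF f d, of n] by simp
  have "(\<lambda>n. B f (?d n)) \<longlonglongrightarrow> 0"
  proof (rule Lim_null_comparison)
    show "\<forall>\<^sub>F n in sequentially. norm (B f (?d n)) \<le> sqrt (sq f) * sqrt (sq (?d n))"
      using Cauchy_Schwarz_sqrt[OF f d] by simp
    show "(\<lambda>n. sqrt (sq f) * sqrt (sq (?d n))) \<longlonglongrightarrow> 0"
      using tendsto_mult[OF tendsto_const[of "sqrt (sq f)"] tendsto_real_sqrt[OF lim]] by simp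
  qed
  from tendsto_Re[OF this] have "(\<lambda>n. sq f - 2 * Re (B f (?d n)) + sq (?d n)) \<longlonglongrightarrow> sq f - 2 * Re 0 + 0"
    by (intro tendsto_add tendsto_diff tendsto_mult tendsto_const lim)
  then show ?thesis by (simp add: eq)
qed

end

text \<open>\<open>onto\<close> says that the operator of \<open>B\<close> maps \<open>V\<close>
  onto \<open>V\<close>. A sequence in \<open>V\<close> minimizing the \<open>B\<close>-distance to
  \<open>f\<close> has residuals that are \<open>B\<close>-Cauchy and asymptotically
  \<open>B\<close>-orthogonal to \<open>V\<close>. By \<open>onto\<close> they are asymptotically
  \<open>A\<close>-orthogonal to \<open>V\<close>, so by density they tend to zero in
  \<open>A\<close>; \<open>closed\<close> then makes them tend to zero in \<open>B\<close>. Working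
  with residuals avoids the existence of a projection.\<close>

lemma form_core:
  fixes A B :: "('a \<Rightarrow> complex) \<Rightarrow> ('a \<Rightarrow> complex) \<Rightarrow> complex"
  assumes A: "hermitian_form S A" and B: "hermitian_form T B" and TS: "T \<subseteq> S" and VT: "V \<subseteq> T"
    and V_add: "\<And>u v. u \<in> V \<Longrightarrow> v \<in> V \<Longrightarrow> (\<lambda>x. u x + v x) \<in> V"
    and V_scale: "\<And>c v. v \<in> V \<Longrightarrow> (\<lambda>x. c * v x) \<in> V"
    and dense: "\<And>f e. f \<in> S \<Longrightarrow> e > 0 \<Longrightarrow> \<exists>v\<in>V. hermitian_form.sq A (\<lambda>x. f x - v x) < e"
    and \<kappa>: "\<kappa> > 0"
    and coercive: "\<And>v. v \<in> V \<Longrightarrow> \<kappa> * hermitian_form.sq A v \<le> hermitian_form.sq B v"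
    and onto: "\<And>u. u \<in> V \<Longrightarrow> \<exists>v\<in>V. \<forall>f\<in>T. B f v = A f u"
    and closed: "\<And>g :: nat \<Rightarrow> 'a \<Rightarrow> complex. (\<And>n. g n \<in> T) \<Longrightarrow> (\<lambda>n. hermitian_form.sq A (g n)) \<longlonglongrightarrow> 0 \<Longrightarrow>
      (\<And>e. e > 0 \<Longrightarrow> \<exists>N. \<forall>n\<ge>N. hermitian_form.sq B (\<lambda>x. g n x - g N x) < e) \<Longrightarrow>
      (\<lambda>n. hermitian_form.sq B (g n)) \<longlonglongrightarrow> 0"
    and f: "f \<in> T"
  shows "\<exists>v :: nat \<Rightarrow> 'a \<Rightarrow> complex. (\<forall>n. v n \<in> V) \<and>
    (\<lambda>n. hermitian_form.sq A (\<lambda>x. f x - v n x)) \<longlonglongrightarrow> 0 \<and> (\<lambda>n. hermitian_form.sq B (\<lambda>x. f x - v n x)) \<longlonglongrightarrow> 0"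
proof -
  interpret A: hermitian_form S A by (rule A)
  interpret B: hermitian_form T B by (rule B)
  have V_diff: "(\<lambda>x. u x - v x) \<in> V" if "u \<in> V" "v \<in> V" for u v
    using V_add[OF that(1) V_scale[OF that(2), of "-1"]] by simp
  define \<delta> where "\<delta> = (INF v\<in>V. B.sq (\<lambda>x. f x - v x))"
  have sqB: "0 \<le> B.sq (\<lambda>x. f x - v x)" if "v \<in> V" for v
    using B.sq_nonneg[OF B.diff_closed[OF f]] that VT by blast
  have bdd: "bdd_below ((\<lambda>v. B.sq (\<lambda>x. f x - v x)) ` V)"
    using sqB by (intro bdd_belowI[of _ 0]) auto
  have \<delta>: "\<delta> \<le> B.sq (\<lambda>x. f x - v x)" if "v \<in> V" for v
    unfolding \<delta>_def by (rule cINF_lower[OF bdd that])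
  have "V \<noteq> {}" using dense[of f 1] f TS by auto
  have "\<exists>v\<in>V. B.sq (\<lambda>x. f x - v x) < \<delta> + 1 / Suc n" for n
    using cINF_less_iff[OF \<open>V \<noteq> {}\<close> bdd, of "\<delta> + 1 / Suc n"] unfolding \<delta>_def by simp
  then obtain v where vV: "\<And>n. v n \<in> V" and v: "\<And>n. B.sq (\<lambda>x. f x - v n x) < \<delta> + 1 / Suc n"
    by metis
  define g where "g n = (\<lambda>x. f x - v n x)" for n
  have gT: "g n \<in> T" for n unfolding g_def using B.diff_closed[OF f] vV VT by blast
  have gS: "g n \<in> S" for n using gT TS by blast
  have VS: "V \<subseteq> S" using VT TS by blast
  have cauchyB: "B.sq (\<lambda>x. g n x - g m x) \<le> 2 / Suc n + 2 / Suc m" for n m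
  proof -
    \<comment> \<open>The midpoint of \<open>v n\<close> and \<open>v m\<close> is again a
      competitor, so the parallelogram law bounds the distance of two near-minimizers.\<close>
    have mid: "(\<lambda>x. (1/2) * (v n x + v m x)) \<in> V" by (intro V_scale V_add vV)
    have "4 * \<delta> \<le> 4 * B.sq (\<lambda>x. f x - (1/2) * (v n x + v m x))" using \<delta>[OF mid] by simp
    also have "\<dots> = (cmod 2)\<^sup>2 * B.sq (\<lambda>x. f x - (1/2) * (v n x + v m x))" by simp
    also have "\<dots> = B.sq (\<lambda>x. 2 * (f x - (1/2) * (v n x + v m x)))"
      by (rule B.sq_scale[symmetric], rule B.diff_closed[OF f]) (use mid VT in blast)
    also have "(\<lambda>x. 2 * (f x - (1/2) * (v n x + v m x))) = (\<lambda>x. g n x + g m x)"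
      by (auto simp: g_def algebra_simps)
    finally have "4 * \<delta> \<le> B.sq (\<lambda>x. g n x + g m x)" .
    moreover have "B.sq (\<lambda>x. g n x + g m x) + B.sq (\<lambda>x. g n x - g m x) = 2 * B.sq (g n) + 2 * B.sq (g m)"
      by (rule B.parallelogram[OF gT gT])
    moreover have "B.sq (g n) < \<delta> + 1 / Suc n" "B.sq (g m) < \<delta> + 1 / Suc m"
      using v unfolding g_def by auto
    ultimately show ?thesis by simp
  qed
  have cauchyA: "\<kappa> * A.sq (\<lambda>x. g n x - g m x) \<le> 2 / Suc n + 2 / Suc m" for n m
  proof -
    \<comment> \<open>Residuals themselves lie outside \<open>V\<close>, but \<open>f\<close>
      cancels in their differences, so \<open>coercive\<close> applies to these.\<close>
    have eq: "(\<lambda>x. g n x - g m x) = (\<lambda>x. v m x - v n x)" by (auto simp: g_def)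
    have "\<kappa> * A.sq (\<lambda>x. g n x - g m x) \<le> B.sq (\<lambda>x. g n x - g m x)"
      unfolding eq by (rule coercive[OF V_diff[OF vV vV]])
    with cauchyB[of n m] show ?thesis by simp
  qed
  have weakB: "(\<lambda>n. B (g n) u) \<longlonglongrightarrow> 0" if u: "u \<in> V" for u
  proof (rule Lim_null_comparison)
    have uT: "u \<in> T" using u VT by blast
    have "norm (B (g n) u) \<le> sqrt (1 / Suc n * B.sq u)" for n
    proof -
      have "\<delta> \<le> B.sq (\<lambda>x. g n x - c * u x)" for c
        using \<delta>[OF V_add[OF vV V_scale[OF u]], of n c] by (simp add: g_def diff_diff_eq)
      from B.near_minimizer_almost_orthogonal[OF gT uT this]
      have "(cmod (B (g n) u))\<^sup>2 \<le> (B.sq (g n) - \<delta>) * B.sq u" .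
      also have "\<dots> \<le> 1 / Suc n * B.sq u"
        using v[of n] B.sq_nonneg[OF uT] by (intro mult_right_mono) (auto simp: g_def)
      finally show ?thesis by (rule real_le_rsqrt)
    qed
    then show "\<forall>\<^sub>F n in sequentially. norm (B (g n) u) \<le> sqrt (1 / Suc n * B.sq u)" by simp
    have "(\<lambda>n. sqrt (1 / Suc n * B.sq u)) \<longlonglongrightarrow> sqrt (0 * B.sq u)"
      by (intro tendsto_intros) (rule LIMSEQ_inverse_real_of_nat[unfolded inverse_eq_divide])
    then show "(\<lambda>n. sqrt (1 / Suc n * B.sq u)) \<longlonglongrightarrow> 0" by simp
  qed
  have weakA: "(\<lambda>n. A (g n) u) \<longlonglongrightarrow> 0" if u: "u \<in> V" for u
  proof -
    from onto[OF u] obtain w where "w \<in> V" and "\<forall>f\<in>T. B f w = A f u" by blast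
    then show ?thesis using weakB[of w] gT by simp
  qed
  have nullA: "(\<lambda>n. A.sq (g n)) \<longlonglongrightarrow> 0"
  proof (rule LIMSEQ_I)
    fix e :: real assume e: "e > 0"
    obtain N where N: "1 / real (Suc N) < \<kappa> * e / 32"
      using e \<kappa> by (metis mult_pos_pos zero_less_divide_iff zero_less_numeral nat_approx_posE)
    \<comment> \<open>A fixed \<open>w\<close> in \<open>V\<close> near \<open>g N\<close> stays
      near all later \<open>g n\<close> by the Cauchy property, while \<open>A (g n) w\<close> tends
      to 0; expanding \<open>A.sq\<close> of \<open>g n - w\<close> then bounds
      \<open>A.sq (g n)\<close> by e/2 + 2 * e/4.\<close>
    obtain w where wV: "w \<in> V" and w: "A.sq (\<lambda>x. g N x - w x) < e / 8"
      using dense[OF gS[of N], of "e/8"] e by auto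
    have wS: "w \<in> S" using wV VS by blast
    have dS: "(\<lambda>x. g n x - w x) \<in> S" for n by (rule A.diff_closed[OF gS wS])
    have near: "A.sq (\<lambda>x. g n x - w x) \<le> e / 2" if n: "n \<ge> N" for n
    proof -
      have sum: "A.sq (\<lambda>x. (g n x - g N x) + (g N x - w x))
         \<le> 2 * A.sq (\<lambda>x. g n x - g N x) + 2 * A.sq (\<lambda>x. g N x - w x)"
        by (rule A.sq_add_le[OF A.diff_closed[OF gS gS] dS])
      have "1 / real (Suc n) \<le> 1 / Suc N" using n by (simp add: field_simps)
      moreover have "2 / real (Suc n) = 2 * (1 / Suc n)" "2 / real (Suc N) = 2 * (1 / Suc N)"
        by simp_all
      ultimately have "\<kappa> * A.sq (\<lambda>x. g n x - g N x) \<le> \<kappa> * (e / 8)"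
        using cauchyA[of n N] N by linarith
      then have "A.sq (\<lambda>x. g n x - g N x) \<le> e / 8" using \<kappa> by simp
      then show ?thesis using sum w by simp
    qed
    have "(\<lambda>n. Re (A (g n) w)) \<longlonglongrightarrow> 0" using tendsto_Re[OF weakA[OF wV]] by simp
    then obtain M where M: "\<And>n. n \<ge> M \<Longrightarrow> \<bar>Re (A (g n) w)\<bar> < e / 4"
      using e LIMSEQ_D[of "\<lambda>n. Re (A (g n) w)" 0 "e/4"] by auto
    show "\<exists>no. \<forall>n\<ge>no. norm (A.sq (g n) - 0) < e"
    proof (intro exI allI impI)
      fix n assume "n \<ge> max N M"
      then have "A.sq (\<lambda>x. g n x - w x) \<le> e / 2" "\<bar>Re (A (g n) w)\<bar> < e / 4"
        using near[of n] M[of n] by auto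
      then show "norm (A.sq (g n) - 0) < e"
        using A.sq_diff[OF gS[of n] wS] A.sq_nonneg[OF gS[of n]] A.sq_nonneg[OF wS] by simp
    qed
  qed
  have nullB: "(\<lambda>n. B.sq (g n)) \<longlonglongrightarrow> 0"
  proof (rule closed[OF gT nullA])
    fix e :: real assume e: "e > 0"
    obtain N where N: "1 / real (Suc N) < e / 4"
      using e by (metis zero_less_divide_iff zero_less_numeral nat_approx_posE)
    show "\<exists>N. \<forall>n\<ge>N. B.sq (\<lambda>x. g n x - g N x) < e"
    proof (intro exI allI impI)
      fix n assume "n \<ge> N"
      then have "1 / real (Suc n) \<le> 1 / Suc N" by (simp add: field_simps)
      then show "B.sq (\<lambda>x. g n x - g N x) < e" using cauchyB[of n N] N by simp
    qed
  qed
  show ?thesis using vV nullA nullB unfolding g_def by blast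
qed

section \<open>Multiplication operators in \<open>L\<^sup>2\<close>\<close>

lemma borel_measurable_cnj [measurable (raw)]:
  "f \<in> borel_measurable M \<Longrightarrow> (\<lambda>x. cnj (f x)) \<in> borel_measurable M"
  by (rule borel_measurable_continuous_on[OF continuous_on_cnj[OF continuous_on_id]])

lemma L2_measurable: "f \<in> L2 M \<Longrightarrow> f \<in> borel_measurable M"
  by (simp add: L2_def)

lemma L2_integrable_mult:
  assumes "f \<in> L2 M" "g \<in> L2 M"
  shows "integrable M (\<lambda>x. f x * cnj (g x))"
proof (rule Bochner_Integration.integrable_bound)
  show "integrable M (\<lambda>x. (cmod (f x))\<^sup>2 + (cmod (g x))\<^sup>2)"
    using assms by (auto simp: L2_def)
  show "(\<lambda>x. f x * cnj (g x)) \<in> borel_measurable M"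
    using assms[THEN L2_measurable] by measurable
  have "cmod (f x) * cmod (g x) \<le> (cmod (f x))\<^sup>2 + (cmod (g x))\<^sup>2" for x
    using sum_squares_bound[of "cmod (f x)" "cmod (g x)"]
      mult_nonneg_nonneg[OF norm_ge_zero[of "f x"] norm_ge_zero[of "g x"]] by linarith
  then show "AE x in M. norm (f x * cnj (g x)) \<le> norm ((cmod (f x))\<^sup>2 + (cmod (g x))\<^sup>2)"
    by (simp add: norm_mult)
qed

lemma L2_scale: "f \<in> L2 M \<Longrightarrow> (\<lambda>x. c * f x) \<in> L2 M"
  by (auto simp: L2_def norm_mult power_mult_distrib)

lemma L2_bound:
  assumes "f \<in> L2 M" "g \<in> borel_measurable M" "AE x in M. cmod (g x) \<le> C * cmod (f x)"
  shows "g \<in> L2 M"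
proof -
  have "integrable M (\<lambda>x. (cmod (g x))\<^sup>2)"
  proof (rule Bochner_Integration.integrable_bound)
    show "integrable M (\<lambda>x. C\<^sup>2 * (cmod (f x))\<^sup>2)" using assms(1) by (simp add: L2_def)
    show "(\<lambda>x. (cmod (g x))\<^sup>2) \<in> borel_measurable M" using assms(2) by measurable
    show "AE x in M. norm ((cmod (g x))\<^sup>2) \<le> norm (C\<^sup>2 * (cmod (f x))\<^sup>2)"
      using assms(3)
    proof eventually_elim
      case (elim x)
      then have "(cmod (g x))\<^sup>2 \<le> (C * cmod (f x))\<^sup>2" by (intro power_mono) auto
      then show ?case by (simp add: power_mult_distrib)
    qed
  qed
  then show ?thesis using assms(2) by (simp add: L2_def)
qed

lemma L2_add:
  assumes "f \<in> L2 M" "g \<in> L2 M" shows "(\<lambda>x. f x + g x) \<in> L2 M"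
proof -
  have "integrable M (\<lambda>x. (cmod (f x + g x))\<^sup>2)"
  proof (rule Bochner_Integration.integrable_bound)
    show "integrable M (\<lambda>x. 2 * (cmod (f x))\<^sup>2 + 2 * (cmod (g x))\<^sup>2)"
      using assms by (auto simp: L2_def)
    show "(\<lambda>x. (cmod (f x + g x))\<^sup>2) \<in> borel_measurable M"
      using assms[THEN L2_measurable] by measurable
    have "(cmod (f x + g x))\<^sup>2 \<le> 2 * (cmod (f x))\<^sup>2 + 2 * (cmod (g x))\<^sup>2" for x
    proof -
      have "(cmod (f x + g x))\<^sup>2 \<le> (cmod (f x) + cmod (g x))\<^sup>2"
        by (intro power_mono norm_triangle_ineq) simp
      then show ?thesis using sum_squares_bound[of "cmod (f x)" "cmod (g x)"]
        by (simp add: power2_sum)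
    qed
    then show "AE x in M. norm ((cmod (f x + g x))\<^sup>2) \<le> norm (2 * (cmod (f x))\<^sup>2 + 2 * (cmod (g x))\<^sup>2)"
      by simp
  qed
  then show ?thesis using assms[THEN L2_measurable] by (simp add: L2_def)
qed

definition ip :: "'a measure \<Rightarrow> ('a \<Rightarrow> complex) \<Rightarrow> ('a \<Rightarrow> complex) \<Rightarrow> complex" where
  "ip M f g = (LINT x|M. f x * cnj (g x))"

lemma ip_self: "ip M f f = of_real (LINT x|M. (cmod (f x))\<^sup>2)"
  unfolding ip_def complex_norm_square[symmetric] by (rule integral_complex_of_real)

lemma ip_cong_AE:
  assumes "AE x in M. f x = f' x" "AE x in M. g x = g' x" "f \<in> borel_measurable M" "f' \<in> borel_measurable M"
    "g \<in> borel_measurable M" "g' \<in> borel_measurable M"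
  shows "ip M f g = ip M f' g'"
  unfolding ip_def using assms by (intro integral_cong_AE) auto

lemma hermitian_form_ip: "hermitian_form (L2 M) (ip M)"
proof
  fix f g h :: "'a \<Rightarrow> complex" and c
  assume f: "f \<in> L2 M" and g: "g \<in> L2 M"
  show "(\<lambda>x. f x + g x) \<in> L2 M" by (rule L2_add[OF f g])
  show "ip M g f = cnj (ip M f g)"
    unfolding ip_def by (subst Bochner_Integration.integral_cnj[symmetric]) (simp add: mult.commute)
  show "ip M (\<lambda>x. c * f x) g = c * ip M f g"
    unfolding ip_def by (simp add: mult.assoc)
  assume h: "h \<in> L2 M"
  show "ip M (\<lambda>x. f x + g x) h = ip M f h + ip M g h"
    unfolding ip_def using L2_integrable_mult[OF f h] L2_integrable_mult[OF g h]
    by (simp add: distrib_right)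
qed (auto simp: ip_self intro: L2_scale)

interpretation ip: hermitian_form "L2 M" "ip M" for M :: "'a measure"
  by (rule hermitian_form_ip)

lemma sq_ip: "ip.sq M f = (LINT x|M. (cmod (f x))\<^sup>2)"
  by (simp add: ip.sq_def ip_self)

lemma L2_zero: "(\<lambda>x. 0) \<in> L2 M"
  by (simp add: L2_def)

lemmas L2_sum = ip.sum_closed[OF _ _ L2_zero]

lemma unitary_closed: "unitary_on_L2 M F \<Longrightarrow> f \<in> L2 M \<Longrightarrow> F f \<in> L2 M"
  unfolding unitary_on_L2_def by blast

lemma unitary_add:
  "unitary_on_L2 M F \<Longrightarrow> f \<in> L2 M \<Longrightarrow> g \<in> L2 M \<Longrightarrow> AE x in M. F (\<lambda>y. f y + g y) x = F f x + F g x"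
  unfolding unitary_on_L2_def by blast

lemma unitary_scale:
  "unitary_on_L2 M F \<Longrightarrow> f \<in> L2 M \<Longrightarrow> AE x in M. F (\<lambda>y. c * f y) x = c * F f x"
  unfolding unitary_on_L2_def by blast

lemma unitary_ip:
  "unitary_on_L2 M F \<Longrightarrow> f \<in> L2 M \<Longrightarrow> g \<in> L2 M \<Longrightarrow> ip M (F f) (F g) = ip M f g"
  unfolding unitary_on_L2_def ip_def by blast

lemma unitary_zero:
  assumes "unitary_on_L2 M F" shows "AE x in M. F (\<lambda>x. 0) x = 0"
proof -
  have "AE x in M. F (\<lambda>x. 0 * 0) x = 0 * F (\<lambda>x. 0) x"
    by (rule unitary_scale[OF assms L2_zero])
  then show ?thesis by simp
qed

lemma unitary_diff:
  assumes F: "unitary_on_L2 M F" and f: "f \<in> L2 M" and g: "g \<in> L2 M"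
  shows "AE x in M. F (\<lambda>y. f y - g y) x = F f x - F g x"
proof -
  have "AE x in M. F (\<lambda>y. f y + (-1) * g y) x = F f x + F (\<lambda>x. (-1) * g x) x"
    by (rule unitary_add[OF F f L2_scale[OF g]])
  then show ?thesis using unitary_scale[OF F g, of "-1"]
    by eventually_elim simp
qed

lemma unitary_sq: "unitary_on_L2 M F \<Longrightarrow> f \<in> L2 M \<Longrightarrow> ip.sq M (F f) = ip.sq M f"
  by (simp add: ip.sq_def unitary_ip)

text \<open>The quadratic form of the operator \<open>w + F\<^sup>-\<^sup>1 w F\<close>, where \<open>w\<close> acts by multiplication.\<close>

definition form_dom :: "'a measure \<Rightarrow> ('a \<Rightarrow> real) \<Rightarrow> (('a \<Rightarrow> complex) \<Rightarrow> ('a \<Rightarrow> complex)) \<Rightarrow> ('a \<Rightarrow> complex) set" where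
  "form_dom M w F = {f \<in> L2 M. (\<lambda>x. of_real (sqrt (w x)) * f x) \<in> L2 M \<and> (\<lambda>x. of_real (sqrt (w x)) * F f x) \<in> L2 M}"

text \<open>The weight is split as a square root on each side: the form lives on its natural domain
  \<open>wL2\<close>, larger than that of multiplication by \<open>w\<close>, and inherits its
  Hermitian properties from \<open>ip\<close>.\<close>

definition wip :: "'a measure \<Rightarrow> ('a \<Rightarrow> real) \<Rightarrow> ('a \<Rightarrow> complex) \<Rightarrow> ('a \<Rightarrow> complex) \<Rightarrow> complex" where
  "wip M w f g = ip M (\<lambda>x. of_real (sqrt (w x)) * f x) (\<lambda>x. of_real (sqrt (w x)) * g x)"

definition form :: "'a measure \<Rightarrow> ('a \<Rightarrow> real) \<Rightarrow> (('a \<Rightarrow> complex) \<Rightarrow> ('a \<Rightarrow> complex)) \<Rightarrow> ('a \<Rightarrow> complex) \<Rightarrow> ('a \<Rightarrow> complex) \<Rightarrow> complex" where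
  "form M w F f g = wip M w f g + wip M w (F f) (F g)"

definition wL2 :: "'a measure \<Rightarrow> ('a \<Rightarrow> real) \<Rightarrow> ('a \<Rightarrow> complex) set" where
  "wL2 M w = {f \<in> L2 M. (\<lambda>x. of_real (sqrt (w x)) * f x) \<in> L2 M}"

lemma hermitian_form_wip: "hermitian_form (wL2 M w) (wip M w)"
proof
  fix f g h :: "'a \<Rightarrow> complex" and c
  let ?s = "\<lambda>f x. of_real (sqrt (w x)) * f x :: complex"
  assume f: "f \<in> wL2 M w" and g: "g \<in> wL2 M w"
  have sf: "f \<in> L2 M" "?s f \<in> L2 M" and sg: "g \<in> L2 M" "?s g \<in> L2 M"
    using f g by (simp_all add: wL2_def)
  show "(\<lambda>x. f x + g x) \<in> wL2 M w"
    using L2_add[OF sf(1) sg(1)] L2_add[OF sf(2) sg(2)] by (simp add: wL2_def distrib_left)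
  show "(\<lambda>x. c * f x) \<in> wL2 M w"
    using L2_scale[OF sf(1), of c] L2_scale[OF sf(2), of c] by (simp add: wL2_def mult.left_commute)
  show "wip M w g f = cnj (wip M w f g)"
    unfolding wip_def by (rule ip.hermitian[OF sf(2) sg(2)])
  show "wip M w (\<lambda>x. c * f x) g = c * wip M w f g"
    using ip.scale_left[OF sf(2) sg(2), of c] by (simp add: wip_def mult.left_commute)
  show "0 \<le> Re (wip M w f f)"
    unfolding wip_def by (rule ip.nonneg[OF sf(2)])
  assume "h \<in> wL2 M w"
  then have "?s h \<in> L2 M" by (simp add: wL2_def)
  from ip.add_left[OF sf(2) sg(2) this]
  show "wip M w (\<lambda>x. f x + g x) h = wip M w f h + wip M w g h"
    by (simp add: wip_def distrib_left)
qed

interpretation wip: hermitian_form "wL2 M w" "wip M w" for M :: "'a measure" and w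
  by (rule hermitian_form_wip)

lemma wip_cong_AE:
  assumes "AE x in M. f x = f' x" "AE x in M. g x = g' x" "f \<in> borel_measurable M" "f' \<in> borel_measurable M"
    "g \<in> borel_measurable M" "g' \<in> borel_measurable M" "w \<in> borel_measurable M"
  shows "wip M w f g = wip M w f' g'"
  unfolding wip_def
proof (intro ip_cong_AE)
  show "AE x in M. of_real (sqrt (w x)) * f x = of_real (sqrt (w x)) * f' x"
    using assms(1) by eventually_elim simp
  show "AE x in M. of_real (sqrt (w x)) * g x = of_real (sqrt (w x)) * g' x"
    using assms(2) by eventually_elim simp
qed (use assms in measurable)

lemma wL2_cong_AE:
  assumes "f \<in> wL2 M w" "AE x in M. f x = f' x" "f' \<in> borel_measurable M" "w \<in> borel_measurable M"
  shows "f' \<in> wL2 M w"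
proof -
  let ?s = "\<lambda>f x. of_real (sqrt (w x)) * f x :: complex"
  have "f' \<in> L2 M"
  proof (rule L2_bound)
    show "f \<in> L2 M" using assms(1) by (simp add: wL2_def)
    show "AE x in M. cmod (f' x) \<le> 1 * cmod (f x)" using assms(2) by eventually_elim simp
  qed (rule assms)
  moreover have "?s f' \<in> L2 M"
  proof (rule L2_bound)
    show "?s f \<in> L2 M" using assms(1) by (simp add: wL2_def)
    show "AE x in M. cmod (?s f' x) \<le> 1 * cmod (?s f x)" using assms(2) by eventually_elim simp
    show "?s f' \<in> borel_measurable M" using assms(3,4) by measurable
  qed
  ultimately show ?thesis by (simp add: wL2_def)
qed

lemma form_dom_eq:
  assumes "unitary_on_L2 M F"
  shows "form_dom M w F = {f \<in> wL2 M w. F f \<in> wL2 M w}"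
  unfolding form_dom_def wL2_def using unitary_closed[OF assms] by auto

text \<open>\<open>F\<close> is linear only almost everywhere, so every algebraic law on the
  transformed side is transported along an AE equality.\<close>

lemma hermitian_form_form:
  assumes F: "unitary_on_L2 M F" and w: "w \<in> borel_measurable M"
  shows "hermitian_form (form_dom M w F) (form M w F)"
proof
  fix f g h :: "'a \<Rightarrow> complex" and c
  assume f: "f \<in> form_dom M w F" and g: "g \<in> form_dom M w F"
  have f': "f \<in> wL2 M w" "F f \<in> wL2 M w" "f \<in> L2 M" "F f \<in> L2 M"
    and g': "g \<in> wL2 M w" "F g \<in> wL2 M w" "g \<in> L2 M" "F g \<in> L2 M"
    using f g form_dom_eq[OF F] by (auto simp: wL2_def)
  have add: "AE x in M. F f x + F g x = F (\<lambda>y. f y + g y) x"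
    using unitary_add[OF F f'(3) g'(3)] by eventually_elim simp
  have scale: "AE x in M. c * F f x = F (\<lambda>y. c * f y) x"
    using unitary_scale[OF F f'(3), of c] by eventually_elim simp
  note meas = L2_measurable[OF unitary_closed[OF F L2_add[OF f'(3) g'(3)]]]
    L2_measurable[OF L2_add[OF f'(4) g'(4)]]
    L2_measurable[OF unitary_closed[OF F L2_scale[OF f'(3)]]] L2_measurable[OF L2_scale[OF f'(4)]]
  show "(\<lambda>x. f x + g x) \<in> form_dom M w F"
    unfolding form_dom_eq[OF F]
    using wL2_cong_AE[OF wip.add_closed[OF f'(2) g'(2)] add meas(1) w] wip.add_closed[OF f'(1) g'(1)] by simp
  show "(\<lambda>x. c * f x) \<in> form_dom M w F"
    unfolding form_dom_eq[OF F]
    using wL2_cong_AE[OF wip.scale_closed[OF f'(2)] scale meas(3) w] wip.scale_closed[OF f'(1)] by simp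
  show "form M w F g f = cnj (form M w F f g)"
    unfolding form_def using wip.hermitian[OF f'(1) g'(1)] wip.hermitian[OF f'(2) g'(2)] by simp
  show "0 \<le> Re (form M w F f f)"
    unfolding form_def using wip.nonneg[OF f'(1)] wip.nonneg[OF f'(2)] by simp
  show "form M w F (\<lambda>x. c * f x) g = c * form M w F f g"
  proof -
    have "wip M w (F (\<lambda>x. c * f x)) (F g) = wip M w (\<lambda>x. c * F f x) (F g)"
      using scale meas w g'(4) by (intro wip_cong_AE) (auto intro: L2_measurable)
    then show ?thesis
      unfolding form_def using wip.scale_left[OF f'(1) g'(1)] wip.scale_left[OF f'(2) g'(2)]
      by (simp add: distrib_left)
  qed
  assume h: "h \<in> form_dom M w F"
  have h': "h \<in> wL2 M w" "F h \<in> wL2 M w" "h \<in> L2 M" "F h \<in> L2 M"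
    using h form_dom_eq[OF F] by (auto simp: wL2_def)
  have "wip M w (F (\<lambda>x. f x + g x)) (F h) = wip M w (\<lambda>x. F f x + F g x) (F h)"
    using add meas w h'(4) by (intro wip_cong_AE) (auto intro: L2_measurable)
  then show "form M w F (\<lambda>x. f x + g x) h = form M w F f h + form M w F g h"
    unfolding form_def using wip.add_left[OF f'(1) g'(1) h'(1)] wip.add_left[OF f'(2) g'(2) h'(2)] by simp
qed

lemma sq_wip:
  assumes "\<And>x. 0 \<le> w x"
  shows "wip.sq M w f = (LINT x|M. w x * (cmod (f x))\<^sup>2)"
  unfolding wip.sq_def wip_def ip_self using assms by (simp add: norm_mult power_mult_distrib)

text \<open>Fix \<open>N\<close> by the Cauchy property, then a level \<open>R\<close> so large that
  \<open>g N\<close> has little weighted mass where \<open>w > R\<close>. Below the level the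
  weighted norm is at most \<open>R\<close> times the vanishing \<open>L2\<close> norm; above it
  \<open>g n\<close> is compared with \<open>g N\<close>.\<close>

lemma wip_closed:
  fixes g :: "nat \<Rightarrow> 'a \<Rightarrow> complex"
  assumes w: "w \<in> borel_measurable M" "\<And>x. 0 \<le> w x"
    and g: "\<And>n. g n \<in> wL2 M w" and null: "(\<lambda>n. ip.sq M (g n)) \<longlonglongrightarrow> 0"
    and cauchy: "\<And>e. e > 0 \<Longrightarrow> \<exists>N. \<forall>n\<ge>N. wip.sq M w (\<lambda>x. g n x - g N x) < e"
  shows "(\<lambda>n. wip.sq M w (g n)) \<longlonglongrightarrow> 0"
proof (rule LIMSEQ_I)
  fix e :: real assume e: "e > 0"
  obtain N where N: "\<And>n. n \<ge> N \<Longrightarrow> wip.sq M w (\<lambda>x. g n x - g N x) < e / 8"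
    using cauchy[of "e/8"] e by auto
  have gL2: "g n \<in> L2 M" for n using g[of n] by (simp add: wL2_def)
  have wint: "integrable M (\<lambda>x. w x * (cmod (h x))\<^sup>2)" if "h \<in> wL2 M w" for h
    using that w(2) by (simp add: wL2_def L2_def norm_mult power_mult_distrib)
  have "(\<lambda>R. LINT x|M. indicator {x. w x > real R} x * (w x * (cmod (g N x))\<^sup>2)) \<longlonglongrightarrow> (LINT x|M. 0)"
  proof (rule integral_dominated_convergence)
    show "integrable M (\<lambda>x. w x * (cmod (g N x))\<^sup>2)" by (rule wint[OF g])
    show "(\<lambda>x. indicator {x. w x > real R} x * (w x * (cmod (g N x))\<^sup>2)) \<in> borel_measurable M" for R
      using w(1) gL2[of N] by (auto simp: L2_def intro!: borel_measurable_times borel_measurable_indicator')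
    show "AE x in M. (\<lambda>R. indicator {x. w x > real R} x * (w x * (cmod (g N x))\<^sup>2)) \<longlonglongrightarrow> 0"
    proof (rule AE_I2)
      fix x
      obtain R0 where R0: "w x \<le> real R0" using real_arch_simple by blast
      have "\<forall>\<^sub>F R in sequentially. indicator {x. w x > real R} x * (w x * (cmod (g N x))\<^sup>2) = 0"
        using eventually_ge_at_top[of R0]
      proof eventually_elim
        case (elim R)
        then have "w x \<le> real R" using R0 by linarith
        then show ?case by (simp add: indicator_def)
      qed
      then show "(\<lambda>R. indicator {x. w x > real R} x * (w x * (cmod (g N x))\<^sup>2)) \<longlonglongrightarrow> 0"
        by (rule tendsto_eventually)
    qed
    show "AE x in M. norm (indicator {x. w x > real R} x * (w x * (cmod (g N x))\<^sup>2)) \<le> w x * (cmod (g N x))\<^sup>2" for R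
      using w(2) by (auto simp: indicator_def)
  qed auto
  then obtain R where R: "\<bar>LINT x|M. indicator {x. w x > real R} x * (w x * (cmod (g N x))\<^sup>2)\<bar> < e / 8"
    using e LIMSEQ_D[of _ 0 "e/8"] by fastforce
  let ?tail = "LINT x|M. indicator {x. w x > real R} x * (w x * (cmod (g N x))\<^sup>2)"
  have "(\<lambda>n. real R * ip.sq M (g n)) \<longlonglongrightarrow> real R * 0" by (intro tendsto_intros null)
  then obtain M0 where M0: "\<And>n. n \<ge> M0 \<Longrightarrow> real R * ip.sq M (g n) < e / 2"
    using e LIMSEQ_D[of "\<lambda>n. real R * ip.sq M (g n)" 0 "e/2"] by fastforce
  show "\<exists>no. \<forall>n\<ge>no. norm (wip.sq M w (g n) - 0) < e"
  proof (intro exI allI impI)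
    fix n assume n: "n \<ge> max N M0"
    have dL2: "(\<lambda>x. g n x - g N x) \<in> wL2 M w" by (rule wip.diff_closed[OF g g])
    have bound: "w x * (cmod (g n x))\<^sup>2 \<le> real R * (cmod (g n x))\<^sup>2
        + (2 * (indicator {x. w x > real R} x * (w x * (cmod (g N x))\<^sup>2)) + 2 * (w x * (cmod (g n x - g N x))\<^sup>2))" for x
    proof (cases "w x > real R")
      case True
      have "(cmod (g n x))\<^sup>2 \<le> (cmod (g N x) + cmod (g n x - g N x))\<^sup>2"
        using norm_triangle_sub[of "g n x" "g N x"] by (intro power_mono) auto
      also have "\<dots> \<le> 2 * (cmod (g N x))\<^sup>2 + 2 * (cmod (g n x - g N x))\<^sup>2"
        using sum_squares_bound[of "cmod (g N x)" "cmod (g n x - g N x)"] by (simp add: power2_sum)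
      finally have "w x * (cmod (g n x))\<^sup>2 \<le> w x * (2 * (cmod (g N x))\<^sup>2 + 2 * (cmod (g n x - g N x))\<^sup>2)"
        by (rule mult_left_mono) (rule w(2))
      then show ?thesis using True by (simp add: algebra_simps add_increasing)
    next
      case False
      then have "w x * (cmod (g n x))\<^sup>2 \<le> real R * (cmod (g n x))\<^sup>2" by (intro mult_right_mono) auto
      then show ?thesis using False w(2)[of x] by (simp add: add_increasing2)
    qed
    have i1: "integrable M (\<lambda>x. real R * (cmod (g n x))\<^sup>2)" using gL2[of n] by (simp add: L2_def)
    have i2: "integrable M (\<lambda>x. indicator {x. w x > real R} x * (w x * (cmod (g N x))\<^sup>2))"
    proof (rule Bochner_Integration.integrable_bound[OF wint[OF g[of N]]])
      show "(\<lambda>x. indicator {x. w x > real R} x * (w x * (cmod (g N x))\<^sup>2)) \<in> borel_measurable M"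
        using w(1) gL2[of N] by (auto simp: L2_def intro!: borel_measurable_times borel_measurable_indicator')
    qed (use w(2) in \<open>auto simp: indicator_def\<close>)
    have "wip.sq M w (g n) \<le> (LINT x|M. real R * (cmod (g n x))\<^sup>2
        + (2 * (indicator {x. w x > real R} x * (w x * (cmod (g N x))\<^sup>2)) + 2 * (w x * (cmod (g n x - g N x))\<^sup>2)))"
      unfolding sq_wip[OF w(2)] using i1 i2 wint[OF g[of n]] wint[OF dL2]
      by (intro integral_mono bound) auto
    also have "\<dots> = real R * ip.sq M (g n) + 2 * ?tail + 2 * wip.sq M w (\<lambda>x. g n x - g N x)"
      using i1 i2 wint[OF dL2] by (simp add: sq_wip[OF w(2)] sq_ip)
    finally have "wip.sq M w (g n) < e"
      using R M0[of n] N[of n] n by auto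
    then show "norm (wip.sq M w (g n) - 0) < e" using wip.sq_nonneg[OF g[of n]] by simp
  qed
qed

section \<open>Laguerre polynomials\<close>

lemma laguerre_0 [simp]: "laguerre 0 s t = 1"
  by (simp add: laguerre_def)

text \<open>With \<open>n = l - j\<close> and \<open>x = l + s\<close> this compares the
  coefficients of \<open>t ^ j\<close> in the Laguerre recurrence. The \<open>of_bool\<close>
  removes the term in which \<open>n - 1\<close> truncates to 0.\<close>

lemma gbinomial_three_term:
  fixes x :: real
  shows "real (n + j + 1) * ((x + 1) gchoose (n + 1)) =
    (real (n + j) + x + 1) * (x gchoose n) + real j * (x gchoose (n + 1)) - x * ((x - 1) gchoose (n - 1)) * of_bool (n > 0)"
proof -
  have pascal: "(x + 1) gchoose (n + 1) = (x gchoose n) + (x gchoose (n + 1))"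
    using gbinomial_Suc_Suc[of x n] by simp
  have up: "real (n + 1) * (x gchoose (n + 1)) = (x - real n) * (x gchoose n)"
    using gbinomial_absorb_comp[of x n] gbinomial_absorption[of n x] by simp
  have down: "x * ((x - 1) gchoose (n - 1)) * of_bool (n > 0) = real n * (x gchoose n)"
    using gbinomial_absorption[of "n - 1" x] by (cases n) auto
  show ?thesis unfolding pascal down using up by (simp add: algebra_simps)
qed

text \<open>With the term for \<open>l = 0\<close> killed by the factor \<open>of_bool\<close>, since \<open>laguerre (0 - 1)\<close> is the junk
  value \<open>laguerre 0\<close>.\<close>

lemma laguerre_three_term:
  "t * laguerre l s t =
     (2 * real l + s + 1) * laguerre l s t - real (l + 1) * laguerre (l + 1) s t
     - of_bool (l > 0) * (real l + s) * laguerre (l - 1) s t"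
proof -
  \<comment> \<open>Coefficients padded by zeros, so that polynomials of three different degrees are
    sums over the common range \<open>j \<le> l + 1\<close>.\<close>
  define c where "c l j = (if j \<le> l then (-1) ^ j * ((real l + s) gchoose (l - j)) / fact j else 0)" for l j
  have lag: "laguerre m s t = (\<Sum>j\<le>l+1. c m j * t ^ j)" if "m \<le> l + 1" for m
  proof -
    have "(\<Sum>j\<le>l+1. c m j * t ^ j) = (\<Sum>j\<le>m. c m j * t ^ j)"
      using that by (intro sum.mono_neutral_right) (auto simp: c_def)
    also have "\<dots> = laguerre m s t"
      unfolding laguerre_def by (intro sum.cong) (auto simp: c_def)
    finally show ?thesis by simp
  qed
  have coeff: "real (l + 1) * c (l + 1) j =
    (2 * real l + s + 1) * c l j - of_bool (j > 0) * c l (j - 1) - of_bool (l > 0) * (real l + s) * c (l - 1) j"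
    if j: "j \<le> l + 1" for j
  proof (cases "j = l + 1")
    case True
    have "real (l + 1) * ((-1) ^ (l + 1) / fact (l + 1)) = - ((-1) ^ l / fact l)"
      by (simp del: of_nat_Suc)
    then show ?thesis using True by (simp add: c_def)
  next
    case False
    with j have jl: "j \<le> l" by simp
    define n where "n = l - j"
    have l: "l = n + j" using jl by (simp add: n_def)
    define x where "x = real l + s"
    have *: "real (n + j + 1) * ((x + 1) gchoose (n + 1)) =
      (real (n + j) + x + 1) * (x gchoose n) + real j * (x gchoose (n + 1)) - x * ((x - 1) gchoose (n - 1)) * of_bool (n > 0)"
      by (rule gbinomial_three_term)
    have c1: "c (l + 1) j = (-1) ^ j / fact j * ((x + 1) gchoose (n + 1))"
      using jl by (simp add: c_def l x_def add_ac)
    have c2: "c l j = (-1) ^ j / fact j * (x gchoose n)"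
      using jl by (simp add: c_def l x_def)
    have c3: "of_bool (j > 0) * c l (j - 1) = - ((-1) ^ j / fact j * (real j * (x gchoose (n + 1))))"
      using jl by (cases j) (auto simp: c_def l x_def add_ac)
    have c4: "of_bool (l > 0) * (real l + s) * c (l - 1) j = (-1) ^ j / fact j * (x * ((x - 1) gchoose (n - 1)) * of_bool (n > 0))"
    proof (cases n)
      case 0
      then show ?thesis by (auto simp: c_def l)
    next
      case (Suc n')
      have "real (l - 1) + s = x - 1" "l - 1 - j = n'" "j \<le> l - 1" using Suc by (auto simp: x_def l)
      then show ?thesis using Suc by (simp add: c_def l x_def add.assoc)
    qed
    have "real (l + 1) * c (l + 1) j = (-1) ^ j / fact j * (real (n + j + 1) * ((x + 1) gchoose (n + 1)))"
      unfolding c1 by (simp add: l)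
    also have "\<dots> = (real (n + j) + x + 1) * c l j - of_bool (j > 0) * c l (j - 1) - of_bool (l > 0) * (real l + s) * c (l - 1) j"
      unfolding * c2 c3 c4 by (simp add: algebra_simps add_divide_distrib diff_divide_distrib)
    also have "real (n + j) + x + 1 = 2 * real l + s + 1" by (simp add: x_def l)
    finally show ?thesis .
  qed
  have shift: "(\<Sum>j\<le>l+1. of_bool (j > 0) * c l (j - 1) * t ^ j) = t * laguerre l s t"
  proof -
    have "(\<Sum>j\<le>l+1. of_bool (j > 0) * c l (j - 1) * t ^ j) = (\<Sum>j\<le>l. c l j * t ^ Suc j)"
      using sum.atMost_Suc_shift[of "\<lambda>j. of_bool (j > 0) * c l (j - 1) * t ^ j" l] by simp
    also have "\<dots> = t * (\<Sum>j\<le>l. c l j * t ^ j)" by (simp add: sum_distrib_left mult_ac)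
    also have "(\<Sum>j\<le>l. c l j * t ^ j) = laguerre l s t"
      unfolding laguerre_def by (intro sum.cong) (auto simp: c_def)
    finally show ?thesis .
  qed
  have "real (l + 1) * laguerre (l + 1) s t = (\<Sum>j\<le>l+1. (real (l + 1) * c (l + 1) j) * t ^ j)"
    by (simp only: lag[OF order.refl] sum_distrib_left mult_ac)
  also have "\<dots> = (\<Sum>j\<le>l+1. (2 * real l + s + 1) * (c l j * t ^ j) - of_bool (j > 0) * c l (j - 1) * t ^ j
      - of_bool (l > 0) * (real l + s) * (c (l - 1) j * t ^ j))"
    by (intro sum.cong refl, subst coeff) (simp_all only: atMost_iff left_diff_distrib mult.assoc)
  also have "\<dots> = (2 * real l + s + 1) * laguerre l s t - t * laguerre l s t
      - of_bool (l > 0) * (real l + s) * laguerre (l - 1) s t"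
    by (simp only: sum_subtractf shift sum_distrib_left[symmetric] lag[of l, symmetric] lag[of "l - 1", symmetric])
  finally show ?thesis by simp
qed

section \<open>The Dunkl Laplacian on polynomials\<close>

lemma real_polynomial_function_derivative:
  fixes p :: "'a::euclidean_space \<Rightarrow> real"
  assumes "real_polynomial_function p"
  shows "p differentiable (at x)" and "real_polynomial_function (\<lambda>x. frechet_derivative p (at x) b)"
proof -
  have "(\<forall>x. p differentiable (at x)) \<and> real_polynomial_function (\<lambda>x. frechet_derivative p (at x) b)"
    using assms
  proof (induction rule: real_polynomial_function.induct)
    case (linear f)
    have "(f has_derivative f) (at x)" for x
      by (rule bounded_linear_imp_has_derivative[OF linear])
    moreover from this have "frechet_derivative f (at x) = f" for x
      by (rule frechet_derivative_at[symmetric])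
    ultimately show ?case
      by (auto simp: differentiable_def intro: real_polynomial_function.intros(2))
  next
    case (const c)
    then show ?case by (auto intro: real_polynomial_function.intros(2))
  next
    case (add f g)
    have "((\<lambda>x. f x + g x) has_derivative (\<lambda>h. frechet_derivative f (at x) h + frechet_derivative g (at x) h)) (at x)" for x
      using add.IH by (intro has_derivative_add) (auto simp: frechet_derivative_works)
    moreover from frechet_derivative_at[OF this]
    have "frechet_derivative (\<lambda>x. f x + g x) (at x) b = frechet_derivative f (at x) b + frechet_derivative g (at x) b" for x
      by (metis (lifting))
    ultimately show ?case using add.IH
      by (auto simp: differentiable_def intro: real_polynomial_function.intros(3))
  next
    case (mult f g)
    have "((\<lambda>x. f x * g x) has_derivative (\<lambda>h. f x * frechet_derivative g (at x) h + frechet_derivative f (at x) h * g x)) (at x)" for x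
      using mult.IH by (intro has_derivative_mult) (auto simp: frechet_derivative_works)
    moreover from frechet_derivative_at[OF this]
    have "frechet_derivative (\<lambda>x. f x * g x) (at x) b = f x * frechet_derivative g (at x) b + frechet_derivative f (at x) b * g x" for x
      by (metis (lifting))
    ultimately show ?case using mult.IH mult.hyps
      by (auto simp: differentiable_def intro!: real_polynomial_function.intros(3) real_polynomial_function.intros(4))
  qed
  then show "p differentiable (at x)" "real_polynomial_function (\<lambda>x. frechet_derivative p (at x) b)" by auto
qed

text \<open>A reflection moves \<open>x\<close> along \<alpha> by a multiple s of \<alpha> that is
  linear in \<open>x\<close>. This is the Taylor expansion to first order in s, with a polynomial as
  cofactor of the remainder s^2; it is what cancels the poles of the Dunkl Laplacian.\<close>

lemma real_polynomial_function_reflection: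
  fixes p :: "'a::euclidean_space \<Rightarrow> real"
  assumes "real_polynomial_function p"
  shows "\<exists>G. real_polynomial_function G \<and> (\<forall>x. p (reflection \<alpha> x) =
    p x - (2 * (\<alpha> \<bullet> x) / (norm \<alpha>)\<^sup>2) * frechet_derivative p (at x) \<alpha> + (2 * (\<alpha> \<bullet> x) / (norm \<alpha>)\<^sup>2)\<^sup>2 * G x)"
  using assms
proof (induction rule: real_polynomial_function.induct)
  case (linear f)
  have "frechet_derivative f (at x) = f" for x
    using frechet_derivative_at[OF bounded_linear_imp_has_derivative[OF linear]] by simp
  moreover have "f (reflection \<alpha> x) = f x - (2 * (\<alpha> \<bullet> x) / (norm \<alpha>)\<^sup>2) * f \<alpha>" for x
    unfolding reflection_def using linear by (simp add: bounded_linear.linear linear_diff linear_scale)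
  ultimately show ?case by (intro exI[of _ "\<lambda>x. 0"]) (auto intro: real_polynomial_function.intros(2))
next
  case (const c)
  then show ?case by (intro exI[of _ "\<lambda>x. 0"]) (auto intro: real_polynomial_function.intros(2))
next
  case (add f g)
  then obtain F G where F: "real_polynomial_function F" "\<And>x. f (reflection \<alpha> x) =
      f x - (2 * (\<alpha> \<bullet> x) / (norm \<alpha>)\<^sup>2) * frechet_derivative f (at x) \<alpha> + (2 * (\<alpha> \<bullet> x) / (norm \<alpha>)\<^sup>2)\<^sup>2 * F x"
    and G: "real_polynomial_function G" "\<And>x. g (reflection \<alpha> x) =
      g x - (2 * (\<alpha> \<bullet> x) / (norm \<alpha>)\<^sup>2) * frechet_derivative g (at x) \<alpha> + (2 * (\<alpha> \<bullet> x) / (norm \<alpha>)\<^sup>2)\<^sup>2 * G x"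
    by blast
  have d: "frechet_derivative (\<lambda>x. f x + g x) (at x) \<alpha> = frechet_derivative f (at x) \<alpha> + frechet_derivative g (at x) \<alpha>" for x
    using frechet_derivative_at[OF has_derivative_add[of f _ "at x" g]] real_polynomial_function_derivative(1)[OF add.hyps(1), of x]
      real_polynomial_function_derivative(1)[OF add.hyps(2), of x]
    by (metis (lifting) frechet_derivative_works)
  show ?case
  proof (intro exI conjI allI)
    show "real_polynomial_function (\<lambda>x. F x + G x)" using F G by (intro real_polynomial_function.intros(3))
  qed (simp only: F(2) G(2) d, simp add: algebra_simps add_divide_distrib)
next
  case (mult f g)
  define s where "s x = 2 * (\<alpha> \<bullet> x) / (norm \<alpha>)\<^sup>2" for x
  from mult obtain F G where F: "real_polynomial_function F" "\<And>x. f (reflection \<alpha> x) =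
      f x - s x * frechet_derivative f (at x) \<alpha> + (s x)\<^sup>2 * F x"
    and G: "real_polynomial_function G" "\<And>x. g (reflection \<alpha> x) =
      g x - s x * frechet_derivative g (at x) \<alpha> + (s x)\<^sup>2 * G x"
    unfolding s_def by blast
  have s: "real_polynomial_function s"
  proof -
    have "bounded_linear s"
      unfolding s_def using bounded_linear_compose[OF bounded_linear_mult_left[of "2 / (norm \<alpha>)\<^sup>2"] bounded_linear_inner_right[of \<alpha>]]
      by (simp add: mult.commute)
    then show ?thesis by (rule real_polynomial_function.intros(1))
  qed
  have d: "frechet_derivative (\<lambda>x. f x * g x) (at x) \<alpha> = f x * frechet_derivative g (at x) \<alpha> + frechet_derivative f (at x) \<alpha> * g x" for x
    using frechet_derivative_at[OF has_derivative_mult[of f _ x UNIV g]] real_polynomial_function_derivative(1)[OF mult.hyps(1), of x]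
      real_polynomial_function_derivative(1)[OF mult.hyps(2), of x]
    by (metis (lifting) frechet_derivative_works)
  \<comment> \<open>Everything beyond first order in the product of the two expansions, divided by
    s^2.\<close>
  define H where "H x = frechet_derivative f (at x) \<alpha> * frechet_derivative g (at x) \<alpha> + f x * G x + F x * g x
     - s x * (frechet_derivative f (at x) \<alpha> * G x + F x * frechet_derivative g (at x) \<alpha>) + s x * s x * F x * G x" for x
  show ?case unfolding s_def[symmetric]
  proof (intro exI conjI allI)
    show "real_polynomial_function H" unfolding H_def
      by (intro real_polynomial_function.intros(3) real_polynomial_function_diff real_polynomial_function.intros(4)
          F(1) G(1) s mult.hyps real_polynomial_function_derivative(2))
  qed (simp only: F(2) G(2) d H_def, simp add: algebra_simps power2_eq_square)
qed

lemma polynomial_function_complex_iff: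
  "polynomial_function p \<longleftrightarrow> real_polynomial_function (\<lambda>x. Re (p x)) \<and> real_polynomial_function (\<lambda>x. Im (p x))"
proof
  assume "polynomial_function p"
  then show "real_polynomial_function (\<lambda>x. Re (p x)) \<and> real_polynomial_function (\<lambda>x. Im (p x))"
    unfolding polynomial_function_def using bounded_linear_Re bounded_linear_Im by (fastforce simp: o_def)
next
  assume p: "real_polynomial_function (\<lambda>x. Re (p x)) \<and> real_polynomial_function (\<lambda>x. Im (p x))"
  have "polynomial_function (\<lambda>x. Re (p x) *\<^sub>R 1 + Im (p x) *\<^sub>R \<i>)"
    using p by (intro polynomial_function_add polynomial_function_mult polynomial_function_const)
      (auto simp: real_polynomial_function_eq)
  also have "(\<lambda>x. Re (p x) *\<^sub>R 1 + Im (p x) *\<^sub>R \<i>) = p"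
    by (auto simp: complex_eq_iff)
  finally show "polynomial_function p" .
qed

lemma polynomial_function_complex_mult:
  fixes p q :: "'a::euclidean_space \<Rightarrow> complex"
  assumes "polynomial_function p" "polynomial_function q"
  shows "polynomial_function (\<lambda>x. p x * q x)"
  using assms unfolding polynomial_function_complex_iff by auto

lemma polynomial_function_complex_derivative:
  fixes p :: "'a::euclidean_space \<Rightarrow> complex"
  assumes "polynomial_function p"
  shows "(p has_derivative frechet_derivative p (at x)) (at x)"
    and "Re (frechet_derivative p (at x) b) = frechet_derivative (\<lambda>x. Re (p x)) (at x) b"
    and "Im (frechet_derivative p (at x) b) = frechet_derivative (\<lambda>x. Im (p x)) (at x) b"
    and "polynomial_function (\<lambda>x. frechet_derivative p (at x) b)"
proof -
  have *: "real_polynomial_function (\<lambda>x. Re (p x))" "real_polynomial_function (\<lambda>x. Im (p x))"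
    using assms by (simp_all add: polynomial_function_complex_iff)
  have "((\<lambda>x. of_real (Re (p x)) + \<i> * of_real (Im (p x))) has_derivative
     (\<lambda>h. of_real (frechet_derivative (\<lambda>x. Re (p x)) (at x) h) + \<i> * of_real (frechet_derivative (\<lambda>x. Im (p x)) (at x) h))) (at x)" for x
    by (intro derivative_intros real_polynomial_function_derivative(1)[OF *(1), unfolded frechet_derivative_works]
        real_polynomial_function_derivative(1)[OF *(2), unfolded frechet_derivative_works])
  moreover have "(\<lambda>x. of_real (Re (p x)) + \<i> * of_real (Im (p x))) = p"
    by (auto simp: complex_eq_iff)
  ultimately have der: "(p has_derivative
     (\<lambda>h. of_real (frechet_derivative (\<lambda>x. Re (p x)) (at x) h) + \<i> * of_real (frechet_derivative (\<lambda>x. Im (p x)) (at x) h))) (at x)" for x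
    by simp
  show "(p has_derivative frechet_derivative p (at x)) (at x)"
    using der frechet_derivative_works differentiable_def by blast
  have eq: "frechet_derivative p (at x) b =
    of_real (frechet_derivative (\<lambda>x. Re (p x)) (at x) b) + \<i> * of_real (frechet_derivative (\<lambda>x. Im (p x)) (at x) b)" for x
    by (subst frechet_derivative_at[OF der, symmetric]) (rule refl)
  show "Re (frechet_derivative p (at x) b) = frechet_derivative (\<lambda>x. Re (p x)) (at x) b"
    and "Im (frechet_derivative p (at x) b) = frechet_derivative (\<lambda>x. Im (p x)) (at x) b"
    by (simp_all add: eq)
  show "polynomial_function (\<lambda>x. frechet_derivative p (at x) b)"
    unfolding polynomial_function_complex_iff eq
    using real_polynomial_function_derivative(2)[OF *(1)] real_polynomial_function_derivative(2)[OF *(2)] by simp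
qed

lemma frechet_derivative_polynomial_add:
  fixes p q :: "'a::euclidean_space \<Rightarrow> complex"
  assumes "polynomial_function p" "polynomial_function q"
  shows "frechet_derivative (\<lambda>x. p x + q x) (at x) b = frechet_derivative p (at x) b + frechet_derivative q (at x) b"
  by (subst frechet_derivative_at[symmetric, OF has_derivative_add[OF
      polynomial_function_complex_derivative(1)[OF assms(1)] polynomial_function_complex_derivative(1)[OF assms(2)]]]) (rule refl)

lemma frechet_derivative_polynomial_scale:
  fixes p :: "'a::euclidean_space \<Rightarrow> complex"
  assumes "polynomial_function p"
  shows "frechet_derivative (\<lambda>x. c * p x) (at x) b = c * frechet_derivative p (at x) b"
  by (subst frechet_derivative_at[symmetric, OF has_derivative_mult_right[OF
      polynomial_function_complex_derivative(1)[OF assms(1)]]]) (rule refl)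

lemma frechet_derivative_polynomial_norm_sq:
  fixes p :: "'a::euclidean_space \<Rightarrow> complex"
  assumes "polynomial_function p"
  shows "frechet_derivative (\<lambda>x. of_real (x \<bullet> x) * p x) (at x) b =
    of_real (x \<bullet> x) * frechet_derivative p (at x) b + 2 * of_real (x \<bullet> b) * p x"
proof -
  have "((\<lambda>x. of_real (x \<bullet> x) * p x) has_derivative
    (\<lambda>h. of_real (x \<bullet> x) * frechet_derivative p (at x) h + of_real (x \<bullet> h + h \<bullet> x) * p x)) (at x)"
    by (intro derivative_intros polynomial_function_complex_derivative(1)[OF assms])
  from frechet_derivative_at[OF this, symmetric] show ?thesis by (simp add: inner_commute)
qed

lemma frechet_derivative_polynomial_inner:
  fixes p :: "'a::euclidean_space \<Rightarrow> complex"
  assumes "polynomial_function p"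
  shows "frechet_derivative (\<lambda>x. of_real (x \<bullet> b) * p x) (at x) h =
    of_real (x \<bullet> b) * frechet_derivative p (at x) h + of_real (h \<bullet> b) * p x"
proof -
  have "((\<lambda>x. of_real (x \<bullet> b) * p x) has_derivative
    (\<lambda>h. of_real (x \<bullet> b) * frechet_derivative p (at x) h + of_real (h \<bullet> b) * p x)) (at x)"
    by (intro derivative_intros polynomial_function_complex_derivative(1)[OF assms])
  from frechet_derivative_at[OF this, symmetric] show ?thesis by simp
qed

lemma polynomial_function_of_real_inner:
  "polynomial_function (\<lambda>x::'a::euclidean_space. of_real (x \<bullet> b) :: complex)"
  unfolding polynomial_function_complex_iff
  by (auto intro!: real_polynomial_function.intros(1) bounded_linear_inner_left simp: bounded_linear_zero)

lemma polynomial_function_of_real_norm_sq: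
  "polynomial_function (\<lambda>x::'a::euclidean_space. of_real (x \<bullet> x) :: complex)"
proof -
  have "real_polynomial_function (\<lambda>x::'a. \<Sum>b\<in>Basis. (x \<bullet> b) * (x \<bullet> b))"
    by (intro real_polynomial_function_sum real_polynomial_function.intros(4) real_polynomial_function.intros(1)
        bounded_linear_inner_left finite_Basis)
  then show ?thesis
    unfolding polynomial_function_complex_iff
    by (simp add: euclidean_inner[symmetric] real_polynomial_function.intros(2))
qed

lemma laplacian_polynomial:
  fixes p :: "'a::euclidean_space \<Rightarrow> complex"
  assumes "polynomial_function p"
  shows "polynomial_function (laplacian p)"
  unfolding laplacian_def
  by (intro polynomial_function_sum polynomial_function_complex_derivative(4) assms finite_Basis)

lemma laplacian_add:
  fixes p q :: "'a::euclidean_space \<Rightarrow> complex"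
  assumes "polynomial_function p" "polynomial_function q"
  shows "laplacian (\<lambda>x. p x + q x) x = laplacian p x + laplacian q x"
  unfolding laplacian_def
  by (simp add: frechet_derivative_polynomial_add assms polynomial_function_complex_derivative(4) sum.distrib)

lemma laplacian_scale:
  fixes p q :: "'a::euclidean_space \<Rightarrow> complex"
  assumes "polynomial_function p"
  shows "laplacian (\<lambda>x. c * p x) x = c * laplacian p x"
  unfolding laplacian_def
  by (simp add: frechet_derivative_polynomial_scale assms polynomial_function_complex_derivative(4) sum_distrib_left)

lemma sum_inner_frechet_derivative:
  fixes p :: "'a::euclidean_space \<Rightarrow> complex"
  assumes "polynomial_function p"
  shows "(\<Sum>b\<in>Basis. of_real (y \<bullet> b) * frechet_derivative p (at x) b) = frechet_derivative p (at x) y"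
proof -
  have lin: "linear (frechet_derivative p (at x))"
    by (rule has_derivative_linear[OF polynomial_function_complex_derivative(1)[OF assms]])
  have "frechet_derivative p (at x) (\<Sum>b\<in>Basis. (y \<bullet> b) *\<^sub>R b) = (\<Sum>b\<in>Basis. of_real (y \<bullet> b) * frechet_derivative p (at x) b)"
    by (simp add: linear_sum[OF lin] linear_scale[OF lin] scaleR_conv_of_real)
  then show ?thesis by (simp add: euclidean_representation)
qed

lemma laplacian_norm_sq:
  fixes p :: "'a::euclidean_space \<Rightarrow> complex"
  assumes "polynomial_function p"
  shows "laplacian (\<lambda>x. of_real (x \<bullet> x) * p x) x =
    of_real (x \<bullet> x) * laplacian p x + 4 * frechet_derivative p (at x) x + 2 * of_nat DIM('a) * p x"
proof -
  note poly = polynomial_function_complex_derivative(4)[OF assms] polynomial_function_of_real_norm_sq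
    polynomial_function_complex_mult polynomial_function_of_real_inner assms
  have "frechet_derivative (\<lambda>y. frechet_derivative (\<lambda>x. of_real (x \<bullet> x) * p x) (at y) b) (at x) b =
    of_real (x \<bullet> x) * frechet_derivative (\<lambda>y. frechet_derivative p (at y) b) (at x) b
    + 4 * (of_real (x \<bullet> b) * frechet_derivative p (at x) b) + 2 * of_real (b \<bullet> b) * p x" for b
    unfolding frechet_derivative_polynomial_norm_sq[OF assms]
    by (simp add: poly frechet_derivative_polynomial_add frechet_derivative_polynomial_norm_sq
        frechet_derivative_polynomial_scale frechet_derivative_polynomial_inner mult.assoc)
  then have "laplacian (\<lambda>x. of_real (x \<bullet> x) * p x) x =
    (\<Sum>b\<in>Basis. of_real (x \<bullet> x) * frechet_derivative (\<lambda>y. frechet_derivative p (at y) b) (at x) b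
    + 4 * (of_real (x \<bullet> b) * frechet_derivative p (at x) b) + 2 * p x)"
    unfolding laplacian_def by (intro sum.cong) auto
  also have "\<dots> = of_real (x \<bullet> x) * laplacian p x + 4 * frechet_derivative p (at x) x + 2 * of_nat DIM('a) * p x"
    unfolding laplacian_def by (simp add: sum.distrib sum_inner_frechet_derivative[OF assms] flip: sum_distrib_left)
  finally show ?thesis .
qed

lemma dunkl_laplacian_add:
  fixes p q :: "'a::euclidean_space \<Rightarrow> complex"
  assumes "polynomial_function p" "polynomial_function q"
  shows "dunkl_laplacian P k (\<lambda>x. p x + q x) x = dunkl_laplacian P k p x + dunkl_laplacian P k q x"
  unfolding dunkl_laplacian_def laplacian_add[OF assms] frechet_derivative_polynomial_add[OF assms]
  by (simp add: algebra_simps add_divide_distrib diff_divide_distrib sum.distrib sum_subtractf)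

lemma dunkl_laplacian_scale:
  fixes p q :: "'a::euclidean_space \<Rightarrow> complex"
  assumes "polynomial_function p"
  shows "dunkl_laplacian P k (\<lambda>x. c * p x) x = c * dunkl_laplacian P k p x"
proof -
  have "dunkl_laplacian P k (\<lambda>x. c * p x) x = c * laplacian p x +
     (\<Sum>\<alpha>\<in>P. c * (of_real (k \<alpha>) * (2 * frechet_derivative p (at x) \<alpha> / of_real (\<alpha> \<bullet> x)
         - of_real ((norm \<alpha>)\<^sup>2) * (p x - p (reflection \<alpha> x)) / of_real ((\<alpha> \<bullet> x)\<^sup>2))))"
    unfolding dunkl_laplacian_def laplacian_scale[OF assms] frechet_derivative_polynomial_scale[OF assms]
    by (intro arg_cong2[of _ _ _ _ "(+)"] refl sum.cong) (simp add: algebra_simps)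
  then show ?thesis unfolding dunkl_laplacian_def by (simp add: distrib_left sum_distrib_left)
qed

lemma reflection_inner_self:
  assumes "\<alpha> \<noteq> 0" shows "reflection \<alpha> x \<bullet> reflection \<alpha> x = x \<bullet> x"
proof -
  have "\<alpha> \<bullet> \<alpha> \<noteq> 0" using assms by simp
  then show ?thesis
    unfolding reflection_def power2_norm_eq_inner
    by (simp add: inner_diff_left inner_diff_right inner_commute field_simps)
qed

text \<open>The squared norm is invariant under reflections, so it factors out of each difference
  term; each gradient term contributes an extra 4 \<open>k \<alpha>\<close> \<open>p\<close>. The
  Euler term and 2 N \<open>p\<close> come from the ordinary Laplacian.\<close>

lemma dunkl_laplacian_norm_sq:
  fixes p :: "'a::euclidean_space \<Rightarrow> complex"
  assumes p: "polynomial_function p" and P: "0 \<notin> P" and x: "\<forall>\<alpha>\<in>P. \<alpha> \<bullet> x \<noteq> 0"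
  shows "dunkl_laplacian P k (\<lambda>x. of_real (x \<bullet> x) * p x) x =
    of_real (x \<bullet> x) * dunkl_laplacian P k p x + 4 * frechet_derivative p (at x) x
    + of_real (2 * real DIM('a) + 4 * mult_index P k) * p x"
proof -
  define T where "T q \<alpha> = of_real (k \<alpha>) * (2 * frechet_derivative q (at x) \<alpha> / of_real (\<alpha> \<bullet> x)
         - of_real ((norm \<alpha>)\<^sup>2) * (q x - q (reflection \<alpha> x)) / of_real ((\<alpha> \<bullet> x)\<^sup>2))" for q :: "'a \<Rightarrow> complex" and \<alpha>
  have "T (\<lambda>x. of_real (x \<bullet> x) * p x) \<alpha> = of_real (x \<bullet> x) * T p \<alpha> + 4 * p x * of_real (k \<alpha>)" if "\<alpha> \<in> P" for \<alpha>
  proof -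
    have nz: "complex_of_real (\<alpha> \<bullet> x) \<noteq> 0" and "\<alpha> \<noteq> 0" using x P that by auto
    show ?thesis
      unfolding T_def reflection_inner_self[OF \<open>\<alpha> \<noteq> 0\<close>] frechet_derivative_polynomial_norm_sq[OF p]
      using nz by (simp add: inner_commute[of x \<alpha>] field_simps power2_eq_square)
  qed
  then have "(\<Sum>\<alpha>\<in>P. T (\<lambda>x. of_real (x \<bullet> x) * p x) \<alpha>) = (\<Sum>\<alpha>\<in>P. of_real (x \<bullet> x) * T p \<alpha> + 4 * p x * of_real (k \<alpha>))"
    by (intro sum.cong) auto
  also have "\<dots> = of_real (x \<bullet> x) * (\<Sum>\<alpha>\<in>P. T p \<alpha>) + 4 * p x * of_real (mult_index P k)"
    by (simp add: sum.distrib mult_index_def flip: sum_distrib_left)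
  finally have sum: "(\<Sum>\<alpha>\<in>P. T (\<lambda>x. of_real (x \<bullet> x) * p x) \<alpha>) = \<dots>" .
  have dunkl: "dunkl_laplacian P k q x = laplacian q x + (\<Sum>\<alpha>\<in>P. T q \<alpha>)" for q
    by (simp add: dunkl_laplacian_def T_def)
  show ?thesis
    unfolding dunkl sum laplacian_norm_sq[OF p] by (simp add: algebra_simps)
qed

text \<open>The first-order term of the reflected difference cancels the gradient term exactly, and
  the factor s^2 of the remainder cancels the squared denominator, leaving 4 / |\<alpha>|^2 times
  the polynomial cofactor.\<close>

lemma dunkl_laplacian_polynomial:
  fixes p :: "'a::euclidean_space \<Rightarrow> complex"
  assumes p: "polynomial_function p" and fin: "finite P" and P: "0 \<notin> P"
  shows "\<exists>g. polynomial_function g \<and> (\<forall>x. (\<forall>\<alpha>\<in>P. \<alpha> \<bullet> x \<noteq> 0) \<longrightarrow> dunkl_laplacian P k p x = g x)"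
proof -
  have "\<exists>G. polynomial_function G \<and> (\<forall>x. p x - p (reflection \<alpha> x) =
    of_real (2 * (\<alpha> \<bullet> x) / (norm \<alpha>)\<^sup>2) * frechet_derivative p (at x) \<alpha> - of_real ((2 * (\<alpha> \<bullet> x) / (norm \<alpha>)\<^sup>2)\<^sup>2) * G x)" for \<alpha>
  proof -
    have *: "real_polynomial_function (\<lambda>x. Re (p x))" "real_polynomial_function (\<lambda>x. Im (p x))"
      using p by (simp_all add: polynomial_function_complex_iff)
    obtain G1 G2 where G: "real_polynomial_function G1" "real_polynomial_function G2"
      "\<And>x. Re (p (reflection \<alpha> x)) = Re (p x) - (2 * (\<alpha> \<bullet> x) / (norm \<alpha>)\<^sup>2) * frechet_derivative (\<lambda>x. Re (p x)) (at x) \<alpha> + (2 * (\<alpha> \<bullet> x) / (norm \<alpha>)\<^sup>2)\<^sup>2 * G1 x"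
      "\<And>x. Im (p (reflection \<alpha> x)) = Im (p x) - (2 * (\<alpha> \<bullet> x) / (norm \<alpha>)\<^sup>2) * frechet_derivative (\<lambda>x. Im (p x)) (at x) \<alpha> + (2 * (\<alpha> \<bullet> x) / (norm \<alpha>)\<^sup>2)\<^sup>2 * G2 x"
      using real_polynomial_function_reflection[OF *(1)] real_polynomial_function_reflection[OF *(2)] by metis
    show ?thesis
    proof (intro exI conjI allI)
      show "polynomial_function (\<lambda>x. Complex (G1 x) (G2 x))"
        using G by (simp add: polynomial_function_complex_iff)
    qed (simp add: complex_eq_iff G polynomial_function_complex_derivative(2,3)[OF p] del: of_real_power of_real_divide of_real_mult)
  qed
  then obtain G where G: "\<And>\<alpha>. polynomial_function (G \<alpha>)"
    and eq: "\<And>\<alpha> x. p x - p (reflection \<alpha> x) =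
      of_real (2 * (\<alpha> \<bullet> x) / (norm \<alpha>)\<^sup>2) * frechet_derivative p (at x) \<alpha> - of_real ((2 * (\<alpha> \<bullet> x) / (norm \<alpha>)\<^sup>2)\<^sup>2) * G \<alpha> x"
    by metis
  define g where "g x = laplacian p x + (\<Sum>\<alpha>\<in>P. of_real (k \<alpha> * 4 / (norm \<alpha>)\<^sup>2) * G \<alpha> x)" for x
  have "polynomial_function g" unfolding g_def
    by (intro polynomial_function_add laplacian_polynomial polynomial_function_sum fin p
        polynomial_function_complex_mult G polynomial_function_const)
  moreover have "dunkl_laplacian P k p x = g x" if x: "\<forall>\<alpha>\<in>P. \<alpha> \<bullet> x \<noteq> 0" for x
    unfolding dunkl_laplacian_def g_def
  proof (intro arg_cong2[of _ _ _ _ "(+)"] refl sum.cong)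
    fix \<alpha> assume "\<alpha> \<in> P"
    then have "complex_of_real (\<alpha> \<bullet> x) \<noteq> 0" "complex_of_real (norm \<alpha>) \<noteq> 0" using x P by auto
    then show "of_real (k \<alpha>) * (2 * frechet_derivative p (at x) \<alpha> / of_real (\<alpha> \<bullet> x)
         - of_real ((norm \<alpha>)\<^sup>2) * (p x - p (reflection \<alpha> x)) / of_real ((\<alpha> \<bullet> x)\<^sup>2)) = of_real (k \<alpha> * 4 / (norm \<alpha>)\<^sup>2) * G \<alpha> x"
      unfolding eq by (simp add: field_simps power2_eq_square)
  qed
  ultimately show ?thesis by blast
qed

section \<open>The Fischer decomposition\<close>

definition hom_polys :: "nat \<Rightarrow> ('a::euclidean_space \<Rightarrow> complex) set" where
  "hom_polys m = {p. polynomial_function p \<and> (\<forall>c x. p (c *\<^sub>R x) = of_real (c ^ m) * p x)}"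

lemma hom_polysD:
  assumes "p \<in> hom_polys m"
  shows "polynomial_function p" "p (c *\<^sub>R x) = of_real (c ^ m) * p x"
  using assms by (auto simp: hom_polys_def)

lemma dunkl_harmonics_eq:
  "dunkl_harmonics P k m = {p \<in> hom_polys m. \<forall>x. (\<forall>\<alpha>\<in>P. \<alpha> \<bullet> x \<noteq> 0) \<longrightarrow> dunkl_laplacian P k p x = 0}"
  by (auto simp: dunkl_harmonics_def hom_polys_def)

text \<open>Differentiate the scaling identity in two ways. The factor \<open>C\<close> is arbitrary
  so that the lemma can be applied again to the directional derivative, which scales by
  \<open>C / c\<close>.\<close>

lemma frechet_derivative_scaling:
  fixes p :: "'a::euclidean_space \<Rightarrow> complex"
  assumes p: "polynomial_function p" and eq: "\<And>x. p (c *\<^sub>R x) = C * p x" and c: "c \<noteq> 0"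
  shows "frechet_derivative p (at (c *\<^sub>R x)) b = C / of_real c * frechet_derivative p (at x) b"
proof -
  have "((\<lambda>x. p (c *\<^sub>R x)) has_derivative (\<lambda>h. frechet_derivative p (at (c *\<^sub>R x)) (c *\<^sub>R h))) (at x)"
    by (rule has_derivative_compose[where f = "\<lambda>x. c *\<^sub>R x"])
      (auto intro!: derivative_eq_intros polynomial_function_complex_derivative(1)[OF p])
  moreover have "((\<lambda>x. p (c *\<^sub>R x)) has_derivative (\<lambda>h. C * frechet_derivative p (at x) h)) (at x)"
    unfolding eq by (intro has_derivative_mult_right polynomial_function_complex_derivative(1)[OF p])
  ultimately have "(\<lambda>h. frechet_derivative p (at (c *\<^sub>R x)) (c *\<^sub>R h)) = (\<lambda>h. C * frechet_derivative p (at x) h)"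
    by (rule has_derivative_unique)
  then have "frechet_derivative p (at (c *\<^sub>R x)) (c *\<^sub>R b) = C * frechet_derivative p (at x) b"
    by (rule fun_cong)
  moreover have "linear (frechet_derivative p (at (c *\<^sub>R x)))"
    by (rule has_derivative_linear[OF polynomial_function_complex_derivative(1)[OF p]])
  ultimately show ?thesis using c by (simp add: linear_scale scaleR_conv_of_real field_simps)
qed

lemma frechet_derivative_euler:
  fixes p :: "'a::euclidean_space \<Rightarrow> complex"
  assumes "p \<in> hom_polys m"
  shows "frechet_derivative p (at x) x = of_nat m * p x"
proof -
  note p = hom_polysD(1)[OF assms]
  have "((\<lambda>t::real. p (t *\<^sub>R x)) has_derivative (\<lambda>h. frechet_derivative p (at (1 *\<^sub>R x)) (h *\<^sub>R x))) (at 1)"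
    by (rule has_derivative_compose[where f = "\<lambda>t. t *\<^sub>R x"])
      (auto intro!: derivative_eq_intros polynomial_function_complex_derivative(1)[OF p, of "1 *\<^sub>R x", simplified])
  moreover have "((\<lambda>t::real. p (t *\<^sub>R x)) has_derivative (\<lambda>h. of_real (of_nat m * h) * p x)) (at 1)"
    unfolding hom_polysD(2)[OF assms] by (auto intro!: derivative_eq_intros)
  ultimately have "(\<lambda>h. frechet_derivative p (at (1 *\<^sub>R x)) (h *\<^sub>R x)) = (\<lambda>h::real. of_real (of_nat m * h) * p x)"
    by (rule has_derivative_unique)
  from fun_cong[OF this, of 1] show ?thesis by simp
qed

lemma laplacian_scaling:
  fixes p :: "'a::euclidean_space \<Rightarrow> complex"
  assumes p: "polynomial_function p" and eq: "\<And>x. p (c *\<^sub>R x) = C * p x" and c: "c \<noteq> 0"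
  shows "laplacian p (c *\<^sub>R x) = C / (of_real c)\<^sup>2 * laplacian p x"
  unfolding laplacian_def sum_distrib_left
  by (intro sum.cong refl, subst frechet_derivative_scaling[OF polynomial_function_complex_derivative(4)[OF p]
        frechet_derivative_scaling[OF p eq c] c]) (simp add: power2_eq_square)

lemma reflection_scaleR: "reflection \<alpha> (c *\<^sub>R x) = c *\<^sub>R reflection \<alpha> x"
  by (simp add: reflection_def scaleR_diff_right)

lemma dunkl_laplacian_scaling:
  fixes p :: "'a::euclidean_space \<Rightarrow> complex"
  assumes p: "polynomial_function p" and eq: "\<And>x. p (c *\<^sub>R x) = C * p x" and c: "c \<noteq> 0"
  shows "dunkl_laplacian P k p (c *\<^sub>R x) = C / (of_real c)\<^sup>2 * dunkl_laplacian P k p x"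
  unfolding dunkl_laplacian_def laplacian_scaling[OF assms] distrib_left sum_distrib_left
    frechet_derivative_scaling[OF assms] reflection_scaleR eq inner_scaleR_right
proof (intro arg_cong2[of _ _ _ _ "(+)"] refl sum.cong)
  fix \<alpha> assume "\<alpha> \<in> P"
  show "of_real (k \<alpha>) * (2 * (C / of_real c * frechet_derivative p (at x) \<alpha>) / of_real (c * (\<alpha> \<bullet> x))
      - of_real ((norm \<alpha>)\<^sup>2) * (C * p x - C * p (reflection \<alpha> x)) / of_real ((c * (\<alpha> \<bullet> x))\<^sup>2))
    = C / (of_real c)\<^sup>2 * (of_real (k \<alpha>) * (2 * frechet_derivative p (at x) \<alpha> / of_real (\<alpha> \<bullet> x)
      - of_real ((norm \<alpha>)\<^sup>2) * (p x - p (reflection \<alpha> x)) / of_real ((\<alpha> \<bullet> x)\<^sup>2)))"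
    using c by (cases "\<alpha> \<bullet> x = 0") (simp_all add: field_simps power2_eq_square)
qed

text \<open>The set where \<open>f\<close> and \<open>g\<close> differ is open and lies in a finite
  union of hyperplanes, which is negligible; a negligible open set is empty.\<close>

lemma eq_off_hyperplanes_imp_eq:
  fixes f g :: "'a::euclidean_space \<Rightarrow> 'b::t2_space"
  assumes fin: "finite P" and P: "0 \<notin> P" and f: "continuous_on UNIV f" and g: "continuous_on UNIV g"
    and eq: "\<And>x. \<forall>\<alpha>\<in>P. \<alpha> \<bullet> x \<noteq> 0 \<Longrightarrow> f x = g x"
  shows "f x = g x"
proof -
  have op: "open {x. f x \<noteq> g x}"
    by (intro open_Collect_neq f g)
  have "{x. f x \<noteq> g x} \<subseteq> (\<Union>\<alpha>\<in>P. {x. \<alpha> \<bullet> x = 0})" using eq by blast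
  moreover have "negligible (\<Union>\<alpha>\<in>P. {x. \<alpha> \<bullet> x = 0})"
    using fin P by (intro negligible_Union) (auto intro!: negligible_hyperplane)
  ultimately have "negligible {x. f x \<noteq> g x}" by (rule negligible_subset[rotated])
  then have "{x. f x \<noteq> g x} = {}" using op open_not_negligible by blast
  then show ?thesis by blast
qed

lemma continuous_on_polynomial_function:
  fixes p :: "'a::euclidean_space \<Rightarrow> complex"
  assumes "polynomial_function p" shows "continuous_on S p"
  using polynomial_function_complex_derivative(1)[OF assms]
  by (meson continuous_at_imp_continuous_on has_derivative_continuous)

text \<open>The polynomial representing the Dunkl Laplacian inherits homogeneity of degree m - 2 for
  nonzero \<open>c\<close>, first off the hyperplanes and then by continuity. Letting
  \<open>c\<close> tend to 0 excludes negative degrees and supplies the case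
  \<open>c = 0\<close>.\<close>

lemma dunkl_laplacian_hom_polys:
  fixes p :: "'a::euclidean_space \<Rightarrow> complex"
  assumes p: "p \<in> hom_polys m" and fin: "finite P" and P: "0 \<notin> P"
  obtains g where "if m < 2 then g = (\<lambda>x. 0) else g \<in> hom_polys (m - 2)"
    "\<And>x. \<forall>\<alpha>\<in>P. \<alpha> \<bullet> x \<noteq> 0 \<Longrightarrow> dunkl_laplacian P k p x = g x"
proof -
  note poly = hom_polysD(1)[OF p]
  obtain g where g: "polynomial_function g" and eq: "\<And>x. \<forall>\<alpha>\<in>P. \<alpha> \<bullet> x \<noteq> 0 \<Longrightarrow> dunkl_laplacian P k p x = g x"
    using dunkl_laplacian_polynomial[OF poly fin P] by blast
  have hom: "g (c *\<^sub>R x) = of_real (c ^ m) / (of_real c)\<^sup>2 * g x" if c: "c \<noteq> 0" for c x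
  proof (rule eq_off_hyperplanes_imp_eq[OF fin P])
    show "continuous_on UNIV (\<lambda>x. g (c *\<^sub>R x))"
      by (rule continuous_on_compose2[OF continuous_on_polynomial_function[OF g, of UNIV]])
        (auto intro: continuous_intros)
    show "continuous_on UNIV (\<lambda>x. of_real (c ^ m) / (of_real c)\<^sup>2 * g x)"
      by (intro continuous_intros continuous_on_polynomial_function[OF g])
    fix x assume x: "\<forall>\<alpha>\<in>P. \<alpha> \<bullet> x \<noteq> 0"
    then have "\<forall>\<alpha>\<in>P. \<alpha> \<bullet> (c *\<^sub>R x) \<noteq> 0" using c by simp
    from eq[OF this] eq[OF x] dunkl_laplacian_scaling[OF poly hom_polysD(2)[OF p] c, of P k x]
    show "g (c *\<^sub>R x) = of_real (c ^ m) / (of_real c)\<^sup>2 * g x" by simp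
  qed
  have lim: "((\<lambda>c. g (c *\<^sub>R x)) \<longlongrightarrow> g 0) (at 0)" for x
  proof -
    have "isCont g 0" using continuous_on_polynomial_function[OF g, of UNIV] by (simp add: continuous_on_eq_continuous_at)
    moreover have "((\<lambda>c. c *\<^sub>R x) \<longlongrightarrow> 0 *\<^sub>R x) (at (0::real))" by (intro tendsto_intros)
    ultimately show ?thesis using isCont_tendsto_compose[of 0 g "\<lambda>c. c *\<^sub>R x"] by simp
  qed
  have ev: "\<forall>\<^sub>F c in at (0::real). c \<noteq> 0" by (simp add: eventually_at_filter)
  show ?thesis
  proof (cases "m < 2")
    case True
    have "g x = 0" for x
    proof -
      \<comment> \<open>The factor clears the negative power of \<open>c\<close>; the function is
        then constant in \<open>c\<close> and has limit 0.\<close>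
      have "((\<lambda>c. of_real (c ^ (2 - m)) * g (c *\<^sub>R x)) \<longlongrightarrow> of_real (0 ^ (2 - m)) * g 0) (at 0)"
        by (intro tendsto_intros lim)
      moreover have "\<forall>\<^sub>F c in at (0::real). of_real (c ^ (2 - m)) * g (c *\<^sub>R x) = g x"
        using ev
      proof eventually_elim
        case (elim c)
        have "c ^ 2 = c ^ (2 - m) * c ^ m" using True by (simp flip: power_add)
        then show ?case using elim by (simp add: hom field_simps flip: of_real_power of_real_mult)
      qed
      ultimately have "((\<lambda>c. g x) \<longlongrightarrow> of_real (0 ^ (2 - m)) * g 0) (at (0::real))"
        by (rule Lim_transform_eventually)
      then have "g x = of_real (0 ^ (2 - m)) * g 0" by (rule tendsto_unique[rotated 2]) auto
      then show ?thesis using True by simp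
    qed
    then show ?thesis using that[of "\<lambda>x. 0"] eq True by simp
  next
    case False
    have hom': "g (c *\<^sub>R x) = of_real (c ^ (m - 2)) * g x" if "c \<noteq> 0" for c x
    proof -
      have "m - 2 + 2 = m" using False by simp
      then have "c ^ m = c ^ (m - 2) * c ^ 2" using power_add[of c "m - 2" 2] by (simp only:)
      then show ?thesis using that by (simp add: hom)
    qed
    \<comment> \<open>Homogeneity at \<open>c = 0\<close>. For \<open>m = 2\<close> the factor is
      \<open>0 ^ 0 = 1\<close>, and the conclusion is that \<open>g\<close> is constant.\<close>
    have "((\<lambda>c. of_real (c ^ (m - 2)) * g x) \<longlongrightarrow> of_real (0 ^ (m - 2)) * g x) (at 0)" for x
      by (intro tendsto_intros)
    moreover have "\<forall>\<^sub>F c in at (0::real). of_real (c ^ (m - 2)) * g x = g (c *\<^sub>R x)" for x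
      using ev by eventually_elim (simp add: hom')
    ultimately have "((\<lambda>c. g (c *\<^sub>R x)) \<longlongrightarrow> of_real (0 ^ (m - 2)) * g x) (at 0)" for x
      by (rule Lim_transform_eventually)
    then have g0: "g 0 = of_real (0 ^ (m - 2)) * g x" for x
      by (rule tendsto_unique[OF _ lim, rotated]) simp
    have "g (c *\<^sub>R x) = of_real (c ^ (m - 2)) * g x" for c x
    proof (cases "c = 0")
      case True
      then show ?thesis using g0[of x] by simp
    qed (rule hom')
    then have "g \<in> hom_polys (m - 2)"
      unfolding hom_polys_def using g by blast
    then show ?thesis using that[of g] eq False by simp
  qed
qed

lemma hom_polys_add:
  assumes "p \<in> hom_polys m" "q \<in> hom_polys m" shows "(\<lambda>x. p x + q x) \<in> hom_polys m"
  using assms by (auto simp: hom_polys_def distrib_left)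

lemma hom_polys_scale:
  fixes p :: "'a::euclidean_space \<Rightarrow> complex"
  assumes "p \<in> hom_polys m" shows "(\<lambda>x. c * p x) \<in> hom_polys m"
  using assms polynomial_function_complex_mult[of "\<lambda>x. c" p] by (auto simp: hom_polys_def mult_ac)

lemma hom_polys_mult:
  fixes p q :: "'a::euclidean_space \<Rightarrow> complex"
  assumes "p \<in> hom_polys m" "q \<in> hom_polys n" shows "(\<lambda>x. p x * q x) \<in> hom_polys (m + n)"
  using assms by (auto simp: hom_polys_def power_add intro: polynomial_function_complex_mult)

lemma norm_sq_hom_polys: "(\<lambda>x::'a::euclidean_space. of_real (x \<bullet> x) :: complex) \<in> hom_polys 2"
  by (simp add: hom_polys_def polynomial_function_of_real_norm_sq power2_eq_square)

lemma norm_sq_power_hom_polys: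
  fixes p :: "'a::euclidean_space \<Rightarrow> complex"
  assumes "p \<in> hom_polys m" shows "(\<lambda>x. of_real ((x \<bullet> x) ^ j) * p x) \<in> hom_polys (m + 2 * j)"
proof (induction j)
  case 0
  then show ?case using assms by simp
next
  case (Suc j)
  from hom_polys_mult[OF norm_sq_hom_polys Suc] show ?case by (simp add: mult.assoc)
qed

lemma dunkl_harmonicsD:
  assumes "p \<in> dunkl_harmonics P k m"
  shows "p \<in> hom_polys m" "\<forall>\<alpha>\<in>P. \<alpha> \<bullet> x \<noteq> 0 \<Longrightarrow> dunkl_laplacian P k p x = 0"
  using assms by (auto simp: dunkl_harmonics_eq)

lemma dunkl_harmonicsI:
  assumes "p \<in> hom_polys m" "\<And>x. \<forall>\<alpha>\<in>P. \<alpha> \<bullet> x \<noteq> 0 \<Longrightarrow> dunkl_laplacian P k p x = 0"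
  shows "p \<in> dunkl_harmonics P k m"
  using assms by (auto simp: dunkl_harmonics_eq)

lemma dunkl_harmonics_add:
  assumes "p \<in> dunkl_harmonics P k m" "q \<in> dunkl_harmonics P k m"
  shows "(\<lambda>x. p x + q x) \<in> dunkl_harmonics P k m"
proof (rule dunkl_harmonicsI)
  note p = dunkl_harmonicsD[OF assms(1)] and q = dunkl_harmonicsD[OF assms(2)]
  show "(\<lambda>x. p x + q x) \<in> hom_polys m" by (rule hom_polys_add[OF p(1) q(1)])
  show "dunkl_laplacian P k (\<lambda>x. p x + q x) x = 0" if "\<forall>\<alpha>\<in>P. \<alpha> \<bullet> x \<noteq> 0" for x
    unfolding dunkl_laplacian_add[OF hom_polysD(1)[OF p(1)] hom_polysD(1)[OF q(1)]] p(2)[OF that] q(2)[OF that] by simp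
qed

lemma dunkl_harmonics_scale:
  assumes "p \<in> dunkl_harmonics P k m"
  shows "(\<lambda>x. c * p x) \<in> dunkl_harmonics P k m"
proof (rule dunkl_harmonicsI)
  note p = dunkl_harmonicsD[OF assms(1)]
  show "(\<lambda>x. c * p x) \<in> hom_polys m" by (rule hom_polys_scale[OF p(1)])
  show "dunkl_laplacian P k (\<lambda>x. c * p x) x = 0" if "\<forall>\<alpha>\<in>P. \<alpha> \<bullet> x \<noteq> 0" for x
    unfolding dunkl_laplacian_scale[OF hom_polysD(1)[OF p(1)]] p(2)[OF that] by simp
qed

lemma dunkl_harmonics_zero: "(\<lambda>x. 0) \<in> dunkl_harmonics P k m"
proof -
  have "frechet_derivative (\<lambda>x::'a. 0 :: complex) (at x) = (\<lambda>h. 0)" for x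
    by (rule frechet_derivative_at[symmetric]) simp
  then show ?thesis by (simp add: dunkl_harmonics_def dunkl_laplacian_def laplacian_def)
qed

text \<open>An inductive predicate in place of explicit finite sums: statements are checked on one
  term and carried through \<open>add\<close>. Scalars can be moved into the harmonic
  factor.\<close>

inductive fischer :: "'a::euclidean_space set \<Rightarrow> ('a \<Rightarrow> real) \<Rightarrow> nat \<Rightarrow> ('a \<Rightarrow> complex) \<Rightarrow> bool"
  for P k where
  harmonic: "h \<in> dunkl_harmonics P k m \<Longrightarrow> fischer P k (m + 2 * j) (\<lambda>x. of_real ((x \<bullet> x) ^ j) * h x)"
| add: "fischer P k m p \<Longrightarrow> fischer P k m q \<Longrightarrow> fischer P k m (\<lambda>x. p x + q x)"

lemma fischer_hom_polys: "fischer P k m p \<Longrightarrow> p \<in> hom_polys m"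
proof (induction rule: fischer.induct)
  case (harmonic h m j)
  then show ?case by (intro norm_sq_power_hom_polys dunkl_harmonicsD)
qed (rule hom_polys_add)

lemma fischer_norm_sq:
  "fischer P k m p \<Longrightarrow> fischer P k (m + 2) (\<lambda>x. of_real (x \<bullet> x) * p x)"
proof (induction rule: fischer.induct)
  case (harmonic h m j)
  from fischer.harmonic[OF this, of "Suc j"] show ?case by (simp add: mult.assoc)
next
  case (add m p q)
  from fischer.add[OF add.IH] show ?case by (simp add: distrib_left)
qed

text \<open>Each further factor \<open>x \<bullet> x\<close> meets a homogeneous polynomial of
  degree \<open>m + 2 * i\<close>, whose Euler term contributes \<open>4 * (m + 2 * i)\<close>.
  Harmonicity kills what remains at the bottom.\<close>

lemma dunkl_laplacian_norm_sq_power: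
  fixes h :: "'a::euclidean_space \<Rightarrow> complex"
  assumes h: "h \<in> dunkl_harmonics P k m" and P: "0 \<notin> P" and x: "\<forall>\<alpha>\<in>P. \<alpha> \<bullet> x \<noteq> 0"
  shows "dunkl_laplacian P k (\<lambda>x. of_real ((x \<bullet> x) ^ Suc j) * h x) x =
    of_real ((\<Sum>i\<le>j. 4 * real (m + 2 * i) + 2 * real DIM('a) + 4 * mult_index P k) * (x \<bullet> x) ^ j) * h x"
proof (induction j)
  case 0
  have hh: "h \<in> hom_polys m" and "dunkl_laplacian P k h x = 0" by (rule dunkl_harmonicsD[OF h])+ (rule x)
  then show ?case
    using dunkl_laplacian_norm_sq[OF hom_polysD(1)[OF hh] P x, of k] frechet_derivative_euler[OF hh, of x]
    by (simp add: algebra_simps)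
next
  case (Suc j)
  let ?q = "\<lambda>x. of_real ((x \<bullet> x) ^ Suc j) * h x"
  have hh: "h \<in> hom_polys m" by (rule dunkl_harmonicsD[OF h])
  note q = norm_sq_power_hom_polys[OF hh, of "Suc j"]
  have "dunkl_laplacian P k (\<lambda>x. of_real ((x \<bullet> x) ^ Suc (Suc j)) * h x) x
    = dunkl_laplacian P k (\<lambda>x. of_real (x \<bullet> x) * ?q x) x" by (simp add: mult.assoc)
  also have "\<dots> = of_real (x \<bullet> x) * dunkl_laplacian P k ?q x + 4 * (of_nat (m + 2 * Suc j) * ?q x)
     + of_real (2 * real DIM('a) + 4 * mult_index P k) * ?q x"
    unfolding dunkl_laplacian_norm_sq[OF hom_polysD(1)[OF q] P x] frechet_derivative_euler[OF q] ..
  also have "\<dots> = of_real ((\<Sum>i\<le>Suc j. 4 * real (m + 2 * i) + 2 * real DIM('a) + 4 * mult_index P k) * (x \<bullet> x) ^ Suc j) * h x"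
  proof -
    have "of_real u * (of_real (S * X) * H) + 4 * (of_nat r * (of_real (u * X) * H)) + of_real K * (of_real (u * X) * H)
      = of_real ((S + (4 * real r + K)) * (u * X)) * H" for u S X K :: real and H :: complex and r
      by (simp add: algebra_simps)
    from this[of "x \<bullet> x" _ "(x \<bullet> x) ^ j" "h x" "m + 2 * Suc j" "2 * real DIM('a) + 4 * mult_index P k"]
    show ?thesis unfolding Suc sum.atMost_Suc power_Suc[symmetric] add.assoc .
  qed
  finally show ?case .
qed

text \<open>The constant of \<open>dunkl_laplacian_norm_sq_power\<close> is positive, since the
  dimension is and the index is nonnegative; dividing by it inverts q -> \<Delta>_k(|x|^2 q) term by
  term.\<close>

lemma fischer_solve:
  fixes g :: "'a::euclidean_space \<Rightarrow> complex"
  assumes "fischer P k m g" and P: "0 \<notin> P" and k: "0 \<le> mult_index P k"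
  shows "\<exists>q. fischer P k m q \<and> (\<forall>x. (\<forall>\<alpha>\<in>P. \<alpha> \<bullet> x \<noteq> 0) \<longrightarrow> dunkl_laplacian P k (\<lambda>x. of_real (x \<bullet> x) * q x) x = g x)"
  using assms(1)
proof (induction rule: fischer.induct)
  case (harmonic h m j)
  define c where "c = (\<Sum>i\<le>j. 4 * real (m + 2 * i) + 2 * real DIM('a) + 4 * mult_index P k)"
  have "0 < 4 * real (m + 2 * i) + 2 * real DIM('a) + 4 * mult_index P k" for i
    using k by (intro add_pos_nonneg add_nonneg_pos) auto
  then have c: "c > 0" unfolding c_def by (intro sum_pos) auto
  define h' where "h' x = of_real (1 / c) * h x" for x
  have h': "h' \<in> dunkl_harmonics P k m"
    unfolding h'_def by (rule dunkl_harmonics_scale[OF harmonic])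
  show ?case
  proof (intro exI conjI allI impI)
    show "fischer P k (m + 2 * j) (\<lambda>x. of_real ((x \<bullet> x) ^ j) * h' x)" by (rule fischer.harmonic[OF h'])
    fix x assume x: "\<forall>\<alpha>\<in>P. \<alpha> \<bullet> x \<noteq> 0"
    have "(\<lambda>x. of_real (x \<bullet> x) * (of_real ((x \<bullet> x) ^ j) * h' x)) = (\<lambda>x. of_real ((x \<bullet> x) ^ Suc j) * h' x)"
      by (simp add: mult.assoc)
    then have "dunkl_laplacian P k (\<lambda>x. of_real (x \<bullet> x) * (of_real ((x \<bullet> x) ^ j) * h' x)) x = of_real (c * (x \<bullet> x) ^ j) * h' x"
      using dunkl_laplacian_norm_sq_power[OF h' P x, of j] unfolding c_def by (simp only:)
    also have "\<dots> = of_real ((x \<bullet> x) ^ j) * h x"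
      using c by (simp add: h'_def)
    finally show "dunkl_laplacian P k (\<lambda>x. of_real (x \<bullet> x) * (of_real ((x \<bullet> x) ^ j) * h' x)) x = of_real ((x \<bullet> x) ^ j) * h x" .
  qed
next
  case (add m p q)
  from add.IH(1) obtain p' where p': "fischer P k m p'" "\<And>x. (\<forall>\<alpha>\<in>P. \<alpha> \<bullet> x \<noteq> 0) \<Longrightarrow> dunkl_laplacian P k (\<lambda>x. of_real (x \<bullet> x) * p' x) x = p x"
    by blast
  from add.IH(2) obtain q' where q': "fischer P k m q'" "\<And>x. (\<forall>\<alpha>\<in>P. \<alpha> \<bullet> x \<noteq> 0) \<Longrightarrow> dunkl_laplacian P k (\<lambda>x. of_real (x \<bullet> x) * q' x) x = q x"
    by blast
  have "polynomial_function (\<lambda>x. of_real (x \<bullet> x) * p' x)" "polynomial_function (\<lambda>x. of_real (x \<bullet> x) * q' x)"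
    using hom_polysD(1)[OF fischer_hom_polys] p' q' polynomial_function_complex_mult polynomial_function_of_real_norm_sq by blast+
  from dunkl_laplacian_add[OF this] show ?case
    using p' q' fischer.add[OF p'(1) q'(1)] by (intro exI[of _ "\<lambda>x. p' x + q' x"]) (simp add: distrib_left)
qed

text \<open>The Dunkl Laplacian of \<open>p\<close> has degree m - 2, so by induction it equals that
  of |x|^2 q for a decomposed \<open>q\<close>. The difference of \<open>p\<close> and |x|^2 q is
  harmonic.\<close>

lemma fischer_decomposition:
  fixes p :: "'a::euclidean_space \<Rightarrow> complex"
  assumes "p \<in> hom_polys m" and fin: "finite P" and P: "0 \<notin> P" and k: "0 \<le> mult_index P k"
  shows "fischer P k m p"
  using assms(1)
proof (induction m arbitrary: p rule: less_induct)
  case (less m)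
  obtain g where g: "if m < 2 then g = (\<lambda>x. 0) else g \<in> hom_polys (m - 2)"
    and eq: "\<And>x. \<forall>\<alpha>\<in>P. \<alpha> \<bullet> x \<noteq> 0 \<Longrightarrow> dunkl_laplacian P k p x = g x"
    using dunkl_laplacian_hom_polys[OF less.prems fin P, of k] by metis
  show ?case
  proof (cases "m < 2")
    case True
    then have "p \<in> dunkl_harmonics P k m" using g eq less.prems by (simp add: dunkl_harmonics_eq)
    from fischer.harmonic[OF this, of 0] show ?thesis by simp
  next
    case False
    then have m: "m - 2 + 2 = m" by simp
    from False g have "fischer P k (m - 2) g" by (intro less.IH) auto
    from fischer_solve[OF this P k] obtain q where q: "fischer P k (m - 2) q"
      and qg: "\<And>x. \<forall>\<alpha>\<in>P. \<alpha> \<bullet> x \<noteq> 0 \<Longrightarrow> dunkl_laplacian P k (\<lambda>x. of_real (x \<bullet> x) * q x) x = g x"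
      by blast
    let ?r = "\<lambda>x. of_real (x \<bullet> x) * q x"
    have r: "fischer P k m ?r" using fischer_norm_sq[OF q] m by simp
    have r': "(\<lambda>x. (-1) * ?r x) \<in> hom_polys m" by (rule hom_polys_scale[OF fischer_hom_polys[OF r]])
    have "(\<lambda>x. p x + (-1) * ?r x) \<in> dunkl_harmonics P k m"
    proof (rule dunkl_harmonicsI)
      show "(\<lambda>x. p x + (-1) * ?r x) \<in> hom_polys m" by (rule hom_polys_add[OF less.prems r'])
      show "dunkl_laplacian P k (\<lambda>x. p x + (-1) * ?r x) x = 0" if "\<forall>\<alpha>\<in>P. \<alpha> \<bullet> x \<noteq> 0" for x
        unfolding dunkl_laplacian_add[OF hom_polysD(1)[OF less.prems] hom_polysD(1)[OF r']]
          dunkl_laplacian_scale[OF hom_polysD(1)[OF fischer_hom_polys[OF r]]] eq[OF that] qg[OF that] by simp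
    qed
    from fischer.add[OF fischer.harmonic[OF this, of 0, simplified] r] show ?thesis by simp
  qed
qed

section \<open>Polynomials as sums of homogeneous ones\<close>

inductive hom_sum :: "('a::euclidean_space \<Rightarrow> complex) \<Rightarrow> bool" where
  hom: "p \<in> hom_polys m \<Longrightarrow> hom_sum p"
| add: "hom_sum p \<Longrightarrow> hom_sum q \<Longrightarrow> hom_sum (\<lambda>x. p x + q x)"

lemma hom_sum_mult:
  assumes "hom_sum p" "hom_sum q" shows "hom_sum (\<lambda>x. p x * q x)"
  using assms(1)
proof (induction rule: hom_sum.induct)
  case (hom p m)
  from assms(2) show ?case
  proof (induction rule: hom_sum.induct)
    case (hom q n)
    with \<open>p \<in> hom_polys m\<close> show ?case by (intro hom_sum.hom[OF hom_polys_mult])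
  next
    case (add q r)
    from hom_sum.add[OF add.IH] show ?case by (simp add: distrib_left)
  qed
next
  case (add p r)
  from hom_sum.add[OF add.IH] show ?case by (simp add: distrib_right)
qed

lemma real_polynomial_hom_sum:
  fixes p :: "'a::euclidean_space \<Rightarrow> real"
  assumes "real_polynomial_function p" shows "hom_sum (\<lambda>x. of_real (p x))"
  using assms
proof (induction rule: real_polynomial_function.induct)
  case (linear f)
  then have "(\<lambda>x. of_real (f x)) \<in> hom_polys 1"
    by (auto simp: hom_polys_def polynomial_function_complex_iff linear_scale[OF bounded_linear.linear]
        intro: real_polynomial_function.intros)
  then show ?case by (rule hom_sum.hom)
next
  case (const c)
  have "(\<lambda>x. of_real c) \<in> hom_polys 0"
    by (auto simp: hom_polys_def)
  then show ?case by (rule hom_sum.hom)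
next
  case (add f g)
  from hom_sum.add[OF add.IH] show ?case by simp
next
  case (mult f g)
  from hom_sum_mult[OF mult.IH] show ?case by simp
qed

lemma polynomial_hom_sum:
  fixes p :: "'a::euclidean_space \<Rightarrow> complex"
  assumes "polynomial_function p" shows "hom_sum p"
proof -
  have 1: "hom_sum (\<lambda>x. of_real (Re (p x)))" "hom_sum (\<lambda>x. of_real (Im (p x)))"
    using assms by (auto simp: polynomial_function_complex_iff intro: real_polynomial_hom_sum)
  have "(\<lambda>x::'a. \<i>) \<in> hom_polys 0" by (auto simp: hom_polys_def)
  from hom_sum.add[OF 1(1) hom_sum_mult[OF hom_sum.hom[OF this] 1(2)]]
  show ?thesis by (simp flip: complex_eq)
qed

section \<open>Exponential moments of the weighted measure\<close>

lemma dyadic_bounds: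
  fixes r :: real assumes "1 \<le> r" obtains j :: nat where "2 ^ j \<le> r" "r < 2 ^ Suc j"
proof -
  obtain n where n: "r < 2 ^ n" using real_arch_pow[of 2 r] by auto
  define m where "m = (LEAST n. r < 2 ^ n)"
  have m: "r < 2 ^ m" unfolding m_def using n by (rule LeastI)
  then obtain j where j: "m = Suc j" using assms by (cases m) auto
  have "\<not> r < 2 ^ j" using not_less_Least[of j "\<lambda>n. r < 2 ^ n"] j unfolding m_def by simp
  then show ?thesis using that[of j] m j by simp
qed

text \<open>Stands in for polar coordinates: a function is bounded by a series of constants on
  balls. One ball per point suffices because the other terms of the series are nonnegative.\<close>

lemma nn_integral_geometric_cball:
  fixes c R :: "nat \<Rightarrow> real"
  assumes "\<And>j. 0 \<le> c j" "\<And>j. 0 \<le> R j" "summable (\<lambda>j. c j * R j ^ DIM('a))"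
    and le: "\<And>x::'a::euclidean_space. x \<in> A \<Longrightarrow> \<exists>j. norm x \<le> R j \<and> f x \<le> c j"
  shows "(\<integral>\<^sup>+ x. ennreal (f x) * indicator A x \<partial>lborel) < \<infinity>"
proof -
  have "(\<integral>\<^sup>+ x. ennreal (f x) * indicator A x \<partial>lborel) \<le> (\<integral>\<^sup>+ x. (\<Sum>j. ennreal (c j) * indicator (cball (0::'a) (R j)) x) \<partial>lborel)"
  proof (rule nn_integral_mono)
    fix x
    show "ennreal (f x) * indicator A x \<le> (\<Sum>j. ennreal (c j) * indicator (cball (0::'a) (R j)) x)"
    proof (cases "x \<in> A")
      case True
      from le[OF this] obtain j where j: "norm x \<le> R j" "f x \<le> c j" by blast
      have "ennreal (f x) * indicator A x \<le> (\<Sum>j\<in>{j}. ennreal (c j) * indicator (cball (0::'a) (R j)) x)"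
        using True j by (simp add: ennreal_leI)
      also have "\<dots> \<le> (\<Sum>j. ennreal (c j) * indicator (cball (0::'a) (R j)) x)"
        by (rule sum_le_suminf[OF summableI]) auto
      finally show ?thesis .
    qed simp
  qed
  also have "\<dots> = (\<Sum>j. \<integral>\<^sup>+ x. ennreal (c j) * indicator (cball (0::'a) (R j)) x \<partial>lborel)"
    by (rule nn_integral_suminf) (intro borel_measurable_times_ennreal borel_measurable_const borel_measurable_indicator, simp)
  also have "\<dots> = (\<Sum>j. ennreal (unit_ball_vol DIM('a) * (c j * R j ^ DIM('a))))"
    using assms(1,2) by (intro suminf_cong)
      (subst nn_integral_cmult_indicator, simp_all add: emeasure_cball ennreal_mult[symmetric] mult_ac)
  also have "\<dots> < \<infinity>"
    unfolding infinity_ennreal_def less_top[symmetric]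
    by (intro ennreal_suminf_neq_top summable_mult mult_nonneg_nonneg zero_le_power assms unit_ball_vol_nonneg) simp
  finally show ?thesis .
qed

text \<open>On the shell where \<open>2 ^ j * norm x\<close> lies between 1/2 and 1, its power is at
  most \<open>2 powr \<bar>\<tau>\<bar>\<close> for either sign of \<tau>. The remaining factor
  times the volume of the ball is geometric with ratio 2^-(\<tau> + N), which is below 1.\<close>

lemma nn_integral_norm_powr_near_0:
  assumes "\<tau> > - real DIM('a)"
  shows "(\<integral>\<^sup>+ x. ennreal (norm x powr \<tau>) * indicator {x. x \<noteq> 0 \<and> norm x \<le> 1} (x::'a::euclidean_space) \<partial>lborel) < \<infinity>"
proof (rule nn_integral_geometric_cball[of "\<lambda>j. 2 powr \<bar>\<tau>\<bar> * (2 powr (- \<tau>)) ^ j" "\<lambda>j. (1/2) ^ j"])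
  have "2 powr (- (\<tau> + real DIM('a))) < 2 powr 0" using assms by (subst powr_less_cancel_iff) auto
  then have "summable (\<lambda>j. 2 powr \<bar>\<tau>\<bar> * (2 powr (- (\<tau> + real DIM('a)))) ^ j)"
    by (intro summable_mult summable_geometric) simp
  moreover have "2 powr \<bar>\<tau>\<bar> * (2 powr (- \<tau>)) ^ j * ((1/2) ^ j) ^ DIM('a) = 2 powr \<bar>\<tau>\<bar> * (2 powr (- (\<tau> + real DIM('a)))) ^ j" for j :: nat
  proof -
    have eq: "2 powr (- (\<tau> + real DIM('a))) = 2 powr (- \<tau>) * (1/2) ^ DIM('a)"
    proof -
      have "2 powr (- (\<tau> + real DIM('a))) = 2 powr (- \<tau>) * 2 powr (- real DIM('a))"
        by (subst powr_add[symmetric]) simp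
      also have "2 powr (- real DIM('a)) = (1/2) ^ DIM('a)"
        by (simp add: powr_minus_divide powr_realpow power_one_over)
      finally show ?thesis .
    qed
    have swap: "((1/2::real) ^ j) ^ DIM('a) = ((1/2) ^ DIM('a)) ^ j"
      by (simp only: power_mult[symmetric] mult.commute[of j])
    show ?thesis
      unfolding eq swap power_mult_distrib mult.assoc ..
  qed
  ultimately show "summable (\<lambda>j. 2 powr \<bar>\<tau>\<bar> * (2 powr (- \<tau>)) ^ j * ((1/2) ^ j) ^ DIM('a))" by (simp only:)
  fix x :: 'a assume "x \<in> {x. x \<noteq> 0 \<and> norm x \<le> 1}"
  then have x: "0 < norm x" "norm x \<le> 1" by auto
  then have "1 \<le> 1 / norm x" by simp
  then obtain j where j: "2 ^ j \<le> 1 / norm x" "1 / norm x < 2 ^ Suc j" by (rule dyadic_bounds)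
  have "(2 ^ j) * norm x \<le> 1" "1 < (2 ^ j * norm x) * 2" using j x by (auto simp: field_simps)
  then have u: "2 ^ j * norm x \<le> 1" "1 / 2 \<le> 2 ^ j * norm x" by auto
  have "(2 ^ j * norm x) powr \<tau> \<le> 2 powr \<bar>\<tau>\<bar>"
  proof (cases "\<tau> \<ge> 0")
    case True
    have "(2 ^ j * norm x) powr \<tau> \<le> 1 powr \<tau>" using u x True by (intro powr_mono2) auto
    also have "\<dots> \<le> 2 powr \<bar>\<tau>\<bar>" using ge_one_powr_ge_zero[of 2 "\<bar>\<tau>\<bar>"] by simp
    finally show ?thesis .
  next
    case False
    have "(2 ^ j * norm x) powr \<tau> \<le> (1/2) powr \<tau>" using u x False by (intro powr_mono2') auto
    also have "\<dots> = 2 powr \<bar>\<tau>\<bar>" using False by (simp add: powr_divide powr_minus_divide)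
    finally show ?thesis .
  qed
  moreover have "norm x powr \<tau> = (2 ^ j * norm x) powr \<tau> * (2 powr (- \<tau>)) ^ j"
  proof -
    have "(2 ^ j :: real) powr \<tau> = (2 powr \<tau>) ^ j"
      by (induction j) (simp_all add: powr_mult)
    moreover have "(2 powr \<tau>) ^ j * (2 powr (- \<tau>)) ^ j = 1"
      by (simp add: power_mult_distrib[symmetric] powr_add[symmetric])
    ultimately show ?thesis by (simp add: powr_mult)
  qed
  ultimately have "norm x powr \<tau> \<le> 2 powr \<bar>\<tau>\<bar> * (2 powr (- \<tau>)) ^ j"
    by (simp add: mult_right_mono)
  moreover have "norm x \<le> (1/2) ^ j" using u(1) by (simp add: field_simps power_one_over)
  ultimately show "\<exists>j. norm x \<le> (1 / 2) ^ j \<and> norm x powr \<tau> \<le> 2 powr \<bar>\<tau>\<bar> * (2 powr (- \<tau>)) ^ j" by blast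
qed auto

text \<open>On dyadic shells the decay 2^-j(N+1) against a volume of order 2^(j+1)N leaves 2^N
  2^-j.\<close>

lemma nn_integral_norm_tail:
  "(\<integral>\<^sup>+ x. ennreal (1 / norm x ^ Suc DIM('a)) * indicator {x. 1 \<le> norm x} (x::'a::euclidean_space) \<partial>lborel) < \<infinity>"
proof (rule nn_integral_geometric_cball[of "\<lambda>j. (1/2) ^ (j * Suc DIM('a))" "\<lambda>j. 2 ^ Suc j"])
  have "(1/2::real) ^ (j * Suc DIM('a)) * (2 ^ Suc j) ^ DIM('a) = 2 ^ DIM('a) * (1/2) ^ j" for j
    by (simp add: power_mult_distrib power_add power_mult[symmetric] power_one_over field_simps)
  moreover have "summable (\<lambda>j. 2 ^ DIM('a) * (1/2::real) ^ j)" by (intro summable_mult summable_geometric) simp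
  ultimately show "summable (\<lambda>j. (1/2::real) ^ (j * Suc DIM('a)) * (2 ^ Suc j) ^ DIM('a))" by (simp only:)
  fix x :: 'a assume "x \<in> {x. 1 \<le> norm x}"
  then have x: "1 \<le> norm x" by simp
  then obtain j where j: "2 ^ j \<le> norm x" "norm x < 2 ^ Suc j" by (rule dyadic_bounds)
  have "(2 ^ j :: real) ^ Suc DIM('a) \<le> norm x ^ Suc DIM('a)" by (intro power_mono j) auto
  moreover have "0 < (2 ^ j :: real) ^ Suc DIM('a)" "0 < norm x ^ Suc DIM('a)"
    using x by (intro zero_less_power; auto)+
  ultimately have "1 / norm x ^ Suc DIM('a) \<le> 1 / (2 ^ j) ^ Suc DIM('a)"
    by (intro divide_left_mono mult_pos_pos) auto
  also have "\<dots> = (1/2) ^ (j * Suc DIM('a))" by (simp only: power_one_over power_mult)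
  finally show "\<exists>j. norm x \<le> 2 ^ Suc j \<and> 1 / norm x ^ Suc DIM('a) \<le> (1/2) ^ (j * Suc DIM('a))"
    using j(2) by (intro exI[of _ j]) auto
qed auto

text \<open>A single term of the exponential series is at most its sum.\<close>

lemma power_exp_bounded:
  fixes c t :: real
  assumes "c > 0" "0 \<le> t"
  shows "t ^ n * exp (- (c * t)) \<le> fact n / c ^ n"
proof -
  have "(c * t) ^ n / fact n \<le> exp (c * t)"
  proof -
    have "(\<Sum>i\<in>{n}. (c * t) ^ i / fact i) \<le> (\<Sum>i. (c * t) ^ i / fact i)"
      using assms summable_exp[of "c * t"] by (intro sum_le_suminf) (auto simp: field_simps)
    then show ?thesis by (simp add: exp_def divide_inverse mult.commute)
  qed
  then have "(c * t) ^ n * exp (- (c * t)) \<le> fact n"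
    by (simp add: exp_minus field_simps)
  then show ?thesis using assms by (simp add: power_mult_distrib field_simps)
qed

locale ka_weight =
  fixes P :: "'a::euclidean_space set" and k :: "'a \<Rightarrow> real" and a :: real
  assumes fin: "finite P" and P0: "0 \<notin> P" and k0: "\<And>\<alpha>. \<alpha> \<in> P \<Longrightarrow> 0 \<le> k \<alpha>"
    and a0: "0 < a" and dim: "2 < a + 2 * mult_index P k + real DIM('a)"
begin

abbreviation M where "M \<equiv> mu P k a"

definition tt :: "'a \<Rightarrow> real" where "tt x = 2 / a * norm x powr a"

lemma tt_nonneg [simp]: "0 \<le> tt x"
  using a0 by (simp add: tt_def)

lemma mult_index_nonneg: "0 \<le> mult_index P k"
  unfolding mult_index_def by (intro sum_nonneg k0)

lemma measurable_theta [measurable]: "theta P k \<in> borel_measurable borel"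
  unfolding theta_def[abs_def] by measurable

lemma measurable_tt [measurable]: "tt \<in> borel_measurable borel"
  unfolding tt_def[abs_def] by measurable

lemma sets_M [measurable_cong, simp]: "sets M = sets borel"
  by (simp add: mu_def)

lemma space_M [simp]: "space M = UNIV"
  by (simp add: mu_def)

text \<open>Cauchy-Schwarz in each factor. The origin is excluded because of
  \<open>0 powr 0 = 0\<close>: for empty \<open>P\<close> the left side is 1 there and the right
  side 0.\<close>

lemma theta_bound:
  obtains C where "C \<ge> 0" "\<And>x. x \<noteq> 0 \<Longrightarrow> theta P k x \<le> C * norm x powr (2 * mult_index P k)"
proof -
  let ?C = "\<Prod>\<alpha>\<in>P. norm \<alpha> powr (2 * k \<alpha>)"
  have "theta P k x \<le> ?C * norm x powr (2 * mult_index P k)" if "x \<noteq> 0" for x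
  proof -
    have "theta P k x \<le> (\<Prod>\<alpha>\<in>P. norm \<alpha> powr (2 * k \<alpha>) * norm x powr (2 * k \<alpha>))"
      unfolding theta_def
    proof (rule prod_mono)
      fix \<alpha> assume "\<alpha> \<in> P"
      have "\<bar>\<alpha> \<bullet> x\<bar> powr (2 * k \<alpha>) \<le> (norm \<alpha> * norm x) powr (2 * k \<alpha>)"
        using k0[OF \<open>\<alpha> \<in> P\<close>] by (intro powr_mono2 Cauchy_Schwarz_ineq2) auto
      then show "0 \<le> \<bar>\<alpha> \<bullet> x\<bar> powr (2 * k \<alpha>) \<and> \<bar>\<alpha> \<bullet> x\<bar> powr (2 * k \<alpha>) \<le> norm \<alpha> powr (2 * k \<alpha>) * norm x powr (2 * k \<alpha>)"
        by (simp add: powr_mult)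
    qed
    also have "\<dots> = ?C * norm x powr (\<Sum>\<alpha>\<in>P. 2 * k \<alpha>)"
      using that fin by (simp add: prod.distrib powr_sum)
    finally show ?thesis by (simp add: mult_index_def sum_distrib_left)
  qed
  then show ?thesis using that[of ?C] by (simp add: prod_nonneg)
qed

lemma nn_integral_M:
  assumes "f \<in> borel_measurable borel"
  shows "(\<integral>\<^sup>+ x. f x \<partial>M) = (\<integral>\<^sup>+ x. ennreal (norm x powr (a - 2) * theta P k x) * f x \<partial>lborel)"
  using assms unfolding mu_def by (intro nn_integral_density) auto

lemma AE_M: "(AE x in lborel. Q x) \<Longrightarrow> (AE x in M. Q x)"
  unfolding mu_def by (subst AE_density) auto

lemma AE_not_0: "AE x in M. x \<noteq> 0"
  by (rule AE_M) (rule AE_lborel_singleton)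

text \<open>The density is at most a multiple of \<open>norm x powr \<sigma>\<close>. The assumption
  \<open>dim\<close> says precisely that \<sigma> > -N, which settles the unit ball; outside it the
  exponential beats every power.\<close>

lemma nn_integral_exp_finite:
  assumes "c > 0" shows "(\<integral>\<^sup>+ x. ennreal (exp (- c * tt x)) \<partial>M) < \<infinity>"
proof -
  define \<sigma> where "\<sigma> = a - 2 + 2 * mult_index P k"
  have \<sigma>: "\<sigma> > - real DIM('a)" using dim by (simp add: \<sigma>_def)
  obtain C where C: "C \<ge> 0" "\<And>x. x \<noteq> 0 \<Longrightarrow> theta P k x \<le> C * norm x powr (2 * mult_index P k)"
    using theta_bound by blast
  have w: "norm x powr (a - 2) * theta P k x \<le> C * norm x powr \<sigma>" if "x \<noteq> 0" for x
  proof -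
    have "norm x powr (a - 2) * theta P k x \<le> norm x powr (a - 2) * (C * norm x powr (2 * mult_index P k))"
      by (intro mult_left_mono C that) auto
    then show ?thesis using that by (simp add: \<sigma>_def powr_add mult_ac)
  qed
  \<comment> \<open>Decay of order N + 1 is wanted, so the exponent \<sigma> + N + 1 is raised to a
    multiple of \<open>a\<close>, that is, to an integer power of \<open>tt x\<close>.\<close>
  obtain n :: nat where n: "\<sigma> + real (Suc DIM('a)) \<le> a * real n"
    using real_arch_simple[of "(\<sigma> + real (Suc DIM('a))) / a"] a0 by (auto simp: field_simps)
  define K where "K = (a / 2) ^ n * (fact n / c ^ n)"
  have K: "0 \<le> K" using a0 assms by (simp add: K_def)
  have tail: "norm x powr \<sigma> * exp (- c * tt x) \<le> K * (1 / norm x ^ Suc DIM('a))" if "1 \<le> norm x" for x :: 'a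
  proof -
    have "norm x powr (\<sigma> + real (Suc DIM('a))) \<le> norm x powr (a * real n)"
      using that n by (intro powr_mono) auto
    also have "\<dots> = (a / 2 * tt x) ^ n"
    proof -
      have "norm x powr (a * real n) = (norm x powr a) powr real n" by (simp add: powr_powr)
      also have "\<dots> = (norm x powr a) ^ n" using that by (intro powr_realpow) auto
      finally show ?thesis using a0 by (simp add: tt_def power_mult_distrib power_divide)
    qed
    finally have "norm x powr (\<sigma> + real (Suc DIM('a))) * exp (- c * tt x) \<le> (a / 2 * tt x) ^ n * exp (- c * tt x)"
      by (intro mult_right_mono) auto
    also have "\<dots> = (a / 2) ^ n * (tt x ^ n * exp (- (c * tt x)))" by (simp add: power_mult_distrib power_divide)
    also have "\<dots> \<le> K" unfolding K_def using a0 assms by (intro mult_left_mono power_exp_bounded) auto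
    finally have *: "norm x powr (\<sigma> + real (Suc DIM('a))) * exp (- c * tt x) \<le> K" .
    have "norm x powr (\<sigma> + real (Suc DIM('a))) = norm x powr \<sigma> * norm x ^ Suc DIM('a)"
    proof -
      have "norm x > 0" using that by linarith
      then show ?thesis by (simp only: powr_add powr_realpow)
    qed
    moreover have "0 < norm x ^ Suc DIM('a)" using that by (intro zero_less_power) linarith
    ultimately show ?thesis using * by (simp add: field_simps)
  qed
  have "(\<integral>\<^sup>+ x. ennreal (exp (- c * tt x)) \<partial>M)
      = (\<integral>\<^sup>+ x. ennreal (norm x powr (a - 2) * theta P k x) * ennreal (exp (- c * tt x)) \<partial>lborel)"
    by (rule nn_integral_M) measurable
  also have "\<dots> \<le> (\<integral>\<^sup>+ x. ennreal C * (ennreal (norm x powr \<sigma>) * indicator {x. x \<noteq> 0 \<and> norm x \<le> 1} (x::'a))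
      + ennreal (C * K) * (ennreal (1 / norm x ^ Suc DIM('a)) * indicator {x. 1 \<le> norm x} x) \<partial>lborel)"
  proof (rule nn_integral_mono_AE, use AE_lborel_singleton[of "0 :: 'a"] in eventually_elim)
    fix x :: 'a assume "x \<noteq> 0"
    have 1: "norm x powr (a - 2) * theta P k x * exp (- c * tt x) \<le> C * norm x powr \<sigma> * exp (- c * tt x)"
      by (intro mult_right_mono w \<open>x \<noteq> 0\<close>) auto
    have "norm x powr (a - 2) * theta P k x * exp (- c * tt x) \<le> (if norm x \<le> 1 then C * norm x powr \<sigma> else C * K * (1 / norm x ^ Suc DIM('a)))"
    proof (cases "norm x \<le> 1")
      case True
      have "C * norm x powr \<sigma> * exp (- c * tt x) \<le> C * norm x powr \<sigma> * 1"
        using assms C(1) by (intro mult_left_mono) auto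
      with True show ?thesis unfolding if_P[OF True] using order_trans[OF 1] by simp
    next
      case False
      have "C * norm x powr \<sigma> * exp (- c * tt x) \<le> C * (K * (1 / norm x ^ Suc DIM('a)))"
        unfolding mult.assoc using False by (intro mult_left_mono tail C(1)) auto
      then show ?thesis unfolding if_not_P[OF False] mult.assoc[of C K] by (rule order_trans[OF 1])
    qed
    then have "ennreal (norm x powr (a - 2) * theta P k x * exp (- c * tt x)) \<le> (if norm x \<le> 1 then ennreal (C * norm x powr \<sigma>) else ennreal (C * K * (1 / norm x ^ Suc DIM('a))))"
      by (auto split: if_splits intro: ennreal_leI)
    also have "\<dots> \<le> ennreal C * (ennreal (norm x powr \<sigma>) * indicator {x. x \<noteq> 0 \<and> norm x \<le> 1} x)
      + ennreal (C * K) * (ennreal (1 / norm x ^ Suc DIM('a)) * indicator {x. 1 \<le> norm x} x)"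
      using \<open>x \<noteq> 0\<close> C(1) K by (auto simp: indicator_def ennreal_mult[symmetric] simp del: power_Suc)
    finally show "ennreal (norm x powr (a - 2) * theta P k x) * ennreal (exp (- c * tt x)) \<le> \<dots>"
      by (simp add: ennreal_mult'')
  qed
  also have "\<dots> = ennreal C * (\<integral>\<^sup>+ x. ennreal (norm x powr \<sigma>) * indicator {x. x \<noteq> 0 \<and> norm x \<le> 1} (x::'a) \<partial>lborel)
      + ennreal (C * K) * (\<integral>\<^sup>+ x. ennreal (1 / norm x ^ Suc DIM('a)) * indicator {x. 1 \<le> norm x} (x::'a) \<partial>lborel)"
    by (subst nn_integral_add) (auto simp: nn_integral_cmult)
  also have "\<dots> < \<infinity>"
    using nn_integral_norm_powr_near_0[OF \<sigma>] nn_integral_norm_tail[where 'a = 'a]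
    by (simp add: ennreal_mult_less_top less_top[symmetric] ennreal_mult_eq_top_iff)
  finally show ?thesis .
qed

lemma exp_bounded_L2:
  assumes f: "f \<in> borel_measurable borel" and "c > 0" and bound: "\<And>x. cmod (f x) \<le> C * exp (- c * tt x)"
  shows "f \<in> L2 M"
proof -
  have "(\<lambda>x. exp (- (c * tt x)) * exp (- (c * tt x))) = (\<lambda>x. exp (- (2 * c) * tt x))"
    by (auto simp: exp_add[symmetric])
  moreover have "integrable M (\<lambda>x. exp (- (2 * c) * tt x))"
    using nn_integral_exp_finite[of "2 * c"] assms(2) by (intro integrableI_nonneg) (auto simp: less_top)
  ultimately have "integrable M (\<lambda>x. (cmod (of_real (exp (- (c * tt x)))))\<^sup>2)"
    by (simp add: power2_eq_square)
  then have e: "(\<lambda>x. of_real (exp (- (c * tt x)))) \<in> L2 M"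
    by (simp add: L2_def)
  show ?thesis
    by (rule L2_bound[OF e, of _ C]) (use f bound in auto)
qed

end

section \<open>Density of the Laguerre functions\<close>

lemma L2_dominated_tendsto:
  fixes f :: "'a \<Rightarrow> complex" and h :: "nat \<Rightarrow> 'a \<Rightarrow> complex"
  assumes f: "f \<in> borel_measurable M" and h: "\<And>n. h n \<in> borel_measurable M" and g: "g \<in> L2 M"
    and lim: "AE x in M. (\<lambda>n. h n x) \<longlonglongrightarrow> f x"
    and bound: "\<And>n. AE x in M. cmod (h n x) \<le> cmod (g x)"
  shows "f \<in> L2 M" and "(\<lambda>n. ip.sq M (\<lambda>x. f x - h n x)) \<longlonglongrightarrow> 0"
proof -
  have bound': "AE x in M. \<forall>n. cmod (h n x) \<le> cmod (g x)"
    using bound by (simp add: AE_all_countable)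
  have fg: "AE x in M. cmod (f x) \<le> cmod (g x)"
    using lim bound'
  proof eventually_elim
    case (elim x)
    show ?case by (rule LIMSEQ_le_const2[OF tendsto_norm[OF elim(1)]]) (use elim(2) in auto)
  qed
  show "f \<in> L2 M" by (rule L2_bound[OF g f, of 1]) (use fg in simp)
  have "(\<lambda>n. LINT x|M. (cmod (f x - h n x))\<^sup>2) \<longlonglongrightarrow> (LINT x|M. 0)"
  proof (rule integral_dominated_convergence)
    show "integrable M (\<lambda>x. 4 * (cmod (g x))\<^sup>2)" using g by (simp add: L2_def)
    show "(\<lambda>x. (cmod (f x - h n x))\<^sup>2) \<in> borel_measurable M" for n using f h by measurable
    show "AE x in M. (\<lambda>n. (cmod (f x - h n x))\<^sup>2) \<longlonglongrightarrow> 0"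
      using lim
    proof eventually_elim
      case (elim x)
      have "(\<lambda>n. (cmod (f x - h n x))\<^sup>2) \<longlonglongrightarrow> (cmod (f x - f x))\<^sup>2" by (intro tendsto_intros elim)
      then show ?case by simp
    qed
    show "AE x in M. norm ((cmod (f x - h n x))\<^sup>2) \<le> 4 * (cmod (g x))\<^sup>2" for n
      using bound' fg
    proof eventually_elim
      case (elim x)
      have "cmod (f x - h n x) \<le> 2 * cmod (g x)"
        using norm_triangle_ineq4[of "f x" "h n x"] elim(1)[rule_format, of n] elim(2) by simp
      then have "(cmod (f x - h n x))\<^sup>2 \<le> (2 * cmod (g x))\<^sup>2" by (intro power_mono) auto
      then show ?case by (simp add: power_mult_distrib)
    qed
  qed auto
  then show "(\<lambda>n. ip.sq M (\<lambda>x. f x - h n x)) \<longlonglongrightarrow> 0" by (simp add: sq_ip)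
qed

lemma hom_polys_growth:
  fixes p :: "'a::euclidean_space \<Rightarrow> complex"
  assumes "p \<in> hom_polys m"
  obtains B where "B \<ge> 0" "\<And>x. cmod (p x) \<le> B * norm x ^ m"
proof -
  have "compact (p ` cball 0 1)"
    by (intro compact_continuous_image continuous_on_polynomial_function hom_polysD(1)[OF assms]) simp
  then obtain B where B: "\<And>y. y \<in> cball 0 1 \<Longrightarrow> cmod (p y) \<le> B"
    using compact_imp_bounded bounded_iff by (metis imageI)
  have "cmod (p x) \<le> max B 0 * norm x ^ m" for x
  proof -
    have "p x = p (norm x *\<^sub>R sgn x)" by (cases "x = 0") (simp_all add: sgn_div_norm)
    also have "\<dots> = of_real (norm x ^ m) * p (sgn x)" by (rule hom_polysD(2)[OF assms])
    finally have "cmod (p x) = norm x ^ m * cmod (p (sgn x))" by (simp add: norm_mult norm_power)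
    moreover have "cmod (p (sgn x)) \<le> B" by (rule B) (simp add: norm_sgn)
    then have "norm x ^ m * cmod (p (sgn x)) \<le> norm x ^ m * max B 0"
      by (intro mult_left_mono) auto
    ultimately show ?thesis by (simp add: mult.commute)
  qed
  then show ?thesis using that[of "max B 0"] by simp
qed

context ka_weight
begin

text \<open>Since \<open>a\<close> is any positive real, \<open>norm x ^ m\<close> is in general no
  integer power of \<open>tt x\<close>. Rounding the exponent up is harmless for
  \<open>norm x > 1\<close>, and the summand 1 covers the unit ball.\<close>

lemma norm_power_le:
  obtains n :: nat where "\<And>x::'a. norm x ^ m \<le> 1 + (a / 2 * tt x) ^ n"
proof -
  obtain n :: nat where n: "real m / a \<le> real n" using real_arch_simple by blast
  have "norm x ^ m \<le> 1 + (a / 2 * tt x) ^ n" for x :: 'a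
  proof (cases "norm x \<le> 1")
    case True
    then have "norm x ^ m \<le> 1" by (simp add: power_le_one)
    moreover have "0 \<le> (a / 2 * tt x) ^ n" using a0 by simp
    ultimately show ?thesis by linarith
  next
    case False
    then have x: "1 < norm x" by simp
    have "norm x ^ m = norm x powr real m" using x by (subst powr_realpow) auto
    also have "\<dots> \<le> norm x powr (a * real n)" using x n a0 by (intro powr_mono) (auto simp: field_simps)
    also have "\<dots> = (norm x powr a) powr real n" by (simp add: powr_powr)
    also have "\<dots> = (norm x powr a) ^ n" using x by (intro powr_realpow) auto
    finally show ?thesis using a0 by (simp add: tt_def)
  qed
  then show ?thesis by (rule that)
qed

text \<open>Half of the exponential absorbs all polynomial growth, the other half remains for
  integrability.\<close>

lemma hom_polys_exp_bound:
  assumes p: "p \<in> hom_polys m" and c: "c > 0"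
  obtains C where "C \<ge> 0" "\<And>x. cmod (p x) * tt x ^ j * exp (- (c * tt x)) \<le> C * exp (- (c / 2) * tt x)"
proof -
  obtain B where B: "B \<ge> 0" "\<And>x. cmod (p x) \<le> B * norm x ^ m" using hom_polys_growth[OF p] by blast
  obtain n where n: "\<And>x::'a. norm x ^ m \<le> 1 + (a / 2 * tt x) ^ n" using norm_power_le by blast
  define C where "C = B * (fact j / (c / 2) ^ j + (a / 2) ^ n * (fact (n + j) / (c / 2) ^ (n + j)))"
  have "cmod (p x) * tt x ^ j * exp (- (c * tt x)) \<le> C * exp (- (c / 2) * tt x)" for x
  proof -
    have "cmod (p x) * (tt x ^ j * exp (- (c / 2 * tt x))) \<le> B * (1 + (a / 2 * tt x) ^ n) * (tt x ^ j * exp (- (c / 2 * tt x)))"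
      using order_trans[OF B(2) mult_left_mono[OF n B(1)]] by (rule mult_right_mono) simp
    also have "\<dots> = B * (tt x ^ j * exp (- (c / 2 * tt x)) + (a / 2) ^ n * (tt x ^ (n + j) * exp (- (c / 2 * tt x))))"
      by (simp add: power_mult_distrib power_divide power_add algebra_simps)
    also have "\<dots> \<le> C"
      unfolding C_def using c a0 B(1) by (intro mult_left_mono add_mono power_exp_bounded) auto
    finally have "cmod (p x) * (tt x ^ j * exp (- (c / 2 * tt x))) * exp (- (c / 2 * tt x)) \<le> C * exp (- (c / 2 * tt x))"
      by (rule mult_right_mono) simp
    moreover have "exp (- (c * tt x)) = exp (- (c / 2 * tt x)) * exp (- (c / 2 * tt x))"
      by (simp add: exp_add[symmetric])
    ultimately show ?thesis by (simp add: mult.assoc)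
  qed
  moreover have "C \<ge> 0" using c a0 B(1) by (simp add: C_def)
  ultimately show ?thesis using that by blast
qed

lemma borel_measurable_hom_polys: "p \<in> hom_polys m \<Longrightarrow> p \<in> borel_measurable borel"
  by (intro borel_measurable_continuous_onI continuous_on_polynomial_function hom_polysD)

lemma hom_polys_exp_L2:
  assumes p: "p \<in> hom_polys m" and c: "c > 0"
  shows "(\<lambda>x. p x * of_real (tt x ^ j * exp (- (c * tt x)))) \<in> L2 M"
proof -
  obtain C where C: "\<And>x. cmod (p x) * tt x ^ j * exp (- (c * tt x)) \<le> C * exp (- (c / 2) * tt x)"
    using hom_polys_exp_bound[OF p c] by blast
  show ?thesis
  proof (rule exp_bounded_L2)
    show "(\<lambda>x. p x * of_real (tt x ^ j * exp (- (c * tt x)))) \<in> borel_measurable borel"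
      using borel_measurable_hom_polys[OF p] by measurable
    show "0 < c / 2" using c by simp
    show "cmod (p x * of_real (tt x ^ j * exp (- (c * tt x)))) \<le> C * exp (- (c / 2) * tt x)" for x
      using C[of x] by (simp add: norm_mult norm_power mult.assoc)
  qed
qed

abbreviation Harm where "Harm m \<equiv> dunkl_harmonics P k m"

lemma Harm_hom: "p \<in> Harm m \<Longrightarrow> p \<in> hom_polys m"
  by (rule dunkl_harmonicsD)

abbreviation lam where "lam m \<equiv> lambda P k a m"

abbreviation \<Phi> where "\<Phi> m l p \<equiv> Phi P k a m l p"

lemma Phi_tt: "\<Phi> m l p x = p x * of_real (laguerre l (lam m) (tt x) * exp (- (1 / 2 * tt x)))"
  using a0 by (simp add: Phi_def tt_def)

text \<open>This is the whole complex span: a scalar is absorbed into the harmonic \<open>p\<close>,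
  as \<open>V_scale\<close> shows.\<close>

inductive_set V :: "('a \<Rightarrow> complex) set" where
  Phi: "p \<in> Harm m \<Longrightarrow> \<Phi> m l p \<in> V"
| add: "u \<in> V \<Longrightarrow> v \<in> V \<Longrightarrow> (\<lambda>x. u x + v x) \<in> V"

lemma Phi_scale: "\<Phi> m l (\<lambda>x. c * p x) = (\<lambda>x. c * \<Phi> m l p x)"
  by (auto simp: Phi_def)

lemma V_scale: "v \<in> V \<Longrightarrow> (\<lambda>x. c * v x) \<in> V"
proof (induction rule: V.induct)
  case (Phi p m l)
  then show ?case unfolding Phi_scale[symmetric] by (intro V.Phi dunkl_harmonics_scale)
next
  case (add u v)
  from V.add[OF add.IH] show ?case by (simp add: distrib_left)
qed

lemma V_zero: "(\<lambda>x. 0) \<in> V"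
  using V_scale[OF V.Phi[OF dunkl_harmonics_zero[of P k 0], of 0], of 0] by simp

lemma tt_Phi:
  "of_real (tt x) * \<Phi> m l p x =
     of_real (2 * real l + lam m + 1) * \<Phi> m l p x - of_real (real (l + 1)) * \<Phi> m (l + 1) p x
     - of_real (of_bool (l > 0) * (real l + lam m)) * \<Phi> m (l - 1) p x"
proof -
  have "of_real (tt x) * \<Phi> m l p x = p x * of_real (tt x * laguerre l (lam m) (tt x)) * of_real (exp (- (1 / 2 * tt x)))"
    by (simp add: Phi_tt mult_ac)
  then show ?thesis unfolding laguerre_three_term Phi_tt
    by (simp add: algebra_simps)
qed

lemma tt_V: "v \<in> V \<Longrightarrow> (\<lambda>x. of_real (tt x) * v x) \<in> V"
proof (induction rule: V.induct)
  case (Phi p m l)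
  have "(\<lambda>x. of_real (2 * real l + lam m + 1) * \<Phi> m l p x + ((- of_real (real (l + 1))) * \<Phi> m (l + 1) p x
     + (- of_real (of_bool (l > 0) * (real l + lam m))) * \<Phi> m (l - 1) p x)) \<in> V"
    by (intro V.add V_scale V.Phi Phi)
  then show ?case unfolding tt_Phi by (simp only: diff_conv_add_uminus mult_minus_left add.assoc)
next
  case (add u v)
  from V.add[OF add.IH] show ?case by (simp add: distrib_left)
qed

text \<open>\<open>V\<close> is stable under multiplication by \<open>tt\<close>, so monomials in
  \<open>tt\<close> arise from the case \<open>l = 0\<close> without inverting the Laguerre
  polynomials.\<close>

lemma Harm_exp_V:
  assumes "p \<in> Harm m" shows "(\<lambda>x. p x * of_real (tt x ^ j * exp (- (1 / 2 * tt x)))) \<in> V"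
proof (induction j)
  case 0
  from V.Phi[OF assms, of 0] show ?case by (simp add: Phi_tt[abs_def])
next
  case (Suc j)
  from tt_V[OF this] show ?case by (simp add: mult_ac)
qed

lemma Phi_L2: "p \<in> Harm m \<Longrightarrow> \<Phi> m l p \<in> L2 M"
proof -
  assume p: "p \<in> Harm m"
  have "(\<lambda>x. \<Sum>j\<le>l. of_real ((-1) ^ j * ((real l + lam m) gchoose (l - j)) / fact j) * (p x * of_real (tt x ^ j * exp (- (1 / 2 * tt x))))) \<in> L2 M"
    by (intro L2_sum L2_scale hom_polys_exp_L2[of p m "1/2"] Harm_hom[OF p]) auto
  also have "(\<lambda>x. \<Sum>j\<le>l. of_real ((-1) ^ j * ((real l + lam m) gchoose (l - j)) / fact j) * (p x * of_real (tt x ^ j * exp (- (1 / 2 * tt x))))) = \<Phi> m l p"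
    unfolding Phi_tt[abs_def] laguerre_def of_real_mult of_real_sum sum_distrib_left sum_distrib_right
    by (intro ext sum.cong refl) simp
  finally show ?thesis .
qed

lemma V_L2: "v \<in> V \<Longrightarrow> v \<in> L2 M"
  by (induction rule: V.induct) (auto intro: Phi_L2 L2_add)

definition closV :: "('a \<Rightarrow> complex) set" where
  "closV = {f \<in> L2 M. \<forall>e>0. \<exists>v\<in>V. ip.sq M (\<lambda>x. f x - v x) < e}"

lemma closV_L2: "f \<in> closV \<Longrightarrow> f \<in> L2 M"
  by (simp add: closV_def)

lemma closVD:
  assumes "f \<in> closV" "e > 0" obtains v where "v \<in> V" "ip.sq M (\<lambda>x. f x - v x) < e"
proof -
  have "\<forall>e>0. \<exists>v\<in>V. ip.sq M (\<lambda>x. f x - v x) < e" using assms(1) by (simp add: closV_def)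
  then have "0 < e \<longrightarrow> (\<exists>v\<in>V. ip.sq M (\<lambda>x. f x - v x) < e)" by (rule spec)
  then have "\<exists>v\<in>V. ip.sq M (\<lambda>x. f x - v x) < e" using assms(2) by (rule mp)
  then show ?thesis using that by (rule bexE)
qed

lemma closV_V: "v \<in> V \<Longrightarrow> v \<in> closV"
  using V_L2[of v] by (auto simp: closV_def sq_ip intro!: bexI[of _ v])

lemma closV_closed:
  assumes f: "f \<in> L2 M" and near: "\<And>e. e > 0 \<Longrightarrow> \<exists>g\<in>closV. ip.sq M (\<lambda>x. f x - g x) < e"
  shows "f \<in> closV"
proof -
  have "\<exists>v\<in>V. ip.sq M (\<lambda>x. f x - v x) < e" if e: "e > 0" for e
  proof -
    obtain g where g: "g \<in> closV" "ip.sq M (\<lambda>x. f x - g x) < e / 4" using near[of "e/4"] e by auto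
    obtain v where v: "v \<in> V" "ip.sq M (\<lambda>x. g x - v x) < e / 4"
      by (rule closVD[OF g(1), of "e / 4"]) (use e in auto)
    have gL: "g \<in> L2 M" by (rule closV_L2[OF g(1)])
    have "ip.sq M (\<lambda>x. (f x - g x) + (g x - v x)) \<le> 2 * ip.sq M (\<lambda>x. f x - g x) + 2 * ip.sq M (\<lambda>x. g x - v x)"
      by (intro ip.sq_add_le ip.diff_closed f gL V_L2 v)
    then show ?thesis using g v by (intro bexI[OF _ v(1)]) simp
  qed
  then show ?thesis using f by (simp add: closV_def)
qed

lemma closV_add:
  assumes f: "f \<in> closV" and g: "g \<in> closV" shows "(\<lambda>x. f x + g x) \<in> closV"
proof -
  have fL: "f \<in> L2 M" "g \<in> L2 M" using f g closV_L2 by auto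
  have "\<exists>v\<in>V. ip.sq M (\<lambda>x. (f x + g x) - v x) < e" if e: "e > 0" for e
  proof -
    have e4: "e / 4 > 0" using e by simp
    obtain u where u: "u \<in> V" "ip.sq M (\<lambda>x. f x - u x) < e / 4" by (rule closVD[OF f e4])
    obtain v where v: "v \<in> V" "ip.sq M (\<lambda>x. g x - v x) < e / 4" by (rule closVD[OF g e4])
    have "ip.sq M (\<lambda>x. (f x - u x) + (g x - v x)) \<le> 2 * ip.sq M (\<lambda>x. f x - u x) + 2 * ip.sq M (\<lambda>x. g x - v x)"
      by (intro ip.sq_add_le ip.diff_closed fL V_L2 u v)
    moreover have "(\<lambda>x. (f x - u x) + (g x - v x)) = (\<lambda>x. (f x + g x) - (u x + v x))" by (auto simp: algebra_simps)
    ultimately show ?thesis using u v by (intro bexI[OF _ V.add[OF u(1) v(1)]]) simp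
  qed
  then show ?thesis using L2_add[OF fL] by (simp add: closV_def)
qed

lemma closV_scale:
  assumes f: "f \<in> closV" shows "(\<lambda>x. c * f x) \<in> closV"
proof (cases "c = 0")
  case True
  then show ?thesis using closV_V[OF V_zero] by simp
next
  case False
  have fL: "f \<in> L2 M" by (rule closV_L2[OF f])
  have "\<exists>v\<in>V. ip.sq M (\<lambda>x. c * f x - v x) < e" if e: "e > 0" for e
  proof -
    have "0 < e / (cmod c)\<^sup>2" using e False by simp
    then obtain u where u: "u \<in> V" "ip.sq M (\<lambda>x. f x - u x) < e / (cmod c)\<^sup>2" by (rule closVD[OF f])
    have "ip.sq M (\<lambda>x. c * (f x - u x)) = (cmod c)\<^sup>2 * ip.sq M (\<lambda>x. f x - u x)"
      by (intro ip.sq_scale ip.diff_closed fL V_L2 u)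
    also have "\<dots> < e" using u(2) False by (simp add: field_simps)
    finally show ?thesis by (intro bexI[OF _ V_scale[OF u(1), of c]]) (simp add: right_diff_distrib)
  qed
  then show ?thesis using L2_scale[OF fL] by (simp add: closV_def)
qed

lemma closV_sum:
  "finite I \<Longrightarrow> (\<And>i. i \<in> I \<Longrightarrow> h i \<in> closV) \<Longrightarrow> (\<lambda>x. \<Sum>i\<in>I. h i x) \<in> closV"
  by (induction rule: finite_induct) (auto intro: closV_add closV_V[OF V_zero])

lemma closV_dominated_limit:
  assumes f: "f \<in> borel_measurable borel" and h: "\<And>n. h n \<in> closV" and g: "g \<in> L2 M"
    and lim: "AE x in M. (\<lambda>n::nat. h n x) \<longlonglongrightarrow> f x"
    and bound: "\<And>n. AE x in M. cmod (h n x) \<le> cmod (g x)"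
  shows "f \<in> closV"
proof -
  have hL: "h n \<in> L2 M" for n by (rule closV_L2[OF h])
  have *: "f \<in> L2 M" "(\<lambda>n. ip.sq M (\<lambda>x. f x - h n x)) \<longlonglongrightarrow> 0"
    using L2_dominated_tendsto[OF _ L2_measurable[OF hL] g lim bound] f by auto
  show ?thesis
  proof (rule closV_closed[OF *(1)])
    fix e :: real assume "e > 0"
    then have "\<exists>no. \<forall>n\<ge>no. norm (ip.sq M (\<lambda>x. f x - h n x) - 0) < e" by (rule LIMSEQ_D[OF *(2)])
    then obtain n where "norm (ip.sq M (\<lambda>x. f x - h n x) - 0) < e" by blast
    then have "ip.sq M (\<lambda>x. f x - h n x) < e" by simp
    then show "\<exists>g\<in>closV. ip.sq M (\<lambda>x. f x - g x) < e" using h by (rule bexI)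
  qed
qed

end

lemma LIMSEQ_norm_le_inverse_Suc:
  fixes X :: "nat \<Rightarrow> 'b::real_normed_vector"
  assumes "\<And>n. norm (X n - L) \<le> 1 / real (Suc n)"
  shows "X \<longlonglongrightarrow> L"
proof (rule LIM_zero_cancel, rule Lim_null_comparison)
  show "\<forall>\<^sub>F n in sequentially. norm (X n - L) \<le> inverse (real (Suc n))"
    using assms by (simp add: inverse_eq_divide)
qed (rule LIMSEQ_inverse_real_of_nat)

section \<open>Approximation in the radial variable and in the full variable\<close>

context ka_weight
begin

text \<open>Each step multiplies by exp(-t/4), expanded in its Taylor series. The partial sums are
  at most exp(t/4), and the exponent already present is at least 1/2, so everything is dominated by
  a polynomial times exp(-t/4). A step smaller than 1/2 is what keeps this dominant in
  \<open>L2\<close>.\<close>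

lemma Harm_exp_closV:
  assumes p: "p \<in> Harm m"
  shows "(\<lambda>x. p x * of_real (tt x ^ j * exp (- ((1 / 2 + real n / 4) * tt x)))) \<in> closV"
proof (induction n arbitrary: j)
  case 0
  from closV_V[OF Harm_exp_V[OF p, of j]] show ?case by simp
next
  case (Suc n)
  define c where "c = 1 / 2 + real n / 4"
  have c: "1 / 2 \<le> c" by (simp add: c_def)
  have split: "exp (- ((1 / 2 + real (Suc n) / 4) * tt x)) = exp (- (c * tt x)) * exp (- (tt x / 4))" for x
  proof -
    have "1 / 2 + real (Suc n) / 4 = c + 1 / 4" by (simp add: c_def add_divide_distrib)
    then have "- ((1 / 2 + real (Suc n) / 4) * tt x) = - ((c + 1 / 4) * tt x)" by (rule arg_cong)
    also have "\<dots> = - (c * tt x) + - (1 / 4 * tt x)" by (simp only: distrib_right minus_add_distrib)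
    also have "1 / 4 * tt x = tt x / 4" by simp
    finally have "- ((1 / 2 + real (Suc n) / 4) * tt x) = - (c * tt x) + - (tt x / 4)" .
    then show ?thesis by (simp only: exp_add)
  qed
  define s where "s N y = (\<Sum>i<N. (-1 / 4) ^ i / fact i * y ^ i)" for N and y :: real
  have s_lim: "(\<lambda>N. s N y) \<longlonglongrightarrow> exp (- (y / 4))" for y
  proof -
    have "(\<lambda>i. (- y / 4) ^ i /\<^sub>R fact i) sums exp (- y / 4)" by (rule exp_converges)
    moreover have "(- y / 4) ^ i /\<^sub>R fact i = (-1 / 4) ^ i / fact i * y ^ i" for i
    proof -
      have e: "- y / 4 = (-1 / 4) * y" by simp
      have "(r * z) /\<^sub>R c = r / c * z" for r z c :: real by (simp add: divide_inverse mult_ac)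
      then show ?thesis unfolding e power_mult_distrib by blast
    qed
    ultimately show ?thesis by (simp add: sums_def s_def[abs_def])
  qed
  have s_bound: "\<bar>s N y\<bar> \<le> exp (y / 4)" if "0 \<le> y" for N y
  proof -
    have "\<bar>s N y\<bar> \<le> (\<Sum>i<N. \<bar>(-1 / 4) ^ i / fact i * y ^ i\<bar>)" unfolding s_def by (rule sum_abs)
    also have "\<dots> = (\<Sum>i<N. (y / 4) ^ i /\<^sub>R fact i)"
      using that by (intro sum.cong refl) (simp add: abs_mult power_abs power_divide field_simps)
    also have "\<dots> \<le> (\<Sum>i. (y / 4) ^ i /\<^sub>R fact i)"
      using that by (intro sum_le_suminf summable_exp_generic) auto
    also have "\<dots> = exp (y / 4)" by (simp add: exp_def)
    finally show ?thesis .
  qed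
  let ?f = "\<lambda>x. p x * of_real (tt x ^ j * exp (- ((1 / 2 + real (Suc n) / 4) * tt x)))"
  let ?h = "\<lambda>N x. p x * of_real (tt x ^ j * exp (- (c * tt x)) * s N (tt x))"
  show ?case
  proof (rule closV_dominated_limit)
    show "?f \<in> borel_measurable borel"
      using borel_measurable_hom_polys[OF Harm_hom[OF p]] by measurable
    show "?h N \<in> closV" for N
    proof -
      have "(\<lambda>x. \<Sum>i<N. of_real ((-1 / 4) ^ i / fact i) * (p x * of_real (tt x ^ (j + i) * exp (- (c * tt x))))) \<in> closV"
        unfolding c_def by (intro closV_sum closV_scale Suc.IH) auto
      also have "(\<lambda>x. \<Sum>i<N. of_real ((-1 / 4) ^ i / fact i) * (p x * of_real (tt x ^ (j + i) * exp (- (c * tt x))))) = ?h N"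
        unfolding s_def sum_distrib_left of_real_sum by (intro ext sum.cong refl) (simp add: power_add)
      finally show ?thesis .
    qed
    show "(\<lambda>x. p x * of_real (tt x ^ j * exp (- (1 / 4 * tt x)))) \<in> L2 M"
      by (rule hom_polys_exp_L2[OF Harm_hom[OF p]]) simp
    show "AE x in M. (\<lambda>N. ?h N x) \<longlonglongrightarrow> ?f x"
    proof (rule AE_I2)
      fix x
      have "(\<lambda>N. ?h N x) \<longlonglongrightarrow> p x * of_real (tt x ^ j * exp (- (c * tt x)) * exp (- (tt x / 4)))"
        by (intro tendsto_intros s_lim)
      then show "(\<lambda>N. ?h N x) \<longlonglongrightarrow> ?f x" by (simp only: split mult.assoc)
    qed
    show "AE x in M. cmod (?h N x) \<le> cmod (p x * of_real (tt x ^ j * exp (- (1 / 4 * tt x))))" for N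
    proof (rule AE_I2)
      fix x
      have "exp (- (c * tt x)) * \<bar>s N (tt x)\<bar> \<le> exp (- (1 / 2 * tt x)) * exp (tt x / 4)"
      proof (intro mult_mono s_bound)
        have "1 / 2 * tt x \<le> c * tt x" using c by (intro mult_right_mono) auto
        then show "exp (- (c * tt x)) \<le> exp (- (1 / 2 * tt x))" by simp
      qed auto
      also have "\<dots> = exp (- (1 / 4 * tt x))" by (simp add: exp_add[symmetric])
      finally have "cmod (p x) * tt x ^ j * (exp (- (c * tt x)) * \<bar>s N (tt x)\<bar>) \<le> cmod (p x) * tt x ^ j * exp (- (1 / 4 * tt x))"
        by (intro mult_left_mono) auto
      then show "cmod (?h N x) \<le> cmod (p x * of_real (tt x ^ j * exp (- (1 / 4 * tt x))))"
        by (simp only: norm_mult norm_of_real abs_mult abs_exp_cancel power_abs abs_of_nonneg[OF tt_nonneg] mult.assoc)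
    qed
  qed
qed

text \<open>The variable u = exp(-t/4) ranges in the compact interval [0,1], where \<open>h\<close>
  is a uniform limit of polynomials; their monomials in u are the functions of
  \<open>Harm_exp_closV\<close> with \<open>j = 0\<close>.\<close>

lemma Harm_continuous_exp_closV:
  fixes h :: "real \<Rightarrow> real"
  assumes p: "p \<in> Harm m" and h: "continuous_on {0..1} h"
  shows "(\<lambda>x. p x * of_real (exp (- (1 / 2 * tt x)) * h (exp (- (tt x / 4))))) \<in> closV"
proof -
  have "\<exists>B. \<forall>y\<in>{0..1}. \<bar>h y\<bar> \<le> B"
    using compact_imp_bounded[OF compact_continuous_image[OF h compact_Icc]] by (auto simp: bounded_iff)
  then obtain B where B: "\<And>y. y \<in> {0..1} \<Longrightarrow> \<bar>h y\<bar> \<le> B" by blast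
  have "\<exists>q. real_polynomial_function q \<and> (\<forall>y\<in>{0..1}. \<bar>h y - q y\<bar> < 1 / real (Suc N))" for N
    using Stone_Weierstrass_real_polynomial_function[OF compact_Icc h, of "1 / real (Suc N)"] by (metis of_nat_0_less_iff zero_less_Suc zero_less_divide_1_iff)
  then obtain q where q: "\<And>N. real_polynomial_function (q N)" "\<And>N y. y \<in> {0..1} \<Longrightarrow> \<bar>h y - q N y\<bar> < 1 / real (Suc N)"
    by metis
  have u: "exp (- (tt x / 4)) \<in> {0..1}" for x by simp
  let ?f = "\<lambda>x. p x * of_real (exp (- (1 / 2 * tt x)) * h (exp (- (tt x / 4))))"
  let ?g = "\<lambda>N x. p x * of_real (exp (- (1 / 2 * tt x)) * q N (exp (- (tt x / 4))))"
  show ?thesis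
  proof (rule closV_dominated_limit)
    have "continuous_on {0..1} h" by (rule h)
    then have "(\<lambda>x. indicator {0..1} x *\<^sub>R h x) \<in> borel_measurable borel"
      by (intro borel_measurable_continuous_on_indicator) auto
    then have "(\<lambda>x. indicator {0..1} (exp (- (tt x / 4))) *\<^sub>R h (exp (- (tt x / 4)))) \<in> borel_measurable borel"
      by (rule measurable_compose[rotated]) measurable
    then have [measurable]: "(\<lambda>x. h (exp (- (tt x / 4)))) \<in> borel_measurable borel"
      by (simp add: u)
    show "?f \<in> borel_measurable borel"
      using borel_measurable_hom_polys[OF Harm_hom[OF p]] by measurable
    show "?g N \<in> closV" for N
    proof -
      obtain b n where bn: "q N = (\<lambda>x. \<Sum>i\<le>n::nat. b i * x ^ i)"
        using real_polynomial_function_imp_sum[OF q(1)] by blast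
      have "(\<lambda>x. \<Sum>i\<le>n. of_real (b i) * (p x * of_real (tt x ^ 0 * exp (- ((1 / 2 + real i / 4) * tt x))))) \<in> closV"
        by (intro closV_sum closV_scale Harm_exp_closV[OF p]) auto
      also have "(\<lambda>x. \<Sum>i\<le>n. of_real (b i) * (p x * of_real (tt x ^ 0 * exp (- ((1 / 2 + real i / 4) * tt x))))) = ?g N"
      proof
        fix x
        have e: "exp (- ((1 / 2 + real i / 4) * tt x)) = exp (- (1 / 2 * tt x)) * exp (- (tt x / 4)) ^ i" for i
          by (simp add: exp_of_nat_mult[symmetric] exp_add[symmetric] algebra_simps)
        show "(\<Sum>i\<le>n. of_real (b i) * (p x * of_real (tt x ^ 0 * exp (- ((1 / 2 + real i / 4) * tt x))))) = ?g N x"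
          unfolding bn e sum_distrib_left of_real_sum by (intro sum.cong refl) simp
      qed
      finally show ?thesis .
    qed
    show "(\<lambda>x. of_real (B + 1) * (p x * of_real (tt x ^ 0 * exp (- (1 / 2 * tt x))))) \<in> L2 M"
      by (intro L2_scale hom_polys_exp_L2[OF Harm_hom[OF p]]) simp
    show "AE x in M. (\<lambda>N. ?g N x) \<longlonglongrightarrow> ?f x"
    proof (rule AE_I2)
      fix x
      have "(\<lambda>N. q N (exp (- (tt x / 4)))) \<longlonglongrightarrow> h (exp (- (tt x / 4)))"
        using q(2)[OF u, of x] by (intro LIMSEQ_norm_le_inverse_Suc) (simp add: abs_minus_commute less_imp_le)
      then show "(\<lambda>N. ?g N x) \<longlonglongrightarrow> ?f x" by (intro tendsto_intros)
    qed
    show "AE x in M. cmod (?g N x) \<le> cmod (of_real (B + 1) * (p x * of_real (tt x ^ 0 * exp (- (1 / 2 * tt x)))))" for N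
    proof (rule AE_I2)
      fix x
      have "1 / real (Suc N) \<le> 1" by simp
      then have "\<bar>q N (exp (- (tt x / 4)))\<bar> \<le> B + 1"
        using q(2)[OF u, of x N] B[OF u, of x] by linarith
      moreover from this have "0 \<le> B + 1" by linarith
      ultimately have "cmod (p x) * exp (- (1 / 2 * tt x)) * \<bar>q N (exp (- (tt x / 4)))\<bar> \<le> cmod (p x) * exp (- (1 / 2 * tt x)) * \<bar>B + 1\<bar>"
        by (intro mult_left_mono) auto
      then show "cmod (?g N x) \<le> cmod (of_real (B + 1) * (p x * of_real (tt x ^ 0 * exp (- (1 / 2 * tt x)))))"
        by (simp only: norm_mult norm_of_real abs_mult abs_exp_cancel power_0 mult_1_left mult_ac)
    qed
  qed
qed

text \<open>Any such \<open>g\<close> has the form exp(-t/2) h(u) with u = exp(-t/4): express the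
  radius through u and divide by u^2 = exp(-t/2). Here \<delta> is the value of u at radius
  \<open>R\<close>; freezing u below \<delta>, where \<open>g\<close> has vanished, keeps
  \<open>h\<close> continuous up to u = 0.\<close>

lemma Harm_radial_closV:
  fixes g :: "real \<Rightarrow> real"
  assumes p: "p \<in> Harm m" and g: "continuous_on {0..} g" and R: "R > 0" and gR: "\<And>r. r \<ge> R \<Longrightarrow> g r = 0"
  shows "(\<lambda>x. p x * of_real (g (norm x))) \<in> closV"
proof -
  define T where "T = 2 / a * R powr a"
  define \<delta> where "\<delta> = exp (- (T / 4))"
  define h where "h u = g ((a / 2 * (- 4 * ln (max u \<delta>))) powr (1 / a)) / (max u \<delta>)\<^sup>2" for u
  have T: "0 \<le> T" using a0 by (simp add: T_def)
  have \<delta>: "0 < \<delta>" "\<delta> \<le> 1" using T by (simp_all add: \<delta>_def)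
  have "continuous_on {0..1} h"
    unfolding h_def
  proof (intro continuous_intros)
    have "continuous_on {0..1} (\<lambda>u. max u \<delta>)" by (intro continuous_intros)
    moreover have "\<forall>u\<in>{0..1}. max u \<delta> \<noteq> 0" using \<delta> by (auto simp: max_def)
    ultimately have "continuous_on {0..1} (\<lambda>u. ln (max u \<delta>))" by (rule continuous_on_ln)
    then have "continuous_on {0..1} (\<lambda>u. a / 2 * (- 4 * ln (max u \<delta>)))"
      by (intro continuous_on_mult continuous_on_const)
    moreover have "0 \<le> a / 2 * (- 4 * ln (max u \<delta>))" if "u \<in> {0..1}" for u
      using that \<delta> a0 by (auto simp: max_def mult_nonneg_nonpos ln_le_zero_iff)
    ultimately have "continuous_on {0..1} (\<lambda>u. (a / 2 * (- 4 * ln (max u \<delta>))) powr (1 / a))"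
      using a0 by (intro continuous_on_powr' continuous_on_const) auto
    then show "continuous_on {0..1} (\<lambda>u. g ((a / 2 * (- 4 * ln (max u \<delta>))) powr (1 / a)))"
      by (rule continuous_on_compose2[OF g]) auto
    show "\<forall>u\<in>{0..1}. (max u \<delta>)\<^sup>2 \<noteq> 0" using \<delta> by (auto simp: max_def)
  qed
  from Harm_continuous_exp_closV[OF p this]
  have "(\<lambda>x. p x * of_real (exp (- (1 / 2 * tt x)) * h (exp (- (tt x / 4))))) \<in> closV" .
  moreover have "exp (- (1 / 2 * tt x)) * h (exp (- (tt x / 4))) = g (norm x)" for x
  proof (cases "tt x \<le> T")
    case True
    then have m: "max (exp (- (tt x / 4))) \<delta> = exp (- (tt x / 4))" by (simp add: \<delta>_def max_def)
    have "a / 2 * (- 4 * ln (exp (- (tt x / 4)))) = norm x powr a"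
      using a0 by (simp add: tt_def)
    then have "(a / 2 * (- 4 * ln (exp (- (tt x / 4))))) powr (1 / a) = norm x"
      using a0 by (simp add: powr_powr)
    then have "h (exp (- (tt x / 4))) = g (norm x) / (exp (- (tt x / 4)))\<^sup>2"
      unfolding h_def m by (simp only:)
    moreover have "(exp (- (tt x / 4)))\<^sup>2 = exp (- (1 / 2 * tt x))"
      by (simp add: power2_eq_square exp_add[symmetric])
    ultimately show ?thesis by simp
  next
    case False
    then have m: "max (exp (- (tt x / 4))) \<delta> = \<delta>" by (simp add: \<delta>_def max_def)
    have "a / 2 * (- 4 * ln \<delta>) = R powr a"
      using a0 by (simp add: \<delta>_def T_def)
    then have "(a / 2 * (- 4 * ln \<delta>)) powr (1 / a) = R"
      using a0 R by (simp add: powr_powr)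
    then have "h (exp (- (tt x / 4))) = g R / \<delta>\<^sup>2" unfolding h_def m by (simp only:)
    moreover have "R \<le> norm x"
    proof (rule ccontr)
      assume "\<not> R \<le> norm x"
      then have "norm x powr a \<le> R powr a" using a0 by (intro powr_mono2) auto
      then have "tt x \<le> T" unfolding tt_def T_def using a0 by (intro mult_left_mono) auto
      with False show False by simp
    qed
    ultimately show ?thesis using gR[of R] gR[of "norm x"] by simp
  qed
  ultimately show ?thesis by (simp only:)
qed

text \<open>The powers of \<open>x \<bullet> x\<close> are radial and move into the factor
  \<open>g\<close>, leaving a harmonic polynomial in front.\<close>

lemma fischer_radial_closV:
  fixes g :: "real \<Rightarrow> real"
  assumes "fischer P k m p" and g: "continuous_on {0..} g" and R: "R > 0" and gR: "\<And>r. r \<ge> R \<Longrightarrow> g r = 0"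
  shows "(\<lambda>x. p x * of_real (g (norm x))) \<in> closV"
  using assms(1)
proof (induction rule: fischer.induct)
  case (harmonic h m j)
  have "(\<lambda>x. h x * of_real (norm x ^ (2 * j) * g (norm x))) \<in> closV"
    using gR by (intro Harm_radial_closV[OF harmonic _ R] continuous_intros g) auto
  moreover have "norm x ^ (2 * j) = (x \<bullet> x) ^ j" for x :: 'a
    by (simp add: power_mult power2_norm_eq_inner)
  ultimately show ?case by (simp only: of_real_mult mult_ac)
next
  case (add m p q)
  from closV_add[OF add.IH] show ?case by (simp add: distrib_right)
qed

lemma polynomial_radial_closV:
  fixes g :: "real \<Rightarrow> real"
  assumes p: "polynomial_function p" and g: "continuous_on {0..} g" and R: "R > 0" and gR: "\<And>r. r \<ge> R \<Longrightarrow> g r = 0"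
  shows "(\<lambda>x. p x * of_real (g (norm x))) \<in> closV"
  using polynomial_hom_sum[OF p]
proof (induction rule: hom_sum.induct)
  case (hom p m)
  show ?case
    by (rule fischer_radial_closV[OF fischer_decomposition[OF hom fin P0 mult_index_nonneg] g R gR])
next
  case (add p q)
  from closV_add[OF add.IH] show ?case by (simp add: distrib_right)
qed

lemma measurable_cball [measurable]: "cball (0::'a) r \<in> sets borel"
  by simp

lemma bounded_support_L2:
  assumes f: "f \<in> borel_measurable borel" and bound: "\<And>x. cmod (f x) \<le> B" and supp: "\<And>x. norm x > R \<Longrightarrow> f x = 0"
  shows "f \<in> L2 M"
proof (rule exp_bounded_L2[OF f])
  define T where "T = 2 / a * \<bar>R\<bar> powr a"
  show "cmod (f x) \<le> (\<bar>B\<bar> * exp T) * exp (- 1 * tt x)" for x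
  proof (cases "norm x > R")
    case True
    then show ?thesis using supp by simp
  next
    case False
    then have "norm x powr a \<le> \<bar>R\<bar> powr a" using a0 by (intro powr_mono2) auto
    then have "tt x \<le> T" unfolding tt_def T_def using a0 by (intro mult_left_mono) auto
    then have "1 \<le> exp (T - tt x)" by simp
    then have "\<bar>B\<bar> * 1 \<le> \<bar>B\<bar> * exp (T - tt x)" by (intro mult_left_mono) auto
    then show ?thesis using bound[of x] by (simp add: exp_diff exp_minus divide_inverse)
  qed
qed simp

definition cutoff :: "real \<Rightarrow> real \<Rightarrow> real" where
  "cutoff R r = max 0 (min 1 (R + 1 - r))"

lemma cutoff: "0 \<le> cutoff R r" "cutoff R r \<le> 1" "r \<le> R \<Longrightarrow> cutoff R r = 1" "R + 1 \<le> r \<Longrightarrow> cutoff R r = 0"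
  by (auto simp: cutoff_def)

lemma continuous_on_cutoff: "continuous_on S (cutoff R)"
  unfolding cutoff_def[abs_def] by (intro continuous_intros)

text \<open>Polynomials approximate \<open>f\<close> uniformly on the ball of radius
  \<open>R + 1\<close> but grow outside. The cutoff makes the approximants vanish there and does not
  change \<open>f\<close>, since it is 1 on the support of \<open>f\<close>.\<close>

lemma continuous_closV:
  fixes f :: "'a \<Rightarrow> complex"
  assumes f: "continuous_on UNIV f" and R: "R > 0" and supp: "\<And>x. norm x > R \<Longrightarrow> f x = 0"
  shows "f \<in> closV"
proof -
  have "\<exists>q. polynomial_function q \<and> (\<forall>x\<in>cball (0::'a) (R + 1). norm (f x - q x) < 1 / real (Suc N))" for N
    by (rule Stone_Weierstrass_polynomial_function) (auto intro: continuous_on_subset[OF f])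
  then obtain q where q: "\<And>N. polynomial_function (q N)"
    and qf: "\<And>N x. x \<in> cball (0::'a) (R + 1) \<Longrightarrow> norm (f x - q N x) < 1 / real (Suc N)"
    by metis
  have "compact (f ` cball 0 (R + 1))"
    by (intro compact_continuous_image continuous_on_subset[OF f]) auto
  then obtain B where B: "\<And>x. x \<in> cball 0 (R + 1) \<Longrightarrow> cmod (f x) \<le> B"
    using compact_imp_bounded bounded_iff by (metis imageI)
  let ?h = "\<lambda>N x. q N x * of_real (cutoff R (norm x))"
  have diff: "cmod (?h N x - f x) \<le> 1 / real (Suc N)" for N x
  proof (cases "norm x \<le> R + 1")
    case True
    have "f x = f x * of_real (cutoff R (norm x))" using supp[of x] cutoff(3)[of "norm x" R] by (cases "norm x \<le> R") auto
    then have "?h N x - f x = (q N x - f x) * of_real (cutoff R (norm x))" by (simp add: left_diff_distrib)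
    then have "cmod (?h N x - f x) = cmod (q N x - f x) * cutoff R (norm x)" using cutoff(1) by (simp add: norm_mult)
    also have "\<dots> \<le> 1 / real (Suc N) * 1"
      using qf[of x N] True cutoff(1,2) by (intro mult_mono) (auto simp: norm_minus_commute less_imp_le)
    finally show ?thesis by simp
  next
    case False
    then show ?thesis using supp[of x] cutoff(4)[of R "norm x"] by simp
  qed
  have meas: "f \<in> borel_measurable borel" by (rule borel_measurable_continuous_onI[OF f])
  define G where "G x = complex_of_real ((\<bar>B\<bar> + 1) * indicator (cball 0 (R + 1)) x)" for x :: 'a
  show ?thesis
  proof (rule closV_dominated_limit[OF meas])
    show "?h N \<in> closV" for N
      using R by (intro polynomial_radial_closV[OF q continuous_on_cutoff, of "R + 1"] cutoff(4)) auto
    show "G \<in> L2 M"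
    proof (rule bounded_support_L2)
      show "G \<in> borel_measurable borel" unfolding G_def[abs_def] by measurable
      show "cmod (G x) \<le> \<bar>B\<bar> + 1" for x by (simp add: G_def indicator_def norm_mult)
      show "norm x > R + 1 \<Longrightarrow> G x = 0" for x by (simp add: G_def indicator_def)
    qed
    show "AE x in M. (\<lambda>N. ?h N x) \<longlonglongrightarrow> f x"
      by (intro AE_I2 LIMSEQ_norm_le_inverse_Suc diff)
    show "AE x in M. cmod (?h N x) \<le> cmod (G x)" for N
    proof (rule AE_I2)
      fix x
      show "cmod (?h N x) \<le> cmod (G x)"
      proof (cases "norm x \<le> R + 1")
        case True
        have "1 / real (Suc N) \<le> 1" by simp
        moreover have "cmod (f x) \<le> B" using True by (intro B) simp
        ultimately have "cmod (?h N x) \<le> B + 1"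
          using norm_triangle_sub[of "?h N x" "f x"] diff[of N x] by linarith
        also have "\<dots> \<le> cmod (G x)" using True by (simp add: G_def)
        finally show ?thesis .
      next
        case False
        then show ?thesis using cutoff(4)[of R "norm x"] by simp
      qed
    qed
  qed
qed

text \<open>The radial retraction onto the closed disc of radius \<open>R\<close>. Being continuous,
  it makes approximants bounded without destroying their convergence.\<close>

definition clamp :: "real \<Rightarrow> complex \<Rightarrow> complex" where
  "clamp R z = of_real (R / max R (cmod z)) * z"

lemma norm_clamp:
  assumes "R > 0" shows "cmod (clamp R z) \<le> R" "cmod (clamp R z) \<le> cmod z"
proof -
  have "cmod (clamp R z) = R / max R (cmod z) * cmod z"
    using assms by (simp add: clamp_def norm_mult norm_divide max_def)
  then show "cmod (clamp R z) \<le> R" "cmod (clamp R z) \<le> cmod z"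
    using assms by (auto simp: max_def field_simps)
qed

lemma clamp_eq: "R > 0 \<Longrightarrow> cmod z \<le> R \<Longrightarrow> clamp R z = z"
  by (simp add: clamp_def max_def)

lemma continuous_on_clamp: "R > 0 \<Longrightarrow> continuous_on S (clamp R)"
  unfolding clamp_def[abs_def] by (intro continuous_intros) (auto simp: max_def)

text \<open>A measurable function is an almost everywhere limit of continuous ones, with no bound on
  them. Clamping values and cutting off space at a fixed level \<open>R\<close> supplies an
  \<open>L2\<close> dominant; afterwards \<open>R\<close> tends to infinity, with \<open>f\<close>
  itself as dominant.\<close>

lemma V_dense:
  assumes f: "f \<in> L2 M" shows "f \<in> closV"
proof -
  have fm: "f \<in> borel_measurable borel" using L2_measurable[OF f] by simp
  then have "f \<in> borel_measurable lebesgue" by (intro measurable_completion) simp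
  then have "f measurable_on UNIV" by (rule lebesgue_measurable_imp_measurable_on) simp
  then obtain Z g where Z: "negligible Z" and g: "\<And>n. continuous_on UNIV (g n)"
    and lim: "\<And>x. x \<notin> Z \<Longrightarrow> (\<lambda>n. g n x) \<longlonglongrightarrow> f x"
    unfolding measurable_on_def by auto
  have "AE x in lebesgue. x \<notin> Z"
    using Z by (intro AE_not_in) (simp add: negligible_iff_null_sets)
  then have "AE x in lborel. x \<notin> Z" by (simp add: AE_completion_iff)
  then have Z': "AE x in M. x \<notin> Z" by (rule AE_M)
  define c where "c R = (\<lambda>x. of_real (cutoff (real (Suc R)) (norm x)) * clamp (real (Suc R)) (f x))" for R
  have cm: "c R \<in> borel_measurable borel" for R
  proof -
    have "(\<lambda>x. clamp (real (Suc R)) (f x)) \<in> borel_measurable borel"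
      by (rule measurable_compose[OF fm]) (intro borel_measurable_continuous_onI continuous_on_clamp, simp)
    moreover have "(\<lambda>x::'a. cutoff (real (Suc R)) (norm x)) \<in> borel_measurable borel"
      by (intro borel_measurable_continuous_onI continuous_on_compose2[OF continuous_on_cutoff[of UNIV]] continuous_intros) auto
    ultimately show ?thesis unfolding c_def by measurable
  qed
  have cV: "c R \<in> closV" for R
  proof (rule closV_dominated_limit[OF cm])
    let ?h = "\<lambda>n x. of_real (cutoff (real (Suc R)) (norm x)) * clamp (real (Suc R)) (g n x)"
    have bound: "cmod (?h n x) \<le> real (Suc R) * indicator (cball 0 (real (Suc R) + 1)) x" for n x
    proof (cases "norm x \<le> real (Suc R) + 1")
      case True
      have "cmod (?h n x) = cutoff (real (Suc R)) (norm x) * cmod (clamp (real (Suc R)) (g n x))"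
        using cutoff(1) by (simp add: norm_mult)
      also have "\<dots> \<le> 1 * real (Suc R)"
        by (intro mult_mono cutoff norm_clamp) auto
      finally show ?thesis using True by simp
    next
      case False
      then show ?thesis using cutoff(4)[of "real (Suc R)" "norm x"] by simp
    qed
    show "?h n \<in> closV" for n
    proof (rule continuous_closV)
      show "continuous_on UNIV (?h n)"
        by (intro continuous_intros continuous_on_compose2[OF continuous_on_cutoff[of UNIV]]
            continuous_on_compose2[OF continuous_on_clamp[of _ UNIV]] g) auto
      show "real (Suc R) + 1 > 0" by simp
      show "?h n x = 0" if "norm x > real (Suc R) + 1" for x
        using bound[of x n] that by simp
    qed
    show "(\<lambda>x. complex_of_real (real (Suc R) * indicator (cball 0 (real (Suc R) + 1)) x)) \<in> L2 M"
    proof (rule bounded_support_L2)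
      show "(\<lambda>x::'a. complex_of_real (real (Suc R) * indicator (cball 0 (real (Suc R) + 1)) x)) \<in> borel_measurable borel"
        by measurable
      show "cmod (complex_of_real (real (Suc R) * indicator (cball 0 (real (Suc R) + 1)) x)) \<le> real (Suc R)" for x :: 'a
        by (simp add: indicator_def norm_mult del: of_nat_Suc)
      show "norm x > real (Suc R) + 1 \<Longrightarrow> complex_of_real (real (Suc R) * indicator (cball 0 (real (Suc R) + 1)) x) = 0" for x :: 'a
        by (simp add: indicator_def)
    qed
    show "AE x in M. (\<lambda>n. ?h n x) \<longlonglongrightarrow> c R x"
      using Z'
    proof eventually_elim
      case (elim x)
      have "isCont (clamp (real (Suc R))) (f x)"
        using continuous_on_clamp[of "real (Suc R)" UNIV] by (simp add: continuous_on_eq_continuous_at)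
      from isCont_tendsto_compose[OF this lim[OF elim]]
      show ?case unfolding c_def by (intro tendsto_intros)
    qed
    show "AE x in M. cmod (?h n x) \<le> cmod (complex_of_real (real (Suc R) * indicator (cball 0 (real (Suc R) + 1)) x))" for n
    proof (rule AE_I2)
      fix x
      show "cmod (?h n x) \<le> cmod (complex_of_real (real (Suc R) * indicator (cball 0 (real (Suc R) + 1)) x))"
        using bound[of x n] unfolding norm_of_real by (rule order_trans[OF _ abs_ge_self])
    qed
  qed
  show ?thesis
  proof (rule closV_dominated_limit[OF fm cV f])
    show "AE x in M. (\<lambda>R. c R x) \<longlonglongrightarrow> f x"
    proof (rule AE_I2)
      fix x
      obtain R0 where R0: "max (norm x) (cmod (f x)) \<le> real R0" using real_arch_simple by blast
      have "\<forall>\<^sub>F R in sequentially. c R x = f x"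
        using eventually_ge_at_top[of R0]
      proof eventually_elim
        case (elim R)
        then have "real R0 \<le> real R" by simp
        with R0 have "norm x \<le> real (Suc R)" "cmod (f x) \<le> real (Suc R)" by auto
        then show ?case unfolding c_def using cutoff(3) clamp_eq[of "real (Suc R)" "f x"] by simp
      qed
      then show "(\<lambda>R. c R x) \<longlonglongrightarrow> f x" by (rule tendsto_eventually)
    qed
    show "AE x in M. cmod (c R x) \<le> cmod (f x)" for R
    proof (rule AE_I2)
      fix x
      have "cmod (c R x) = cutoff (real (Suc R)) (norm x) * cmod (clamp (real (Suc R)) (f x))"
        using cutoff(1) by (simp add: c_def norm_mult)
      also have "\<dots> \<le> 1 * cmod (f x)"
        by (intro mult_mono cutoff norm_clamp) auto
      finally show "cmod (c R x) \<le> cmod (f x)" by simp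
    qed
  qed
qed

end

section \<open>Multiplication by t as a Jacobi matrix\<close>

context ka_weight
begin

lemma lam_eq: "lam m = lam 0 + 2 * real m / a"
  unfolding lambda_def using a0 by (simp add: field_simps)

lemma lam0_pos: "0 < lam 0 + 1"
proof -
  have "lam 0 + 1 = (2 * mult_index P k + real DIM('a) + a - 2) / a"
    unfolding lambda_def using a0 by (simp add: field_simps)
  then show ?thesis using dim a0 by simp
qed

lemma lam_mono: "lam 0 \<le> lam m"
  using lam_eq[of m] a0 by simp

lemma lam_pos: "0 < lam m + 1"
  using lam0_pos lam_mono[of m] by linarith

lemma lam_inj: "lam m = lam m' \<longleftrightarrow> m = m'"
  unfolding lam_eq[of m] lam_eq[of m'] using a0 by simp

definition ev :: "nat \<Rightarrow> nat \<Rightarrow> real" where "ev m l = 2 * real l + lam m + 1"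

text \<open>The factor of the lower neighbour. It is 0 for \<open>l = 0\<close>, where
  \<open>l - 1\<close> truncates and would name the function itself.\<close>

definition lowc :: "nat \<Rightarrow> nat \<Rightarrow> real" where "lowc m l = of_bool (l > 0) * (real l + lam m)"

lemma tt_Phi': "of_real (tt x) * \<Phi> m l p x =
   of_real (ev m l) * \<Phi> m l p x - of_real (real (l + 1)) * \<Phi> m (l + 1) p x - of_real (lowc m l) * \<Phi> m (l - 1) p x"
  unfolding tt_Phi ev_def lowc_def ..

lemma tt_ip: "ip M (\<lambda>x. of_real (tt x) * u x) v = ip M u (\<lambda>x. of_real (tt x) * v x)"
  by (simp add: ip_def mult_ac)

text \<open>The two integrands agree pointwise, so no integrability enters.\<close>

lemma wip_tt: "wip M tt u v = ip M u (\<lambda>x. of_real (tt x) * v x)"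
proof -
  have "(of_real (sqrt (tt x)) * u x) * cnj (of_real (sqrt (tt x)) * v x) = u x * cnj (of_real (tt x) * v x)" for x
  proof -
    have "(of_real (sqrt (tt x)) * u x) * cnj (of_real (sqrt (tt x)) * v x)
        = of_real (sqrt (tt x) * sqrt (tt x)) * (u x * cnj (v x))"
      by (simp only: complex_cnj_mult complex_cnj_complex_of_real of_real_mult mult_ac)
    also have "sqrt (tt x) * sqrt (tt x) = tt x" by simp
    finally show ?thesis by (simp only: complex_cnj_mult complex_cnj_complex_of_real mult_ac)
  qed
  then show ?thesis unfolding wip_def ip_def by (simp only:)
qed

text \<open>The weighted square of \<open>u\<close> is the product of the two \<open>L2\<close>
  functions \<open>tt u\<close> and \<open>u\<close>.\<close>

lemma wL2I:
  assumes u: "u \<in> L2 M" and tu: "(\<lambda>x. of_real (tt x) * u x) \<in> L2 M"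
  shows "u \<in> wL2 M tt"
proof -
  have m: "(\<lambda>x. of_real (sqrt (tt x)) * u x) \<in> borel_measurable M"
    using L2_measurable[OF u] by measurable
  have "integrable M (\<lambda>x. Re ((of_real (tt x) * u x) * cnj (u x)))"
    by (intro integrable_Re L2_integrable_mult u tu)
  also have "(\<lambda>x. Re ((of_real (tt x) * u x) * cnj (u x))) = (\<lambda>x. (cmod (of_real (sqrt (tt x)) * u x))\<^sup>2)"
    by (simp add: mult.assoc complex_norm_square[symmetric] norm_mult power_mult_distrib flip: of_real_mult)
  finally show ?thesis using m u by (simp add: wL2_def L2_def)
qed

lemma V_wL2: "v \<in> V \<Longrightarrow> v \<in> wL2 M tt"
  by (intro wL2I V_L2 tt_V)

end

section \<open>Orthogonality and the conjugated multiplication operator\<close>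

locale ka_fourier = ka_weight P k a for P :: "'a::euclidean_space set" and k a +
  fixes F :: "('a \<Rightarrow> complex) \<Rightarrow> ('a \<Rightarrow> complex)"
  assumes F: "is_ka_Fourier P k a F"
begin

lemma U: "unitary_on_L2 M F"
  using F by (simp add: is_ka_Fourier_def)

definition \<omega> :: "nat \<Rightarrow> nat \<Rightarrow> complex" where
  "\<omega> m l = exp (- \<i> * of_real (pi * (real l + real m / a)))"

lemma F_Phi: "p \<in> Harm m \<Longrightarrow> AE x in M. F (\<Phi> m l p) x = \<omega> m l * \<Phi> m l p x"
  using F by (simp add: is_ka_Fourier_def \<omega>_def)

lemma \<omega>_Suc: "\<omega> m (l + 1) = - \<omega> m l"
proof -
  have "\<omega> m (l + 1) = exp (- \<i> * of_real (pi * (real l + real m / a)) + (- (\<i> * of_real pi)))"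
    unfolding \<omega>_def by (simp add: algebra_simps)
  also have "\<dots> = \<omega> m l * exp (- (\<i> * of_real pi))"
    unfolding \<omega>_def by (rule exp_add)
  also have "exp (- (\<i> * of_real pi)) = -1"
    by (simp add: exp_minus)
  finally show ?thesis by simp
qed

text \<open>Unitarity: an inner product can be nonzero only if the two phases agree.\<close>

lemma Phi_ip_invariant:
  assumes p: "p \<in> Harm m" and q: "q \<in> Harm m'"
  shows "\<omega> m l * cnj (\<omega> m' l') * ip M (\<Phi> m l p) (\<Phi> m' l' q) = ip M (\<Phi> m l p) (\<Phi> m' l' q)"
proof -
  have L: "\<Phi> m l p \<in> L2 M" "\<Phi> m' l' q \<in> L2 M" using p q by (auto intro: Phi_L2)
  have "ip M (\<Phi> m l p) (\<Phi> m' l' q) = ip M (F (\<Phi> m l p)) (F (\<Phi> m' l' q))"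
    by (rule unitary_ip[OF U L, symmetric])
  also have "\<dots> = ip M (\<lambda>x. \<omega> m l * \<Phi> m l p x) (\<lambda>x. \<omega> m' l' * \<Phi> m' l' q x)"
    by (intro ip_cong_AE F_Phi p q L2_measurable unitary_closed[OF U] L L2_scale)
  also have "\<dots> = \<omega> m l * cnj (\<omega> m' l') * ip M (\<Phi> m l p) (\<Phi> m' l' q)"
    by (simp add: ip.scale_left[OF L(1) L2_scale[OF L(2)]] ip.scale_right[OF L(2) L(1)])
  finally show ?thesis by simp
qed

text \<open>Symmetry of multiplication by \<open>tt\<close> gives the difference of the two claims.
  Multiplying it by the phase quotient \<open>w\<close> fixes \<open>G l l'\<close> and reverses the
  sign of every neighbour, which gives their sum.\<close>

lemma Phi_ip_recurrences:
  fixes l l' :: nat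
  assumes p: "p \<in> Harm m" and q: "q \<in> Harm m'"
  defines "G \<equiv> \<lambda>l l'. ip M (\<Phi> m l p) (\<Phi> m' l' q)"
  shows "of_real (ev m l) * G l l' = of_real (ev m' l') * G l l'"
    and "of_real (real (l + 1)) * G (l + 1) l' + of_real (lowc m l) * G (l - 1) l' =
         of_real (real (l' + 1)) * G l (l' + 1) + of_real (lowc m' l') * G l (l' - 1)"
proof -
  have L: "\<Phi> m l p \<in> L2 M" "\<Phi> m' l' q \<in> L2 M" for l l' using p q by (auto intro: Phi_L2)
  have "ip M (\<lambda>x. of_real (tt x) * \<Phi> m l p x) (\<Phi> m' l' q) = of_real (ev m l) * G l l'
      - of_real (real (l + 1)) * G (l + 1) l' - of_real (lowc m l) * G (l - 1) l'"
    unfolding tt_Phi' G_def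
    by (simp only: ip.diff_left ip.scale_left ip.diff_closed L2_scale L)
  moreover have "ip M (\<Phi> m l p) (\<lambda>x. of_real (tt x) * \<Phi> m' l' q x) = of_real (ev m' l') * G l l'
      - of_real (real (l' + 1)) * G l (l' + 1) - of_real (lowc m' l') * G l (l' - 1)"
    unfolding tt_Phi' G_def
    by (simp only: ip.diff_right ip.scale_right ip.diff_closed L2_scale L complex_cnj_complex_of_real)
  ultimately have sym: "of_real (ev m l) * G l l' - (of_real (real (l + 1)) * G (l + 1) l' + of_real (lowc m l) * G (l - 1) l')
    = of_real (ev m' l') * G l l' - (of_real (real (l' + 1)) * G l (l' + 1) + of_real (lowc m' l') * G l (l' - 1))"
    using tt_ip[of "\<Phi> m l p" "\<Phi> m' l' q"] by (simp only: diff_diff_eq)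
  define w where "w = \<omega> m l * cnj (\<omega> m' l')"
  have w0: "w * G l l' = G l l'" unfolding w_def G_def by (rule Phi_ip_invariant[OF p q])
  have w1: "w * G (l + 1) l' = - G (l + 1) l'"
    using Phi_ip_invariant[OF p q, of "l + 1" l'] unfolding w_def G_def \<omega>_Suc by (simp add: minus_equation_iff)
  have w2: "w * G l (l' + 1) = - G l (l' + 1)"
    using Phi_ip_invariant[OF p q, of l "l' + 1"] unfolding w_def G_def \<omega>_Suc by (simp add: minus_equation_iff)
  have w3: "w * (of_real (lowc m l) * G (l - 1) l') = - (of_real (lowc m l) * G (l - 1) l')"
  proof (cases l)
    case 0
    then show ?thesis by (simp add: lowc_def)
  next
    case (Suc j)
    then have "w * G (l - 1) l' = - G (l - 1) l'"
      using Phi_ip_invariant[OF p q, of j l'] \<omega>_Suc[of m j] unfolding w_def G_def by (simp add: minus_equation_iff)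
    then show ?thesis by (simp only: mult.left_commute[of w] mult_minus_right)
  qed
  have w4: "w * (of_real (lowc m' l') * G l (l' - 1)) = - (of_real (lowc m' l') * G l (l' - 1))"
  proof (cases l')
    case 0
    then show ?thesis by (simp add: lowc_def)
  next
    case (Suc j)
    then have "w * G l (l' - 1) = - G l (l' - 1)"
      using Phi_ip_invariant[OF p q, of l j] \<omega>_Suc[of m' j] unfolding w_def G_def by (simp add: minus_equation_iff)
    then show ?thesis by (simp only: mult.left_commute[of w] mult_minus_right)
  qed
  have sym': "of_real (ev m l) * G l l' + (of_real (real (l + 1)) * G (l + 1) l' + of_real (lowc m l) * G (l - 1) l')
    = of_real (ev m' l') * G l l' + (of_real (real (l' + 1)) * G l (l' + 1) + of_real (lowc m' l') * G l (l' - 1))"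
    using arg_cong[OF sym, of "\<lambda>z. w * z"]
    by (simp only: right_diff_distrib distrib_left mult.left_commute[of w "of_real (ev m l)"] mult.left_commute[of w "of_real (ev m' l')"]
       mult.left_commute[of w "of_real (real (l + 1))"] mult.left_commute[of w "of_real (real (l' + 1))"] w0 w1 w2 w3 w4
       mult_minus_right minus_add_distrib[symmetric] diff_minus_eq_add)
  have half: "x = x'" "y = y'" if "x - y = x' - y'" "x + y = x' + y'" for x y x' y' :: complex
  proof -
    have "(x - y) + (x + y) = (x' - y') + (x' + y')" "(x + y) - (x - y) = (x' + y') - (x' - y')" using that by simp_all
    then have "2 * x = 2 * x'" "2 * y = 2 * y'" by (simp_all add: algebra_simps)
    then show "x = x'" "y = y'" by simp_all
  qed
  show "of_real (ev m l) * G l l' = of_real (ev m' l') * G l l'"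
    and "of_real (real (l + 1)) * G (l + 1) l' + of_real (lowc m l) * G (l - 1) l' =
         of_real (real (l' + 1)) * G l (l' + 1) + of_real (lowc m' l') * G l (l' - 1)"
    by (rule half[OF sym sym'])+
qed

lemma Phi_ip_ev:
  assumes "p \<in> Harm m" "q \<in> Harm m'" "ev m l \<noteq> ev m' l'"
  shows "ip M (\<Phi> m l p) (\<Phi> m' l' q) = 0"
  using Phi_ip_recurrences(1)[OF assms(1,2), of l l'] assms(3) by simp

text \<open>In the off-diagonal recurrence at \<open>(l, l' + 1)\<close> the two other terms pair
  functions whose diagonal values differ by 4, hence vanish.\<close>

lemma Phi_ip_ladder:
  assumes p: "p \<in> Harm m" and q: "q \<in> Harm m'" and eq: "ev m l = ev m' l'"
  shows "of_real (real (l + 1)) * ip M (\<Phi> m (l + 1) p) (\<Phi> m' (l' + 1) q) =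
      of_real (real l' + 1 + lam m') * ip M (\<Phi> m l p) (\<Phi> m' l' q)"
proof -
  have low: "of_real (lowc m l) * ip M (\<Phi> m (l - 1) p) (\<Phi> m' (l' + 1) q) = 0"
  proof (cases l)
    case 0
    then show ?thesis by (simp add: lowc_def)
  next
    case (Suc j)
    then have "ev m (l - 1) \<noteq> ev m' (l' + 1)" using eq by (simp add: ev_def)
    from Phi_ip_ev[OF p q this] show ?thesis by simp
  qed
  have high: "ip M (\<Phi> m l p) (\<Phi> m' (l' + 1 + 1) q) = 0"
    using eq by (intro Phi_ip_ev p q) (simp add: ev_def)
  have c: "lowc m' (l' + 1) = real l' + 1 + lam m'" by (simp add: lowc_def)
  show ?thesis
    using Phi_ip_recurrences(2)[OF p q, of l "l' + 1"]
    by (simp only: low high c mult_zero_right add_0_left add_0_right add_diff_cancel_right')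
qed

text \<open>For equal diagonal values the ladder, read once for the pair and once with its members
  exchanged, gives two linear equations between the inner product \<open>g\<close> and its successor
  \<open>h\<close>. Eliminating \<open>h\<close> leaves \<open>g = 0\<close> unless the coefficients
  coincide.\<close>

lemma Phi_orthogonal:
  assumes p: "p \<in> Harm m" and q: "q \<in> Harm m'" and ne: "(m, l) \<noteq> (m', l')"
  shows "ip M (\<Phi> m l p) (\<Phi> m' l' q) = 0"
proof (cases "ev m l = ev m' l'")
  case False
  then show ?thesis by (rule Phi_ip_ev[OF p q])
next
  case True
  have L: "\<Phi> m l p \<in> L2 M" "\<Phi> m' l' q \<in> L2 M" for l l' using p q by (auto intro: Phi_L2)
  define y where "y = real l + 1"
  define y' where "y' = real l' + 1"
  define g where "g = ip M (\<Phi> m l p) (\<Phi> m' l' q)"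
  define h where "h = ip M (\<Phi> m (l + 1) p) (\<Phi> m' (l' + 1) q)"
  have up: "of_real y * h = of_real (y' + lam m') * g"
    using Phi_ip_ladder[OF p q True] by (simp add: y_def y'_def g_def h_def add_ac)
  have up': "of_real y' * h = of_real (y + lam m) * g"
  proof -
    have gh: "cnj (ip M (\<Phi> m' l' q) (\<Phi> m l p)) = g" "cnj (ip M (\<Phi> m' (l' + 1) q) (\<Phi> m (l + 1) p)) = h"
      unfolding g_def h_def by (rule ip.hermitian[OF L(2) L(1), symmetric])+
    from arg_cong[OF Phi_ip_ladder[OF q p True[symmetric]], of cnj]
    have "of_real (real (l' + 1)) * h = of_real (real l + 1 + lam m) * g"
      by (simp only: complex_cnj_mult complex_cnj_complex_of_real gh)
    then show ?thesis by (simp add: y_def y'_def add_ac)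
  qed
  have lam: "lam m = lam m' + 2 * (y' - y)" using True by (simp add: ev_def y_def y'_def)
  have "of_real (y' * (y' + lam m')) * g = of_real (y * (y + lam m)) * g"
    by (simp only: of_real_mult mult.assoc up[symmetric] up'[symmetric] mult.left_commute[of "complex_of_real y'"])
  then have "g = 0 \<or> y' * (y' + lam m') = y * (y + lam m)"
    by (simp only: mult_cancel_right of_real_eq_iff)
  moreover have "y' * (y' + lam m') \<noteq> y * (y + lam m)"
  proof
    assume "y' * (y' + lam m') = y * (y + lam m)"
    \<comment> \<open>Substituting \<open>lam\<close> factors the difference of coefficients. The
      first factor forces equal indices. The second makes \<open>lam m\<close> and
      \<open>lam m'\<close> opposite numbers of the form l' - l and l - l', so unless both are 0 one
      of them is at most -1, against \<open>lam_pos\<close>.\<close>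
    then have "(y' - y) * (y' - y + lam m') = 0" unfolding lam by (simp add: algebra_simps)
    then consider "y = y'" | "lam m' = y - y'" by auto
    then show False
    proof cases
      case 1
      then have "m = m'" using lam lam_inj by simp
      then show False using 1 ne by (simp add: y_def y'_def)
    next
      case 2
      then have m: "lam m = y' - y" using lam by simp
      consider "l = l'" | "l < l'" | "l' < l" by linarith
      then show False
      proof cases
        case 1
        then show False using 2 m lam_inj[of m m'] ne by (simp add: y_def y'_def)
      next
        case 2
        then have "y - y' \<le> -1" by (simp add: y_def y'_def)
        then show False using lam_pos[of m'] \<open>lam m' = y - y'\<close> by simp
      next
        case 3
        then have "y' - y \<le> -1" by (simp add: y_def y'_def)
        then show False using lam_pos[of m] m by simp
      qed
    qed
  qed
  ultimately show ?thesis by (simp add: g_def)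
qed

text \<open>The ratio of consecutive squared norms, read off the ladder in place of Gamma
  integrals.\<close>

lemma Phi_sq_Suc:
  assumes p: "p \<in> Harm m"
  shows "real (l + 1) * ip.sq M (\<Phi> m (l + 1) p) = (real l + 1 + lam m) * ip.sq M (\<Phi> m l p)"
  using Phi_ip_ladder[OF p p refl, of l]
  by (simp only: ip.sq_eq[OF Phi_L2[OF p]] of_real_mult[symmetric] of_real_eq_iff)

text \<open>\<open>y\<close> represents F^-1 t F v inside \<open>V\<close>. A relation, because
  \<open>F\<close> determines functions only up to null sets.\<close>

definition conj_tt :: "('a \<Rightarrow> complex) \<Rightarrow> ('a \<Rightarrow> complex) \<Rightarrow> bool" where
  "conj_tt v y \<longleftrightarrow> v \<in> V \<and> y \<in> V \<and> (AE x in M. F y x = of_real (tt x) * F v x)"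

lemma conj_tt_add:
  assumes "conj_tt v y" "conj_tt v' y'"
  shows "conj_tt (\<lambda>x. v x + v' x) (\<lambda>x. y x + y' x)"
proof -
  have VV: "v \<in> V" "y \<in> V" "v' \<in> V" "y' \<in> V" using assms by (auto simp: conj_tt_def)
  have *: "AE x in M. F y x = of_real (tt x) * F v x" "AE x in M. F y' x = of_real (tt x) * F v' x"
    using assms by (auto simp: conj_tt_def)
  have "AE x in M. F (\<lambda>x. y x + y' x) x = of_real (tt x) * F (\<lambda>x. v x + v' x) x"
    using * unitary_add[OF U V_L2[OF VV(2)] V_L2[OF VV(4)]] unitary_add[OF U V_L2[OF VV(1)] V_L2[OF VV(3)]]
    by eventually_elim (simp add: distrib_left)
  then show ?thesis using VV by (simp add: conj_tt_def V.add)
qed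

lemma conj_tt_zero: "conj_tt (\<lambda>x. 0) (\<lambda>x. 0)"
proof -
  have "AE x in M. F (\<lambda>x. 0) x = of_real (tt x) * F (\<lambda>x. 0) x"
    using unitary_zero[OF U] by eventually_elim simp
  then show ?thesis using V_zero by (simp add: conj_tt_def)
qed

lemma conj_tt_sum:
  "finite I \<Longrightarrow> (\<And>i. i \<in> I \<Longrightarrow> conj_tt (h i) (g i)) \<Longrightarrow> conj_tt (\<lambda>x. \<Sum>i\<in>I. h i x) (\<lambda>x. \<Sum>i\<in>I. g i x)"
  by (induction rule: finite_induct) (auto intro: conj_tt_add conj_tt_zero)

text \<open>\<open>tt_Phi'\<close> with the signs of both neighbours reversed.\<close>

definition Y :: "nat \<Rightarrow> nat \<Rightarrow> ('a \<Rightarrow> complex) \<Rightarrow> 'a \<Rightarrow> complex" where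
  "Y m l p x = of_real (ev m l) * \<Phi> m l p x + (of_real (real (l + 1)) * \<Phi> m (l + 1) p x + of_real (lowc m l) * \<Phi> m (l - 1) p x)"

lemma Y_V: "p \<in> Harm m \<Longrightarrow> Y m l p \<in> V"
  unfolding Y_def[abs_def] by (intro V.add V_scale V.Phi)

lemma conj_tt_Phi:
  assumes p: "p \<in> Harm m" shows "conj_tt (\<Phi> m l p) (Y m l p)"
proof -
  have L: "(\<lambda>x. c * \<Phi> m l p x) \<in> L2 M" for c l by (intro L2_scale Phi_L2 p)
  have *: "AE x in M. F (\<lambda>x. c * \<Phi> m l p x) x = c * (\<omega> m l * \<Phi> m l p x)" for c l
    using unitary_scale[OF U Phi_L2[OF p], of c l] F_Phi[OF p, of l] by eventually_elim simp
  have low: "of_real (lowc m l) * (\<omega> m (l - 1) * z) = - (\<omega> m l * (of_real (lowc m l) * z))" for z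
    using \<omega>_Suc[of m "l - 1"] by (cases l) (simp_all add: lowc_def)
  have "AE x in M. F (Y m l p) x = of_real (tt x) * F (\<Phi> m l p) x"
    using unitary_add[OF U L[of "of_real (ev m l)" l] L2_add[OF L[of "of_real (real (l + 1))" "l + 1"] L[of "of_real (lowc m l)" "l - 1"]]]
      unitary_add[OF U L[of "of_real (real (l + 1))" "l + 1"] L[of "of_real (lowc m l)" "l - 1"]]
      *[of "of_real (ev m l)" l] *[of "of_real (real (l + 1))" "l + 1"] *[of "of_real (lowc m l)" "l - 1"] F_Phi[OF p, of l]
  proof eventually_elim
    case (elim x)
    have "F (Y m l p) x = of_real (ev m l) * (\<omega> m l * \<Phi> m l p x) +
       (of_real (real (l + 1)) * (\<omega> m (l + 1) * \<Phi> m (l + 1) p x) + of_real (lowc m l) * (\<omega> m (l - 1) * \<Phi> m (l - 1) p x))"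
      unfolding Y_def[abs_def] elim(1,2,3,4,5) ..
    also have "\<dots> = \<omega> m l * (of_real (tt x) * \<Phi> m l p x)"
      unfolding low \<omega>_Suc tt_Phi' by (simp add: algebra_simps)
    finally show ?case unfolding elim(6) by (simp only: mult.left_commute)
  qed
  then show ?thesis using p Y_V by (simp add: conj_tt_def V.Phi)
qed

lemma V_conj_tt: "v \<in> V \<Longrightarrow> \<exists>y. conj_tt v y"
  by (induction rule: V.induct) (auto intro: conj_tt_Phi conj_tt_add)

lemma conj_tt_wip:
  assumes "conj_tt v y" and f: "f \<in> L2 M"
  shows "wip M tt (F f) (F v) = ip M f y"
proof -
  have v: "v \<in> L2 M" and y: "y \<in> L2 M" and eq: "AE x in M. of_real (tt x) * F v x = F y x"
    using assms(1) V_L2 unfolding conj_tt_def by (auto elim: eventually_mono)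
  have "wip M tt (F f) (F v) = ip M (F f) (F y)"
    unfolding wip_tt
  proof (intro ip_cong_AE eq)
    show "(\<lambda>x. of_real (tt x) * F v x) \<in> borel_measurable M"
      using L2_measurable[OF unitary_closed[OF U v]] by measurable
  qed (auto intro: L2_measurable unitary_closed[OF U] f y)
  also have "\<dots> = ip M f y" by (rule unitary_ip[OF U f y])
  finally show ?thesis .
qed

lemma V_form_dom:
  assumes "v \<in> V" shows "v \<in> form_dom M tt F"
proof -
  obtain y where y: "conj_tt v y" using V_conj_tt[OF assms] by blast
  then have yL: "F y \<in> L2 M" and eq: "AE x in M. cmod (of_real (tt x) * F v x) \<le> 1 * cmod (F y x)"
    using V_L2 unitary_closed[OF U] unfolding conj_tt_def by (auto elim: eventually_mono)
  have Fv: "F v \<in> L2 M" by (intro unitary_closed[OF U] V_L2 assms)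
  have "(\<lambda>x. of_real (tt x) * F v x) \<in> L2 M"
    by (rule L2_bound[OF yL _ eq]) (use L2_measurable[OF Fv] in measurable)
  then have "F v \<in> wL2 M tt" by (rule wL2I[OF Fv])
  then show ?thesis using V_wL2[OF assms] by (simp add: form_dom_eq[OF U])
qed

end

section \<open>The uncertainty inequality on the span\<close>

lemma sum_shift_le:
  fixes c :: "nat \<Rightarrow> real"
  assumes "\<And>l. 0 \<le> c l"
  shows "(\<Sum>l<n. if l = 0 then 0 else c (l - 1)) \<le> (\<Sum>l<n. c l)"
proof (cases n)
  case (Suc k)
  have "(\<Sum>l<n. if l = 0 then 0 else c (l - 1)) = (\<Sum>l<k. c l)"
    unfolding Suc sum.lessThan_Suc_shift by simp
  also have "\<dots> \<le> (\<Sum>l<n. c l)" unfolding Suc using assms by simp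
  finally show ?thesis .
qed simp

lemma sum_shift_eq:
  fixes c :: "nat \<Rightarrow> real"
  assumes "c 0 = 0" "c n = 0"
  shows "(\<Sum>l<n. c (l + 1)) = (\<Sum>l<n. c l)"
  using sum.lessThan_Suc_shift[of c n] assms by simp

context ka_weight
begin

lemma Phi_zero: "\<Phi> m l (\<lambda>x. 0) = (\<lambda>x. 0)"
  by (rule ext) (simp add: Phi_def)

lemma Phi_add: "\<Phi> m l (\<lambda>x. p x + q x) x = \<Phi> m l p x + \<Phi> m l q x"
  by (simp add: Phi_def distrib_right)

lemma Phi_sum_extend:
  assumes "n \<le> N" and p: "\<forall>m l. n \<le> m \<or> n \<le> l \<longrightarrow> p m l = (\<lambda>x. 0)"
  shows "(\<Sum>(m, l)\<in>{..<n} \<times> {..<n}. \<Phi> m l (p m l) x) = (\<Sum>(m, l)\<in>{..<N} \<times> {..<N}. \<Phi> m l (p m l) x)"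
proof (rule sum.mono_neutral_left)
  show "\<forall>i\<in>{..<N} \<times> {..<N} - {..<n} \<times> {..<n}. (case i of (m, l) \<Rightarrow> \<Phi> m l (p m l) x) = 0"
  proof
    fix i assume "i \<in> {..<N} \<times> {..<N} - {..<n} \<times> {..<n}"
    then obtain m l where i: "i = (m, l)" and "n \<le> m \<or> n \<le> l" by (cases i) auto
    with p have "p m l = (\<lambda>x. 0)" by blast
    then show "(case i of (m, l) \<Rightarrow> \<Phi> m l (p m l) x) = 0" by (simp add: i Phi_zero)
  qed
qed (use assms(1) in auto)

text \<open>All terms with the same indices are merged into one harmonic \<open>p m l\<close>, so
  distinct terms are orthogonal. Zero coefficients beyond a square index range allow two expansions
  to be compared and index shifts to be made at the boundary.\<close>

lemma V_expansion:
  assumes "v \<in> V"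
  obtains n p where "\<And>m l. p m l \<in> Harm m" "\<And>m l. n \<le> m \<or> n \<le> l \<Longrightarrow> p m l = (\<lambda>x. 0)"
    "v = (\<lambda>x. \<Sum>(m, l)\<in>{..<n} \<times> {..<n}. \<Phi> m l (p m l) x)"
proof -
  have "\<exists>n p. (\<forall>m l. p m l \<in> Harm m) \<and> (\<forall>m l. n \<le> m \<or> n \<le> l \<longrightarrow> p m l = (\<lambda>x. 0)) \<and>
    v = (\<lambda>x. \<Sum>(m, l)\<in>{..<n} \<times> {..<n}. \<Phi> m l (p m l) x)"
    using assms
  proof (induction rule: V.induct)
    case (Phi p m l)
    define n where "n = Suc (max m l)"
    define q where "q m' l' = (if (m', l') = (m, l) then p else (\<lambda>x. 0))" for m' l'
    have "(\<lambda>x. \<Sum>(m', l')\<in>{..<n} \<times> {..<n}. \<Phi> m' l' (q m' l') x) = \<Phi> m l p"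
    proof
      fix x
      have "(\<Sum>(m', l')\<in>{..<n} \<times> {..<n}. \<Phi> m' l' (q m' l') x) = (\<Sum>i\<in>{..<n} \<times> {..<n}. if i = (m, l) then \<Phi> m l p x else 0)"
      proof (intro sum.cong refl)
        fix i
        show "(case i of (m', l') \<Rightarrow> \<Phi> m' l' (q m' l') x) = (if i = (m, l) then \<Phi> m l p x else 0)"
          by (cases i; cases "i = (m, l)") (auto simp: q_def Phi_zero)
      qed
      also have "\<dots> = \<Phi> m l p x" by (simp add: n_def less_Suc_eq_le)
      finally show "(\<Sum>(m', l')\<in>{..<n} \<times> {..<n}. \<Phi> m' l' (q m' l') x) = \<Phi> m l p x" .
    qed
    note eq = this
    have H: "\<forall>m l. q m l \<in> Harm m" using Phi dunkl_harmonics_zero by (auto simp: q_def)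
    have Z: "\<forall>m l. n \<le> m \<or> n \<le> l \<longrightarrow> q m l = (\<lambda>x. 0)" by (auto simp: q_def n_def)
    show ?case
      by (rule exI[of _ n], rule exI[of _ q]) (intro conjI H Z eq[symmetric])
  next
    case (add u v)
    from add.IH(1) obtain n p where p: "\<forall>m l. p m l \<in> Harm m" "\<forall>m l. n \<le> m \<or> n \<le> l \<longrightarrow> p m l = (\<lambda>x. 0)"
      "u = (\<lambda>x. \<Sum>(m, l)\<in>{..<n} \<times> {..<n}. \<Phi> m l (p m l) x)" by blast
    from add.IH(2) obtain n' q where q: "\<forall>m l. q m l \<in> Harm m" "\<forall>m l. n' \<le> m \<or> n' \<le> l \<longrightarrow> q m l = (\<lambda>x. 0)"
      "v = (\<lambda>x. \<Sum>(m, l)\<in>{..<n'} \<times> {..<n'}. \<Phi> m l (q m l) x)" by blast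
    define N where "N = max n n'"
    define r where "r m l = (\<lambda>x. p m l x + q m l x)" for m l
    have uN: "u x = (\<Sum>(m, l)\<in>{..<N} \<times> {..<N}. \<Phi> m l (p m l) x)" for x
      unfolding p(3) by (rule Phi_sum_extend[OF _ p(2)]) (simp add: N_def)
    have vN: "v x = (\<Sum>(m, l)\<in>{..<N} \<times> {..<N}. \<Phi> m l (q m l) x)" for x
      unfolding q(3) by (rule Phi_sum_extend[OF _ q(2)]) (simp add: N_def)
    have "(\<lambda>x. u x + v x) = (\<lambda>x. \<Sum>(m, l)\<in>{..<N} \<times> {..<N}. \<Phi> m l (r m l) x)"
      unfolding uN vN r_def Phi_add by (simp add: sum.distrib case_prod_beta)
    moreover have "\<forall>m l. r m l \<in> Harm m" using p(1) q(1) by (auto simp: r_def intro: dunkl_harmonics_add)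
    moreover have "\<forall>m l. N \<le> m \<or> N \<le> l \<longrightarrow> r m l = (\<lambda>x. 0)"
    proof (intro allI impI)
      fix m l assume "N \<le> m \<or> N \<le> l"
      then have *: "n \<le> m \<or> n \<le> l" "n' \<le> m \<or> n' \<le> l" by (auto simp: N_def)
      have "p m l = (\<lambda>x. 0)" by (rule p(2)[rule_format, OF *(1)])
      moreover have "q m l = (\<lambda>x. 0)" by (rule q(2)[rule_format, OF *(2)])
      ultimately show "r m l = (\<lambda>x. 0)" by (simp add: r_def)
    qed
    ultimately show ?case by blast
  qed
  then obtain n p where *: "\<forall>m l. p m l \<in> Harm m" "\<forall>m l. n \<le> m \<or> n \<le> l \<longrightarrow> p m l = (\<lambda>x. 0)"
    "v = (\<lambda>x. \<Sum>(m, l)\<in>{..<n} \<times> {..<n}. \<Phi> m l (p m l) x)" by blast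
  show ?thesis
  proof (rule that)
    show "p m l \<in> Harm m" for m l using *(1) by simp
    show "n \<le> m \<or> n \<le> l \<Longrightarrow> p m l = (\<lambda>x. 0)" for m l by (rule *(2)[rule_format])
  qed (rule *(3))
qed

end

context ka_fourier
begin

text \<open>With \<open>S\<^sub>0 = \<Sum> l \<parallel>e\<^sub>m\<^sub>l\<parallel>\<^sup>2\<close> and \<open>S\<^sub>1 = \<Sum> (l + 1 + lam m) \<parallel>e\<^sub>m\<^sub>l\<parallel>\<^sup>2\<close> the two forms are \<open>S\<^sub>0 + S\<^sub>1 \<mp> r\<close>
  with \<open>\<bar>r\<bar> \<le> 2 \<surd>(S\<^sub>0 S\<^sub>1)\<close> by Cauchy--Schwarz, so that their product is at least \<open>(S\<^sub>1 - S\<^sub>0)\<^sup>2\<close>.\<close>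

lemma V_uncertainty:
  assumes "v \<in> V"
  shows "((lam 0 + 1) * ip.sq M v)\<^sup>2 \<le> wip.sq M tt v * wip.sq M tt (F v)"
    and "2 * (lam 0 + 1) * ip.sq M v \<le> wip.sq M tt v + wip.sq M tt (F v)"
proof -
  obtain p n where p: "\<And>m l. p m l \<in> Harm m" and p0: "\<And>m l. n \<le> m \<or> n \<le> l \<Longrightarrow> p m l = (\<lambda>x. 0)"
    and v: "v = (\<lambda>x. \<Sum>(m, l)\<in>{..<n} \<times> {..<n}. \<Phi> m l (p m l) x)"
    by (rule V_expansion[OF assms]) blast
  define I where "I = {..<n} \<times> {..<n}"
  define e where "e i = \<Phi> (fst i) (snd i) (p (fst i) (snd i))" for i
  have fin: "finite I" by (simp add: I_def)
  have v_e: "v = (\<lambda>x. \<Sum>i\<in>I. e i x)" unfolding v I_def e_def by (simp add: case_prod_beta)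
  have L: "\<Phi> m l q \<in> L2 M" if "q \<in> Harm m" for m l q by (rule Phi_L2[OF that])
  have eL: "e i \<in> L2 M" for i unfolding e_def by (rule L[OF p])
  have vL: "v \<in> L2 M" by (rule V_L2[OF assms])
  define u where "u m l = sqrt (ip.sq M (\<Phi> m l (p m l)))" for m l
  have u0: "0 \<le> u m l" for m l unfolding u_def by (intro real_sqrt_ge_zero ip.sq_nonneg L p)
  have u_sq: "(u m l)\<^sup>2 = ip.sq M (\<Phi> m l (p m l))" for m l
    unfolding u_def by (intro real_sqrt_pow2 ip.sq_nonneg L p)
  have u_n: "u m n = 0" for m unfolding u_def p0[of m n, OF disjI2[OF order.refl]] Phi_zero by (simp add: sq_ip)
  \<comment> \<open>By orthogonality only the component with the same indices is seen, for any
    harmonic \<open>q\<close>. The case \<open>l \<ge> n\<close> is included because raising can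
    leave the index range; the component there is 0.\<close>
  have ip_v: "ip M (\<Phi> m l q) v = ip M (\<Phi> m l q) (\<Phi> m l (p m l))" if q: "q \<in> Harm m" and m: "m < n" for m l q
  proof -
    have "ip M (\<Phi> m l q) v = (\<Sum>i\<in>I. ip M (\<Phi> m l q) (e i))"
      unfolding v_e by (rule ip.sum_right[OF fin eL L[OF q]])
    also have "\<dots> = (\<Sum>i\<in>I. if i = (m, l) then ip M (\<Phi> m l q) (\<Phi> m l (p m l)) else 0)"
    proof (intro sum.cong refl)
      fix i
      show "ip M (\<Phi> m l q) (e i) = (if i = (m, l) then ip M (\<Phi> m l q) (\<Phi> m l (p m l)) else 0)"
        unfolding e_def using Phi_orthogonal[OF q p, of l "fst i" "snd i"] by (cases i) auto
    qed
    also have "\<dots> = (if (m, l) \<in> I then ip M (\<Phi> m l q) (\<Phi> m l (p m l)) else 0)"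
      using fin by simp
    also have "\<dots> = ip M (\<Phi> m l q) (\<Phi> m l (p m l))"
    proof (cases "l < n")
      case True
      then show ?thesis using m by (simp add: I_def)
    next
      case False
      then have "p m l = (\<lambda>x. 0)" by (intro p0) simp
      then show ?thesis using False by (simp add: I_def Phi_zero ip.zero_right[OF L[OF q]])
    qed
    finally show ?thesis .
  qed
  define D where "D = (\<Sum>i\<in>I. of_real (ev (fst i) (snd i)) * ip M (e i) v)"
  define A where "A = (\<Sum>i\<in>I. of_real (real (snd i + 1)) * ip M (\<Phi> (fst i) (snd i + 1) (p (fst i) (snd i))) v)"
  define C where "C = (\<Sum>i\<in>I. of_real (lowc (fst i) (snd i)) * ip M (\<Phi> (fst i) (snd i - 1) (p (fst i) (snd i))) v)"
  have wip_v: "wip M tt v v = D - A - C"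
  proof -
    have tv: "(\<lambda>x. of_real (tt x) * v x) = (\<lambda>x. \<Sum>i\<in>I. of_real (tt x) * e i x)"
      unfolding v_e sum_distrib_left ..
    have "wip M tt v v = ip M (\<lambda>x. \<Sum>i\<in>I. of_real (tt x) * e i x) v"
      unfolding tv[symmetric] wip_tt tt_ip ..
    also have "\<dots> = (\<Sum>i\<in>I. ip M (\<lambda>x. of_real (tt x) * e i x) v)"
    proof (rule ip.sum_left[OF fin _ vL])
      show "(\<lambda>x. of_real (tt x) * e i x) \<in> L2 M" for i
        unfolding e_def by (intro V_L2 tt_V V.Phi p)
    qed
    also have "\<dots> = (\<Sum>i\<in>I. of_real (ev (fst i) (snd i)) * ip M (e i) v
       - of_real (real (snd i + 1)) * ip M (\<Phi> (fst i) (snd i + 1) (p (fst i) (snd i))) v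
       - of_real (lowc (fst i) (snd i)) * ip M (\<Phi> (fst i) (snd i - 1) (p (fst i) (snd i))) v)"
      unfolding e_def tt_Phi'
      by (intro sum.cong refl) (simp only: ip.diff_left ip.scale_left ip.diff_closed L2_scale L[OF p] vL)
    also have "\<dots> = D - A - C" unfolding D_def A_def C_def by (simp only: sum_subtractf)
    finally show ?thesis .
  qed
  define y where "y = (\<lambda>x. \<Sum>i\<in>I. Y (fst i) (snd i) (p (fst i) (snd i)) x)"
  have y: "conj_tt v y" unfolding v_e y_def e_def
    by (intro conj_tt_sum conj_tt_Phi p fin)
  have yL: "y \<in> L2 M" using y V_L2 by (simp add: conj_tt_def)
  have ip_y: "ip M y v = D + (A + C)"
  proof -
    have "ip M y v = (\<Sum>i\<in>I. ip M (Y (fst i) (snd i) (p (fst i) (snd i))) v)"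
      unfolding y_def by (rule ip.sum_left[OF fin _ vL]) (intro V_L2 Y_V p)
    also have "\<dots> = (\<Sum>i\<in>I. of_real (ev (fst i) (snd i)) * ip M (e i) v
       + (of_real (real (snd i + 1)) * ip M (\<Phi> (fst i) (snd i + 1) (p (fst i) (snd i))) v
       + of_real (lowc (fst i) (snd i)) * ip M (\<Phi> (fst i) (snd i - 1) (p (fst i) (snd i))) v))"
      unfolding e_def Y_def[abs_def]
      by (intro sum.cong refl) (simp only: ip.add_left ip.scale_left ip.add_closed L2_scale L[OF p] vL)
    also have "\<dots> = D + (A + C)" unfolding D_def A_def C_def by (simp only: sum.distrib)
    finally show ?thesis .
  qed
  define S0 where "S0 = (\<Sum>m<n. \<Sum>l<n. real l * (u m l)\<^sup>2)"
  define S1 where "S1 = (\<Sum>m<n. \<Sum>l<n. (real l + 1 + lam m) * (u m l)\<^sup>2)"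
  have ip_e: "ip M (e i) v = of_real ((u (fst i) (snd i))\<^sup>2)" if "i \<in> I" for i
  proof -
    have "fst i < n" using that by (auto simp: I_def)
    from ip_v[OF p this, of "snd i"] show ?thesis
      unfolding e_def u_sq using ip.sq_eq[OF L[OF p]] by simp
  qed
  have sq_v: "ip.sq M v = (\<Sum>m<n. \<Sum>l<n. (u m l)\<^sup>2)"
  proof -
    have "ip M v v = (\<Sum>i\<in>I. ip M (e i) v)"
      by (subst v_e) (rule ip.sum_left[OF fin eL vL])
    also have "\<dots> = of_real (\<Sum>i\<in>I. (u (fst i) (snd i))\<^sup>2)"
      unfolding of_real_sum by (intro sum.cong refl ip_e)
    also have "(\<Sum>i\<in>I. (u (fst i) (snd i))\<^sup>2) = (\<Sum>m<n. \<Sum>l<n. (u m l)\<^sup>2)"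
      unfolding I_def sum.cartesian_product by (simp add: case_prod_beta)
    finally show ?thesis unfolding ip.sq_def by (simp only: Re_complex_of_real)
  qed
  have D: "D = of_real (S0 + S1)"
  proof -
    have "D = of_real (\<Sum>i\<in>I. ev (fst i) (snd i) * (u (fst i) (snd i))\<^sup>2)"
      unfolding D_def of_real_sum of_real_mult by (intro sum.cong refl) (simp add: ip_e)
    also have "(\<Sum>i\<in>I. ev (fst i) (snd i) * (u (fst i) (snd i))\<^sup>2) = (\<Sum>m<n. \<Sum>l<n. ev m l * (u m l)\<^sup>2)"
      unfolding I_def sum.cartesian_product by (simp add: case_prod_beta)
    also have "\<dots> = S0 + S1"
      unfolding S0_def S1_def sum.distrib[symmetric] by (intro sum.cong refl) (simp add: ev_def algebra_simps)
    finally show ?thesis .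
  qed
  \<comment> \<open>Bounds the coupling of levels \<open>l\<close> and \<open>l + 1\<close> in
    either direction: \<open>ladder\<close> trades half of the coefficient for the ratio of the
    norms, which makes the bound symmetric.\<close>
  define b where "b m l = sqrt (real l + 1 + lam m) * u m l * (sqrt (real l + 1) * u m (l + 1))" for m l
  define K where "K = (\<Sum>m<n. \<Sum>l<n. b m l)"
  have lam1: "0 \<le> real l + 1 + lam m" for l m using lam_pos[of m] by linarith
  have b0: "0 \<le> b m l" for m l unfolding b_def using lam1 u0 by (intro mult_nonneg_nonneg) auto
  have ladder: "sqrt (real l + 1) * sqrt (ip.sq M (\<Phi> m (l + 1) q)) = sqrt (real l + 1 + lam m) * sqrt (ip.sq M (\<Phi> m l q))"
    if "q \<in> Harm m" for m l q
    using Phi_sq_Suc[OF that, of l] by (simp add: real_sqrt_mult[symmetric] add.commute)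
  have A: "cmod A \<le> K"
  proof -
    have "cmod A \<le> (\<Sum>i\<in>I. b (fst i) (snd i))"
      unfolding A_def
    proof (rule order_trans[OF norm_sum], rule sum_mono)
      fix i assume "i \<in> I"
      then obtain m l where i: "i = (m, l)" and m: "m < n" by (cases i) (auto simp: I_def)
      have "cmod (ip M (\<Phi> m (l + 1) (p m l)) v) \<le> sqrt (ip.sq M (\<Phi> m (l + 1) (p m l))) * u m (l + 1)"
        unfolding ip_v[OF p m] u_def by (rule ip.Cauchy_Schwarz_sqrt[OF L[OF p] L[OF p]])
      then have "(real l + 1) * cmod (ip M (\<Phi> m (l + 1) (p m l)) v) \<le> (real l + 1) * (sqrt (ip.sq M (\<Phi> m (l + 1) (p m l))) * u m (l + 1))"
        by (rule mult_left_mono) simp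
      also have "\<dots> = (sqrt (real l + 1) * sqrt (ip.sq M (\<Phi> m (l + 1) (p m l)))) * (sqrt (real l + 1) * u m (l + 1))"
        using real_sqrt_mult_self[of "real l + 1"] by (simp only: mult_ac abs_of_nat) simp
      also have "\<dots> = b m l"
        unfolding ladder[OF p] b_def u_def ..
      finally show "cmod (of_real (real (snd i + 1)) * ip M (\<Phi> (fst i) (snd i + 1) (p (fst i) (snd i))) v) \<le> b (fst i) (snd i)"
        unfolding i fst_conv snd_conv norm_mult norm_of_real by (simp add: add.commute)
    qed
    also have "\<dots> = K" unfolding K_def I_def sum.cartesian_product by (simp add: case_prod_beta)
    finally show ?thesis .
  qed
  have C: "cmod C \<le> K"
  proof -
    \<comment> \<open>Lowering from \<open>l\<close> has the bound of raising from
      \<open>l - 1\<close>, so this sum is a shifted part of \<open>K\<close>.\<close>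
    have "cmod C \<le> (\<Sum>i\<in>I. if snd i = 0 then 0 else b (fst i) (snd i - 1))"
      unfolding C_def
    proof (rule order_trans[OF norm_sum], rule sum_mono)
      fix i assume "i \<in> I"
      then obtain m l where i: "i = (m, l)" and m: "m < n" by (cases i) (auto simp: I_def)
      show "cmod (of_real (lowc (fst i) (snd i)) * ip M (\<Phi> (fst i) (snd i - 1) (p (fst i) (snd i))) v) \<le> (if snd i = 0 then 0 else b (fst i) (snd i - 1))"
      proof (cases l)
        case 0
        then show ?thesis by (simp add: i lowc_def)
      next
        case (Suc j)
        have "cmod (ip M (\<Phi> m j (p m l)) v) \<le> sqrt (ip.sq M (\<Phi> m j (p m l))) * u m j"
          unfolding ip_v[OF p m] u_def by (rule ip.Cauchy_Schwarz_sqrt[OF L[OF p] L[OF p]])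
        then have "(real j + 1 + lam m) * cmod (ip M (\<Phi> m j (p m l)) v) \<le> (real j + 1 + lam m) * (sqrt (ip.sq M (\<Phi> m j (p m l))) * u m j)"
          by (rule mult_left_mono) (rule lam1)
        also have "\<dots> = (sqrt (real j + 1 + lam m) * u m j) * (sqrt (real j + 1 + lam m) * sqrt (ip.sq M (\<Phi> m j (p m l))))"
          using real_sqrt_mult_self[of "real j + 1 + lam m"] lam1[of j m] by (simp only: mult_ac abs_of_nonneg) (simp add: mult.assoc[symmetric])
        also have "\<dots> = b m j"
          unfolding ladder[OF p, symmetric] b_def u_def Suc by simp
        finally show ?thesis
          using lam1[of j m] unfolding i fst_conv snd_conv norm_mult norm_of_real by (simp add: Suc lowc_def add.commute)
      qed
    qed
    also have "\<dots> = (\<Sum>m<n. \<Sum>l<n. if l = 0 then 0 else b m (l - 1))"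
      unfolding I_def sum.cartesian_product by (simp add: case_prod_beta)
    also have "\<dots> \<le> K" unfolding K_def by (intro sum_mono sum_shift_le b0)
    finally show ?thesis .
  qed
  have K: "K\<^sup>2 \<le> S0 * S1"
  proof -
    have Keq: "K = (\<Sum>i\<in>I. (sqrt (real (snd i) + 1 + lam (fst i)) * u (fst i) (snd i)) * (sqrt (real (snd i) + 1) * u (fst i) (snd i + 1)))"
      unfolding K_def I_def b_def sum.cartesian_product by (simp add: case_prod_beta)
    have "K\<^sup>2 \<le> (\<Sum>i\<in>I. (sqrt (real (snd i) + 1 + lam (fst i)) * u (fst i) (snd i))\<^sup>2) * (\<Sum>i\<in>I. (sqrt (real (snd i) + 1) * u (fst i) (snd i + 1))\<^sup>2)"
      unfolding Keq by (rule Cauchy_Schwarz_ineq_sum)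
    also have "(\<Sum>i\<in>I. (sqrt (real (snd i) + 1 + lam (fst i)) * u (fst i) (snd i))\<^sup>2) = S1"
      unfolding S1_def I_def sum.cartesian_product
      by (intro sum.cong refl) (simp add: case_prod_beta power_mult_distrib lam1)
    also have "(\<Sum>i\<in>I. (sqrt (real (snd i) + 1) * u (fst i) (snd i + 1))\<^sup>2) = (\<Sum>m<n. \<Sum>l<n. real (l + 1) * (u m (l + 1))\<^sup>2)"
      unfolding I_def sum.cartesian_product
      by (intro sum.cong refl) (simp add: case_prod_beta power_mult_distrib add.commute)
    \<comment> \<open>Nothing is lost in the shift: the weight \<open>l\<close> vanishes at 0 and
      \<open>u m n = 0\<close>.\<close>
    also have "\<dots> = S0"
      unfolding S0_def by (intro sum.cong refl sum_shift_eq) (auto simp: u_n)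
    finally show ?thesis by (simp add: mult.commute)
  qed
  define r where "r = Re (A + C)"
  have r: "\<bar>r\<bar> \<le> 2 * K"
    using abs_Re_le_cmod[of "A + C"] norm_triangle_ineq[of A C] A C unfolding r_def by linarith
  have X: "wip.sq M tt v = S0 + S1 - r"
    unfolding wip.sq_def wip_v D r_def by simp
  have Z: "wip.sq M tt (F v) = S0 + S1 + r"
    unfolding wip.sq_def conj_tt_wip[OF y vL] ip.hermitian[OF yL vL] ip_y D r_def by simp
  \<comment> \<open>The parts growing with \<open>l\<close> cancel in \<open>S1 - S0\<close>,
    leaving \<open>1 + lam m\<close>, which is smallest at \<open>m = 0\<close>.\<close>
  have diff: "(lam 0 + 1) * ip.sq M v \<le> S1 - S0"
  proof -
    have "(lam 0 + 1) * ip.sq M v = (\<Sum>m<n. \<Sum>l<n. (lam 0 + 1) * (u m l)\<^sup>2)"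
      unfolding sq_v sum_distrib_left ..
    also have "\<dots> \<le> (\<Sum>m<n. \<Sum>l<n. (real l + 1 + lam m) * (u m l)\<^sup>2 - real l * (u m l)\<^sup>2)"
    proof (intro sum_mono)
      fix m l
      have "(lam 0 + 1) * (u m l)\<^sup>2 \<le> (1 + lam m) * (u m l)\<^sup>2" using lam_mono[of m] by (intro mult_right_mono) auto
      then show "(lam 0 + 1) * (u m l)\<^sup>2 \<le> (real l + 1 + lam m) * (u m l)\<^sup>2 - real l * (u m l)\<^sup>2" by (simp add: algebra_simps)
    qed
    also have "\<dots> = S1 - S0" unfolding S1_def S0_def by (simp only: sum_subtractf)
    finally show ?thesis .
  qed
  have pos: "0 \<le> (lam 0 + 1) * ip.sq M v" using lam0_pos ip.sq_nonneg[OF vL] by simp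
  have S0: "0 \<le> S0" unfolding S0_def by (intro sum_nonneg) auto
  have "((lam 0 + 1) * ip.sq M v)\<^sup>2 \<le> (S1 - S0)\<^sup>2" by (rule power_mono[OF diff pos])
  also have "\<dots> = (S0 + S1)\<^sup>2 - 4 * (S0 * S1)" by (simp add: power2_eq_square algebra_simps)
  also have "\<dots> \<le> (S0 + S1)\<^sup>2 - r\<^sup>2"
  proof -
    have "r\<^sup>2 \<le> (2 * K)\<^sup>2" using r by (intro abs_le_square_iff[THEN iffD1]) simp
    then show ?thesis using K by (simp add: power_mult_distrib)
  qed
  also have "\<dots> = (S0 + S1 - r) * (S0 + S1 + r)" by (simp add: power2_eq_square algebra_simps)
  finally show "((lam 0 + 1) * ip.sq M v)\<^sup>2 \<le> wip.sq M tt v * wip.sq M tt (F v)" unfolding X Z .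
  show "2 * (lam 0 + 1) * ip.sq M v \<le> wip.sq M tt v + wip.sq M tt (F v)"
    unfolding X Z mult.assoc using diff S0 by linarith
qed

end

section \<open>The uncertainty inequality in \<open>L\<^sup>2\<close>\<close>

text \<open>The tangent of the convex power at \<open>m\<close>. For positive \<open>x\<close> it is
  Young's inequality with weights 1/s and 1 - 1/s, applied to \<open>x powr s\<close> and
  \<open>m powr s\<close>.\<close>

lemma powr_tangent:
  fixes x m s :: real
  assumes "0 \<le> x" "0 < m" "1 \<le> s"
  shows "m powr s + s * m powr (s - 1) * (x - m) \<le> x powr s"
proof (cases "s = 1 \<or> x = 0")
  case True
  then show ?thesis
  proof
    assume "s = 1"
    then show ?thesis using assms by simp
  next
    assume "x = 0"
    have "m powr s = m powr (s - 1) * m" using assms powr_add[of m "s - 1" 1] by simp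
    then have "m powr s + s * m powr (s - 1) * (0 - m) = (1 - s) * m powr s" by (simp add: algebra_simps)
    also have "\<dots> \<le> 0" using assms by (intro mult_nonpos_nonneg) auto
    finally show ?thesis using \<open>x = 0\<close> by simp
  qed
next
  case False
  then have x: "0 < x" and s: "1 < s" using assms by auto
  have "x * m powr (s - 1) \<le> (x powr s) * (1 / s) + (m powr s) * (1 - 1 / s)"
  proof -
    have "(x powr s) powr (1 / s) * (m powr s) powr (1 - 1 / s) \<le> (1 / s) * (x powr s) + (1 - 1 / s) * (m powr s)"
      using s x assms(2) by (intro Youngs_inequality_0) (auto simp: field_simps)
    moreover have "(x powr s) powr (1 / s) = x" using x s by (simp add: powr_powr)
    moreover have "(m powr s) powr (1 - 1 / s) = m powr (s - 1)"
    proof -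
      have "s * (1 - 1 / s) = s - 1" using s by (simp add: field_simps)
      then show ?thesis by (simp only: powr_powr)
    qed
    ultimately show ?thesis by (simp add: mult.commute)
  qed
  then have "s * (x * m powr (s - 1)) \<le> s * ((x powr s) * (1 / s) + (m powr s) * (1 - 1 / s))"
    using s by (intro mult_left_mono) auto
  also have "\<dots> = x powr s + (s - 1) * m powr s" using s by (simp add: field_simps)
  finally have *: "s * (x * m powr (s - 1)) \<le> x powr s + (s - 1) * m powr s" .
  have "m powr s = m powr (s - 1) * m" using assms powr_add[of m "s - 1" 1] by simp
  then have "m powr s + s * m powr (s - 1) * (x - m) = s * (x * m powr (s - 1)) - (s - 1) * m powr s"
    by (simp add: algebra_simps)
  then show ?thesis using * by linarith
qed

text \<open>Jensen's inequality for the probability density |f|^2 / S: integrate the tangent of the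
  power at the mean \<open>m = J / S\<close>. Integrability of the first moment follows from
  \<open>w \<le> 1 + w powr s\<close>.\<close>

lemma moment_interpolation:
  fixes w :: "'a \<Rightarrow> real" and f :: "'a \<Rightarrow> complex"
  assumes f: "f \<in> L2 M" and w: "w \<in> borel_measurable M" "\<And>x. 0 \<le> w x" and s: "1 \<le> s"
    and int: "integrable M (\<lambda>x. w x powr s * (cmod (f x))\<^sup>2)"
  shows "integrable M (\<lambda>x. w x * (cmod (f x))\<^sup>2)"
    and "0 < ip.sq M f \<Longrightarrow> 0 < (LINT x|M. w x * (cmod (f x))\<^sup>2) \<Longrightarrow>
      ip.sq M f * ((LINT x|M. w x * (cmod (f x))\<^sup>2) / ip.sq M f) powr s \<le> (LINT x|M. w x powr s * (cmod (f x))\<^sup>2)"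
proof -
  have fint: "integrable M (\<lambda>x. (cmod (f x))\<^sup>2)" and fm: "f \<in> borel_measurable M"
    using f by (simp_all add: L2_def)
  show wint: "integrable M (\<lambda>x. w x * (cmod (f x))\<^sup>2)"
  proof (rule Bochner_Integration.integrable_bound)
    show "integrable M (\<lambda>x. (cmod (f x))\<^sup>2 + w x powr s * (cmod (f x))\<^sup>2)" using fint int by simp
    show "(\<lambda>x. w x * (cmod (f x))\<^sup>2) \<in> borel_measurable M" using w(1) fm by measurable
    have "w x \<le> 1 + w x powr s" for x
    proof (cases "w x \<le> 1")
      case True
      then show ?thesis using powr_ge_zero[of "w x" s] by linarith
    next
      case False
      then have "w x powr 1 \<le> w x powr s" using s by (intro powr_mono) auto
      then show ?thesis using False by simp
    qed
    then have "w x * (cmod (f x))\<^sup>2 \<le> (1 + w x powr s) * (cmod (f x))\<^sup>2" for x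
      by (rule mult_right_mono) simp
    then show "AE x in M. norm (w x * (cmod (f x))\<^sup>2) \<le> norm ((cmod (f x))\<^sup>2 + w x powr s * (cmod (f x))\<^sup>2)"
      using w(2) by (simp add: distrib_right)
  qed
  define S where "S = ip.sq M f"
  define J where "J = (LINT x|M. w x * (cmod (f x))\<^sup>2)"
  assume "0 < ip.sq M f" and "0 < (LINT x|M. w x * (cmod (f x))\<^sup>2)"
  then have S: "0 < S" and J: "0 < J" by (simp_all add: S_def J_def)
  define m where "m = J / S"
  define c where "c = s * m powr (s - 1)"
  have m: "0 < m" using S J by (simp add: m_def)
  have lin: "integrable M (\<lambda>x. (m powr s - c * m) * (cmod (f x))\<^sup>2 + c * (w x * (cmod (f x))\<^sup>2))"
    using fint wint by simp
  have "S * m powr s = (m powr s - c * m) * S + c * J"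
    using S by (simp add: m_def field_simps)
  also have "\<dots> = (LINT x|M. (m powr s - c * m) * (cmod (f x))\<^sup>2 + c * (w x * (cmod (f x))\<^sup>2))"
    using fint wint by (simp add: S_def J_def sq_ip)
  also have "\<dots> \<le> (LINT x|M. w x powr s * (cmod (f x))\<^sup>2)"
  proof (rule integral_mono[OF lin int])
    fix x
    have "(m powr s - c * m) + c * w x \<le> w x powr s"
      using powr_tangent[OF w(2) m s, of x] by (simp add: c_def algebra_simps)
    then have "((m powr s - c * m) + c * w x) * (cmod (f x))\<^sup>2 \<le> w x powr s * (cmod (f x))\<^sup>2"
      by (rule mult_right_mono) simp
    then show "(m powr s - c * m) * (cmod (f x))\<^sup>2 + c * (w x * (cmod (f x))\<^sup>2) \<le> w x powr s * (cmod (f x))\<^sup>2"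
      by (simp add: distrib_right mult.assoc)
  qed
  finally show "ip.sq M f * ((LINT x|M. w x * (cmod (f x))\<^sup>2) / ip.sq M f) powr s \<le> (LINT x|M. w x powr s * (cmod (f x))\<^sup>2)"
    by (simp add: m_def S_def J_def)
qed

lemma ennpowr_ennreal: "0 \<le> t \<Longrightarrow> ennpowr (ennreal t) s = ennreal (t powr s)"
  by (simp add: ennpowr_def)

lemma ennpowr_top: "ennpowr top s = top"
  by (simp add: ennpowr_def)

lemma ennpowr_eq_0: "ennpowr t s = 0 \<Longrightarrow> t = 0"
  by (cases t) (auto simp: ennpowr_def split: if_splits)

section \<open>From the span to all of L2, and general exponents\<close>

context ka_fourier
begin

interpretation form: hermitian_form "form_dom M tt F" "form M tt F"
  by (rule hermitian_form_form[OF U]) simp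

lemma form_sq: "form.sq f = wip.sq M tt f + wip.sq M tt (F f)"
  by (simp add: form.sq_def form_def wip.sq_def)

lemma form_domD:
  assumes "f \<in> form_dom M tt F"
  shows "f \<in> L2 M" "F f \<in> L2 M" "f \<in> wL2 M tt" "F f \<in> wL2 M tt"
  using assms unfolding form_dom_eq[OF U] by (auto simp: wL2_def)

text \<open>In t + F^-1 t F the neighbours of \<open>\<Phi> m l p\<close> cancel, so it is an
  eigenvector with eigenvalue \<open>2 * ev m l > 0\<close>, and dividing by the eigenvalue solves
  the equation.\<close>

lemma form_onto:
  assumes "u \<in> V" shows "\<exists>v\<in>V. \<forall>f\<in>form_dom M tt F. form M tt F f v = ip M f u"
  using assms
proof (induction rule: V.induct)
  case (Phi p m l)
  define c where "c = 1 / (2 * ev m l)"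
  have ev: "0 < ev m l" using lam_pos[of m] by (simp add: ev_def)
  have v: "(\<lambda>x. of_real c * \<Phi> m l p x) \<in> V" by (intro V_scale V.Phi Phi)
  show ?case
  proof (intro bexI[OF _ v] ballI)
    fix f assume f: "f \<in> form_dom M tt F"
    note fD = form_domD[OF f]
    have \<Phi>: "\<Phi> m l p \<in> V" by (rule V.Phi[OF Phi])
    have "form M tt F f (\<Phi> m l p) = ip M f (\<lambda>x. of_real (tt x) * \<Phi> m l p x) + ip M f (Y m l p)"
      unfolding form_def wip_tt[of f] conj_tt_wip[OF conj_tt_Phi[OF Phi] fD(1)] ..
    also have "\<dots> = ip M f (\<lambda>x. of_real (tt x) * \<Phi> m l p x + Y m l p x)"
      by (rule ip.add_right[symmetric]) (intro fD V_L2 tt_V Y_V Phi \<Phi>)+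
    also have "(\<lambda>x. of_real (tt x) * \<Phi> m l p x + Y m l p x) = (\<lambda>x. of_real (2 * ev m l) * \<Phi> m l p x)"
      unfolding tt_Phi' Y_def by (rule ext) (simp add: algebra_simps)
    also have "ip M f \<dots> = of_real (2 * ev m l) * ip M f (\<Phi> m l p)"
      by (simp add: ip.scale_right[OF V_L2[OF \<Phi>] fD(1)])
    finally have "form M tt F f (\<Phi> m l p) = of_real (2 * ev m l) * ip M f (\<Phi> m l p)" .
    moreover have "form M tt F f (\<lambda>x. of_real c * \<Phi> m l p x) = of_real c * form M tt F f (\<Phi> m l p)"
      using form.scale_right[OF V_form_dom[OF \<Phi>] f, of "of_real c"] by simp
    ultimately have "form M tt F f (\<lambda>x. of_real c * \<Phi> m l p x) = of_real (c * (2 * ev m l)) * ip M f (\<Phi> m l p)"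
      by (simp only: of_real_mult mult.assoc)
    also have "c * (2 * ev m l) = 1" using ev by (simp add: c_def)
    finally show "form M tt F f (\<lambda>x. of_real c * \<Phi> m l p x) = ip M f (\<Phi> m l p)" by simp
  qed
next
  case (add u u')
  from add.IH(1) obtain v where v: "v \<in> V" "\<forall>f\<in>form_dom M tt F. form M tt F f v = ip M f u" by (rule bexE)
  from add.IH(2) obtain v' where v': "v' \<in> V" "\<forall>f\<in>form_dom M tt F. form M tt F f v' = ip M f u'" by (rule bexE)
  show ?case
  proof (intro bexI[OF _ V.add[OF v(1) v'(1)]] ballI)
    fix f assume f: "f \<in> form_dom M tt F"
    have "form M tt F f (\<lambda>x. v x + v' x) = form M tt F f v + form M tt F f v'"
      by (intro form.add_right V_form_dom v v' f)
    also have "\<dots> = ip M f u + ip M f u'" using v(2) v'(2) f by simp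
    also have "\<dots> = ip M f (\<lambda>x. u x + u' x)"
      by (rule ip.add_right[symmetric]) (intro V_L2 add.hyps form_domD(1)[OF f])+
    finally show "form M tt F f (\<lambda>x. v x + v' x) = ip M f (\<lambda>x. u x + u' x)" .
  qed
qed

lemma wip_sq_F_diff:
  assumes f: "f \<in> form_dom M tt F" and g: "g \<in> form_dom M tt F"
  shows "wip.sq M tt (F (\<lambda>x. f x - g x)) = wip.sq M tt (\<lambda>x. F f x - F g x)"
proof -
  note fD = form_domD[OF f] and gD = form_domD[OF g]
  show ?thesis unfolding wip.sq_def
    using unitary_diff[OF U fD(1) gD(1)] ip.diff_closed[OF fD(2) gD(2)] unitary_closed[OF U ip.diff_closed[OF fD(1) gD(1)]]
    by (intro arg_cong[of _ _ Re] wip_cong_AE) (auto intro: L2_measurable)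
qed

text \<open>\<open>wip_closed\<close> is applied to \<open>g n\<close> and to \<open>F (g n)\<close>
  separately; unitarity makes the second sequence null in \<open>L2\<close> as well.\<close>

lemma form_closed:
  fixes g :: "nat \<Rightarrow> 'a \<Rightarrow> complex"
  assumes g: "\<And>n. g n \<in> form_dom M tt F" and null: "(\<lambda>n. ip.sq M (g n)) \<longlonglongrightarrow> 0"
    and cauchy: "\<And>e. e > 0 \<Longrightarrow> \<exists>N. \<forall>n\<ge>N. form.sq (\<lambda>x. g n x - g N x) < e"
  shows "(\<lambda>n. form.sq (g n)) \<longlonglongrightarrow> 0"
proof -
  note gD = form_domD[OF g]
  have le: "wip.sq M tt (\<lambda>x. g n x - g N x) \<le> form.sq (\<lambda>x. g n x - g N x)"
    "wip.sq M tt (\<lambda>x. F (g n) x - F (g N) x) \<le> form.sq (\<lambda>x. g n x - g N x)" for n N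
    unfolding form_sq wip_sq_F_diff[OF g g]
    using wip.sq_nonneg[OF wip.diff_closed[OF gD(3) gD(3)], of n N] wip.sq_nonneg[OF wip.diff_closed[OF gD(4) gD(4)], of n N] by auto
  have "(\<lambda>n. wip.sq M tt (g n)) \<longlonglongrightarrow> 0"
  proof (rule wip_closed[OF _ tt_nonneg gD(3) null])
    fix e :: real assume "e > 0"
    from cauchy[OF this] obtain N where "\<forall>n\<ge>N. form.sq (\<lambda>x. g n x - g N x) < e" by (rule exE)
    then show "\<exists>N. \<forall>n\<ge>N. wip.sq M tt (\<lambda>x. g n x - g N x) < e" using le(1) by (intro exI[of _ N]) (auto intro: le_less_trans)
  qed simp
  moreover have "(\<lambda>n. wip.sq M tt (F (g n))) \<longlonglongrightarrow> 0"
  proof (rule wip_closed[OF _ tt_nonneg gD(4)])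
    show "(\<lambda>n. ip.sq M (F (g n))) \<longlonglongrightarrow> 0" using null by (simp add: unitary_sq[OF U gD(1)])
    fix e :: real assume "e > 0"
    from cauchy[OF this] obtain N where "\<forall>n\<ge>N. form.sq (\<lambda>x. g n x - g N x) < e" by (rule exE)
    then show "\<exists>N. \<forall>n\<ge>N. wip.sq M tt (\<lambda>x. F (g n) x - F (g N) x) < e" using le(2) by (intro exI[of _ N]) (auto intro: le_less_trans)
  qed simp
  ultimately show ?thesis unfolding form_sq using tendsto_add[of _ 0 sequentially _ 0] by fastforce
qed

text \<open>The form error is a sum of two nonnegative weighted errors, so convergence in the form
  gives convergence of both weighted norms, and \<open>V_uncertainty\<close> passes to the
  limit.\<close>

lemma uncertainty_form:
  assumes f: "f \<in> form_dom M tt F"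
  shows "((lam 0 + 1) * ip.sq M f)\<^sup>2 \<le> wip.sq M tt f * wip.sq M tt (F f)"
proof -
  note fD = form_domD[OF f]
  have "\<exists>v :: nat \<Rightarrow> 'a \<Rightarrow> complex. (\<forall>n. v n \<in> V) \<and>
    (\<lambda>n. ip.sq M (\<lambda>x. f x - v n x)) \<longlonglongrightarrow> 0 \<and> (\<lambda>n. form.sq (\<lambda>x. f x - v n x)) \<longlonglongrightarrow> 0"
  proof (rule form_core[OF hermitian_form_ip form.hermitian_form_axioms])
    show "form_dom M tt F \<subseteq> L2 M" using form_domD by blast
    show "V \<subseteq> form_dom M tt F" using V_form_dom by blast
    show "0 < 2 * (lam 0 + 1)" using lam0_pos by simp
    show "\<exists>v\<in>V. ip.sq M (\<lambda>x. f x - v x) < e" if "f \<in> L2 M" "e > 0" for f e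
      using closVD[OF V_dense[OF that(1)] that(2)] by blast
    show "2 * (lam 0 + 1) * ip.sq M v \<le> form.sq v" if "v \<in> V" for v
      unfolding form_sq by (rule V_uncertainty(2)[OF that])
    show "\<exists>v\<in>V. \<forall>f\<in>form_dom M tt F. form M tt F f v = ip M f u" if "u \<in> V" for u
      by (rule form_onto[OF that])
  qed (fact V.add V_scale form_closed f)+
  then obtain v :: "nat \<Rightarrow> 'a \<Rightarrow> complex" where vV: "\<And>n. v n \<in> V" and A: "(\<lambda>n. ip.sq M (\<lambda>x. f x - v n x)) \<longlonglongrightarrow> 0"
    and B: "(\<lambda>n. form.sq (\<lambda>x. f x - v n x)) \<longlonglongrightarrow> 0" by blast
  note vf = V_form_dom[OF vV]
  note vD = form_domD[OF vf]
  have le: "0 \<le> wip.sq M tt (\<lambda>x. f x - v n x)" "0 \<le> wip.sq M tt (\<lambda>x. F f x - F (v n) x)"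
    "form.sq (\<lambda>x. f x - v n x) = wip.sq M tt (\<lambda>x. f x - v n x) + wip.sq M tt (\<lambda>x. F f x - F (v n) x)" for n
    unfolding form_sq wip_sq_F_diff[OF f vf]
    by (auto intro: wip.sq_nonneg wip.diff_closed fD vD)
  have "(\<lambda>n. wip.sq M tt (\<lambda>x. f x - v n x)) \<longlonglongrightarrow> 0"
    by (rule tendsto_sandwich[OF _ _ tendsto_const B]) (use le in \<open>auto intro!: always_eventually\<close>)
  then have X: "(\<lambda>n. wip.sq M tt (v n)) \<longlonglongrightarrow> wip.sq M tt f"
    by (rule wip.sq_tendsto[OF fD(3) vD(3)])
  have "(\<lambda>n. wip.sq M tt (\<lambda>x. F f x - F (v n) x)) \<longlonglongrightarrow> 0"
    by (rule tendsto_sandwich[OF _ _ tendsto_const B]) (use le in \<open>auto intro!: always_eventually\<close>)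
  then have Z: "(\<lambda>n. wip.sq M tt (F (v n))) \<longlonglongrightarrow> wip.sq M tt (F f)"
    by (rule wip.sq_tendsto[OF fD(4) vD(4)])
  have N: "(\<lambda>n. ip.sq M (v n)) \<longlonglongrightarrow> ip.sq M f"
    by (rule ip.sq_tendsto[OF fD(1) vD(1) A])
  show ?thesis
  proof (rule LIMSEQ_le)
    show "(\<lambda>n. ((lam 0 + 1) * ip.sq M (v n))\<^sup>2) \<longlonglongrightarrow> ((lam 0 + 1) * ip.sq M f)\<^sup>2"
      by (intro tendsto_power tendsto_mult tendsto_const N)
    show "(\<lambda>n. wip.sq M tt (v n) * wip.sq M tt (F (v n))) \<longlonglongrightarrow> wip.sq M tt f * wip.sq M tt (F f)"
      by (intro tendsto_mult X Z)
    show "\<exists>N. \<forall>n\<ge>N. ((lam 0 + 1) * ip.sq M (v n))\<^sup>2 \<le> wip.sq M tt (v n) * wip.sq M tt (F (v n))"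
      using V_uncertainty(1)[OF vV] by blast
  qed
qed

lemma form_domI:
  assumes f: "f \<in> L2 M" and "integrable M (\<lambda>x. norm x powr a * (cmod (f x))\<^sup>2)"
    and "integrable M (\<lambda>x. norm x powr a * (cmod (F f x))\<^sup>2)"
  shows "f \<in> form_dom M tt F"
proof -
  have "(\<lambda>x. of_real (sqrt (tt x)) * g x) \<in> L2 M" if g: "g \<in> L2 M" and int: "integrable M (\<lambda>x. norm x powr a * (cmod (g x))\<^sup>2)" for g
  proof -
    have "(\<lambda>x. of_real (sqrt (tt x)) * g x) \<in> borel_measurable M"
      using L2_measurable[OF g] by measurable
    moreover have "(\<lambda>x. (cmod (of_real (sqrt (tt x)) * g x))\<^sup>2) = (\<lambda>x. 2 / a * (norm x powr a * (cmod (g x))\<^sup>2))"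
      by (rule ext) (simp add: norm_mult power_mult_distrib, simp add: tt_def)
    ultimately show ?thesis using integrable_mult_right[OF int, of "2 / a"] by (simp add: L2_def)
  qed
  from this[OF f assms(2)] this[OF unitary_closed[OF U f] assms(3)] f show ?thesis by (simp add: form_dom_def)
qed

lemma uncertainty_product:
  fixes f :: "'a \<Rightarrow> complex"
  defines "\<kappa> \<equiv> (2 * mult_index P k + real DIM('a) + a - 2) / 2"
  assumes f: "f \<in> L2 M" and I: "integrable M (\<lambda>x. norm x powr a * (cmod (f x))\<^sup>2)"
    and J: "integrable M (\<lambda>x. norm x powr a * (cmod (F f x))\<^sup>2)"
  shows "(\<kappa> * ip.sq M f)\<^sup>2 \<le> (LINT x|M. norm x powr a * (cmod (f x))\<^sup>2) * (LINT x|M. norm x powr a * (cmod (F f x))\<^sup>2)"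
proof -
  have tt: "wip.sq M tt g = 2 / a * (LINT x|M. norm x powr a * (cmod (g x))\<^sup>2)" for g
    unfolding sq_wip[OF tt_nonneg] tt_def mult.assoc by (rule integral_mult_right_zero)
  \<comment> \<open>The factor a/2 undoes the normalization of \<open>tt\<close>, once in each of
    the two weighted norms.\<close>
  have lam: "\<kappa> = (lam 0 + 1) * (a / 2)" unfolding \<kappa>_def lambda_def using a0 by (simp add: field_simps)
  have "(\<kappa> * ip.sq M f)\<^sup>2 = (a / 2)\<^sup>2 * ((lam 0 + 1) * ip.sq M f)\<^sup>2"
    unfolding lam by (simp add: power_mult_distrib power_divide)
  also have "\<dots> \<le> (a / 2)\<^sup>2 * (wip.sq M tt f * wip.sq M tt (F f))"
    by (intro mult_left_mono uncertainty_form form_domI f I J) auto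
  also have "\<dots> = (LINT x|M. norm x powr a * (cmod (f x))\<^sup>2) * (LINT x|M. norm x powr a * (cmod (F f x))\<^sup>2)"
    unfolding tt using a0 by (simp add: power2_eq_square)
  finally show ?thesis .
qed

lemma L2norm_powr:
  assumes g: "g \<in> borel_measurable M"
  shows "ennpowr (L2norm M (\<lambda>x. of_real (norm x powr (s * (a / 2))) * g x)) r =
    ennpowr (ennpowr (\<integral>\<^sup>+ x. ennreal ((norm x powr a) powr s * (cmod (g x))\<^sup>2) \<partial>M) (1 / 2)) r"
proof -
  have "(norm x powr (s * (a / 2)))\<^sup>2 = (norm x powr a) powr s" for x :: 'a
    by (simp add: power2_eq_square powr_add[symmetric] powr_powr mult.commute)
  then have "(cmod (of_real (norm x powr (s * (a / 2))) * g x))\<^sup>2 = (norm x powr a) powr s * (cmod (g x))\<^sup>2" for x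
    by (simp add: norm_mult power_mult_distrib)
  then show ?thesis by (simp only: L2norm_def)
qed

text \<open>The weight vanishes only at the origin, a null set. This rules out a zero factor next to
  an infinite one in the product of norms.\<close>

lemma nn_integral_weight_zero:
  assumes g: "g \<in> L2 M" and "(\<integral>\<^sup>+ x. ennreal ((norm x powr a) powr s * (cmod (g x))\<^sup>2) \<partial>M) = 0"
  shows "ip.sq M g = 0"
proof -
  have gm: "g \<in> borel_measurable M" by (rule L2_measurable[OF g])
  have "(\<lambda>x. ennreal ((norm x powr a) powr s * (cmod (g x))\<^sup>2)) \<in> borel_measurable M" using gm by measurable
  then have "AE x in M. ennreal ((norm x powr a) powr s * (cmod (g x))\<^sup>2) = 0"
    using assms(2) by (simp add: nn_integral_0_iff_AE)
  then have "AE x in M. (cmod (g x))\<^sup>2 = 0"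
    using AE_not_0 by eventually_elim (auto simp: mult_le_0_iff)
  then have "ip.sq M g = (LINT x|M. 0)" unfolding sq_ip using gm by (intro integral_cong_AE) auto
  then show ?thesis by simp
qed

lemma uncertainty_general:
  fixes f :: "'a \<Rightarrow> complex" and \<alpha> \<beta> :: real
  defines "\<kappa> \<equiv> (2 * mult_index P k + real DIM('a) + a - 2) / 2"
  assumes \<alpha>: "\<alpha> \<ge> 1" and \<beta>: "\<beta> \<ge> 1" and f: "f \<in> L2 M"
  shows "ennreal (\<kappa> powr (\<alpha> * \<beta> / (\<alpha> + \<beta>))) * L2norm M f \<le>
    ennpowr (L2norm M (\<lambda>x. of_real (norm x powr (\<alpha> * (a / 2))) * f x)) (\<beta> / (\<alpha> + \<beta>))
     * ennpowr (L2norm M (\<lambda>x. of_real (norm x powr (\<beta> * (a / 2))) * F f x)) (\<alpha> / (\<alpha> + \<beta>))"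
proof -
  define S where "S = ip.sq M f"
  have Ff: "F f \<in> L2 M" by (rule unitary_closed[OF U f])
  have SF: "ip.sq M (F f) = S" unfolding S_def by (rule unitary_sq[OF U f])
  have S0: "0 \<le> S" unfolding S_def by (rule ip.sq_nonneg[OF f])
  have \<kappa>: "0 < \<kappa>" using dim by (simp add: \<kappa>_def)
  have fm: "f \<in> borel_measurable M" "F f \<in> borel_measurable M" using L2_measurable f Ff by auto
  have norm_f: "L2norm M f = ennreal (S powr (1 / 2))"
  proof -
    have "(\<integral>\<^sup>+ x. ennreal ((cmod (f x))\<^sup>2) \<partial>M) = ennreal S"
      unfolding S_def sq_ip using f by (intro nn_integral_eq_integral) (auto simp: L2_def)
    then show ?thesis unfolding L2norm_def using S0 by (simp only: ennpowr_ennreal)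
  qed
  define A where "A = (\<integral>\<^sup>+ x. ennreal ((norm x powr a) powr \<alpha> * (cmod (f x))\<^sup>2) \<partial>M)"
  define B where "B = (\<integral>\<^sup>+ x. ennreal ((norm x powr a) powr \<beta> * (cmod (F f x))\<^sup>2) \<partial>M)"
  \<comment> \<open>The exponents satisfy \<open>p + q = 1\<close>, which splits the power of
    \<open>S\<close>, and \<open>\<alpha> * p = \<beta> * q\<close>. The product inequality is
    raised to half of this common exponent, so that each factor meets its own Jensen bound.\<close>
  define p where "p = \<beta> / (\<alpha> + \<beta>)"
  define q where "q = \<alpha> / (\<alpha> + \<beta>)"
  have ab: "\<alpha> + \<beta> \<noteq> 0" using \<alpha> \<beta> by simp
  have pq: "p + q = 1" "\<alpha> * p = \<alpha> * \<beta> / (\<alpha> + \<beta>)" "\<beta> * q = \<alpha> * \<beta> / (\<alpha> + \<beta>)"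
    using ab by (simp_all add: p_def q_def field_simps add_divide_distrib[symmetric])
  have "ennreal (\<kappa> powr (\<alpha> * p)) * ennreal (S powr (1 / 2)) \<le> ennpowr (ennpowr A (1 / 2)) p * ennpowr (ennpowr B (1 / 2)) q"
  proof (cases "S = 0")
    case True
    then show ?thesis by simp
  next
    case False
    then have S: "0 < S" using S0 by simp
    have A0: "A \<noteq> 0" using nn_integral_weight_zero[OF f] False unfolding A_def S_def by blast
    have B0: "B \<noteq> 0" using nn_integral_weight_zero[OF Ff] False unfolding B_def SF by blast
    show ?thesis
    proof (cases "A = \<infinity> \<or> B = \<infinity>")
      case True
      \<comment> \<open>Needed because \<open>0 * \<infinity> = 0\<close> in \<open>ennreal\<close>:
        an infinite factor makes the product infinite only if the other one is nonzero.\<close>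
      have "ennpowr (ennpowr A (1 / 2)) p \<noteq> 0" "ennpowr (ennpowr B (1 / 2)) q \<noteq> 0"
        using A0 B0 ennpowr_eq_0 by blast+
      then have "ennpowr (ennpowr A (1 / 2)) p * ennpowr (ennpowr B (1 / 2)) q = \<infinity>"
        using True by (auto simp: ennpowr_top ennreal_mult_eq_top_iff)
      then show ?thesis by simp
    next
      case False
      have wm: "(\<lambda>x. norm x powr a) \<in> borel_measurable M" by simp
      have IA: "integrable M (\<lambda>x. (norm x powr a) powr \<alpha> * (cmod (f x))\<^sup>2)"
        using False fm unfolding A_def by (intro integrableI_nonneg) (auto simp: less_top)
      have IB: "integrable M (\<lambda>x. (norm x powr a) powr \<beta> * (cmod (F f x))\<^sup>2)"
        using False fm unfolding B_def by (intro integrableI_nonneg) (auto simp: less_top)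
      note Af = moment_interpolation[OF f wm powr_ge_zero \<alpha> IA] and Bf = moment_interpolation[OF Ff wm powr_ge_zero \<beta> IB]
      define a' where "a' = (LINT x|M. (norm x powr a) powr \<alpha> * (cmod (f x))\<^sup>2)"
      define b' where "b' = (LINT x|M. (norm x powr a) powr \<beta> * (cmod (F f x))\<^sup>2)"
      define I where "I = (LINT x|M. norm x powr a * (cmod (f x))\<^sup>2)"
      define J where "J = (LINT x|M. norm x powr a * (cmod (F f x))\<^sup>2)"
      have Aa: "A = ennreal a'" and Bb: "B = ennreal b'"
        unfolding A_def B_def a'_def b'_def using IA IB by (auto intro!: nn_integral_eq_integral)
      have "0 \<le> I" "0 \<le> J" unfolding I_def J_def by (auto intro!: integral_nonneg_AE)
      have IJ: "(\<kappa> * S)\<^sup>2 \<le> I * J"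
        unfolding \<kappa>_def S_def I_def J_def by (rule uncertainty_product[OF f Af(1) Bf(1)])
      moreover have "0 < (\<kappa> * S)\<^sup>2" using \<kappa> S by simp
      ultimately have "0 < I * J" by linarith
      then have I: "0 < I" and J: "0 < J" using \<open>0 \<le> I\<close> \<open>0 \<le> J\<close> by (auto simp: zero_less_mult_iff)
      have Ale: "S * (I / S) powr \<alpha> \<le> a'"
        using Af(2) S I unfolding S_def I_def a'_def by simp
      have Ble: "S * (J / S) powr \<beta> \<le> b'"
        using Bf(2) S J unfolding SF J_def b'_def by simp
      have "0 < S * (I / S) powr \<alpha>" "0 < S * (J / S) powr \<beta>" using S I J by simp_all
      then have a': "0 \<le> a'" and b': "0 \<le> b'" using Ale Ble by linarith+
      have p0: "0 \<le> p" "0 \<le> q" using \<alpha> \<beta> by (simp_all add: p_def q_def)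
      have "\<kappa>\<^sup>2 \<le> (I / S) * (J / S)"
        using IJ S by (simp add: field_simps power2_eq_square)
      then have "(\<kappa>\<^sup>2) powr (\<alpha> * p / 2) \<le> ((I / S) * (J / S)) powr (\<alpha> * p / 2)"
        using \<alpha> p0 by (intro powr_mono2) auto
      moreover have "(\<kappa>\<^sup>2) powr (\<alpha> * p / 2) = \<kappa> powr (\<alpha> * p)"
      proof -
        have "\<kappa>\<^sup>2 = \<kappa> powr 2" using \<kappa> by simp
        then have "(\<kappa>\<^sup>2) powr (\<alpha> * p / 2) = \<kappa> powr (2 * (\<alpha> * p / 2))" by (simp only: powr_powr)
        then show ?thesis by simp
      qed
      ultimately have \<kappa>le: "\<kappa> powr (\<alpha> * p) \<le> ((I / S) * (J / S)) powr (\<alpha> * p / 2)" by simp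
      have "\<kappa> powr (\<alpha> * p) * S powr (1 / 2) \<le> ((I / S) * (J / S)) powr (\<alpha> * p / 2) * S powr (1 / 2)"
        by (intro mult_right_mono \<kappa>le) simp
      also have "\<dots> = (S * (I / S) powr \<alpha>) powr (p / 2) * (S * (J / S) powr \<beta>) powr (q / 2)"
      proof -
        have "S powr (1 / 2) = S powr (p / 2) * S powr (q / 2)"
          using pq(1) by (simp add: powr_add[symmetric] add_divide_distrib[symmetric])
        moreover have "\<beta> * (q / 2) = \<alpha> * p / 2" "\<alpha> * (p / 2) = \<alpha> * p / 2" using pq by simp_all
        moreover have "((I / S) * (J / S)) powr (\<alpha> * p / 2) = (I / S) powr (\<alpha> * p / 2) * (J / S) powr (\<alpha> * p / 2)"
          by (rule powr_mult)
        moreover have "(S * (I / S) powr \<alpha>) powr (p / 2) = S powr (p / 2) * (I / S) powr (\<alpha> * (p / 2))"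
          "(S * (J / S) powr \<beta>) powr (q / 2) = S powr (q / 2) * (J / S) powr (\<beta> * (q / 2))"
          by (simp_all only: powr_powr powr_mult)
        ultimately show ?thesis by (simp only: mult_ac)
      qed
      also have "\<dots> \<le> a' powr (p / 2) * b' powr (q / 2)"
        using Ale Ble S I J p0 by (intro mult_mono powr_mono2) auto
      finally have "\<kappa> powr (\<alpha> * p) * S powr (1 / 2) \<le> a' powr (p / 2) * b' powr (q / 2)" .
      then show ?thesis
        unfolding Aa Bb by (simp add: ennpowr_ennreal a' b' powr_powr ennreal_mult[symmetric] ennreal_leI)
    qed
  qed
  then show ?thesis
    unfolding L2norm_powr[OF fm(1)] L2norm_powr[OF fm(2)] norm_f A_def[symmetric] B_def[symmetric] p_def q_def
    by (simp add: times_divide_eq_right)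
qed

end

theorem proposition5p3:
  fixes R P :: "(real ^ 'n) set"
    and k :: "real ^ 'n \<Rightarrow> real"
    and a \<alpha> \<beta> :: real
    and F :: "(real ^ 'n \<Rightarrow> complex) \<Rightarrow> (real ^ 'n \<Rightarrow> complex)"
    and f :: "real ^ 'n \<Rightarrow> complex"
  assumes "reduced_root_system R"
    and "positive_subsystem R P"
    and "multiplicity_function R k"
    and "a > 0"
    and "a + 2 * mult_index P k + real CARD('n) > 2"
    and "\<alpha> \<ge> 1" and "\<beta> \<ge> 1"
    and "is_ka_Fourier P k a F"
    and "f \<in> L2 (mu P k a)"
  shows
    "ennpowr (L2norm (mu P k a) (\<lambda>x. of_real (norm x powr (\<alpha> * (a / 2))) * f x)) (\<beta> / (\<alpha> + \<beta>))
     * ennpowr (L2norm (mu P k a) (\<lambda>x. of_real (norm x powr (\<beta> * (a / 2))) * F f x)) (\<alpha> / (\<alpha> + \<beta>))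
     \<ge> ennreal (((2 * mult_index P k + real CARD('n) + a - 2) / 2) powr (\<alpha> * \<beta> / (\<alpha> + \<beta>)))
       * L2norm (mu P k a) f"
proof -
  have PR: "P \<subseteq> R" using assms(2) by (auto simp: positive_subsystem_def)
  interpret ka_fourier P k a F
  proof
    show "finite P" using PR assms(1) finite_subset by (auto simp: reduced_root_system_def)
    show "0 \<notin> P" using PR assms(1) by (auto simp: reduced_root_system_def)
    show "0 \<le> k \<alpha>" if "\<alpha> \<in> P" for \<alpha> using that PR assms(3) by (auto simp: multiplicity_function_def)
  qed (use assms in auto)
  show ?thesis using uncertainty_general[OF assms(6,7,9)] by simp
qed

end
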